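(* Consider the Gaussian white noise model with true function $f_0\in L^2[0,1]$, and let $\alpha_n\in(0,1]$ with $n\alpha_n\to\infty$. Assign to $f$ a mean-zero Gaussian prior $\Pi$ in $L^2[0,1]$ with associated reproducing kernel Hilbert space (RKHS) $\mathbb H$. Suppose that $\varepsilon_n\to0$ satisfies $\varphi_{f_0}(\varepsilon_n)\le n\alpha_n\varepsilon_n^2$. Let the functional $\psi$ satisfy $\psi(f)=\psi(f_0)+\langle\psi_0,f-f_0\rangle_2+r(f,f_0)$ with $\psi_0\in L^2[0,1]$, and suppose there are measurable sets $A_n\subset\{f:\|f-f_0\|_2\le\varepsilon_n\}$ with $\Pi_{\alpha_n}(A_n\mid Y^n)=1+o_P(1)$ and $\sup_{f\in A_n}|t\sqrt{n\alpha_n}\,r(f,f_0)|=o_P(1)$ for every fixed $t\in\mathbb R$. Further assume that there exist sequences $\psi_n\in\mathbb H$ and $\zeta_n\to0$ such that $$\|\psi_n-\psi_0\|_2\le\zeta_n,\qquad\|\psi_n\|_{\mathbb H}\le\sqrt{n\alpha_n}\,\zeta_n,\qquad\sqrt{n\alpha_n}\,\varepsilon_n\zeta_n\to0.$$ Then, with $\hat\psi=\psi(f_0)+\frac1{\sqrt n}\sum_{k\ge1}\langle\psi_0,\phi_k\rangle_2\,\varepsilon_k$ (where the $\varepsilon_k$ are the noise variables of the model), the $\alpha_n$-posterior distribution of $\sqrt{n\alpha_n}(\psi(f)-\hat\psi)$ converges weakly in $P_0$-probability to a Gaussian distribution with mean $0$ and variance $\|\psi_0\|_2^2$.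
   Context: Gaussian white noise model: for an orthonormal basis $(\phi_k)_{k\ge1}$ of $L^2[0,1]$, one observes $Y^n=(Y^n_k)_{k\ge1}$, $Y_k^n=f_k+\frac1{\sqrt n}\varepsilon_k$, $f_k=\langle f,\phi_k\rangle_2$, $\varepsilon_k$ i.i.d. $\mathcal N(0,1)$ (the noise variables $\varepsilon_k$, indexed by $k$, are distinct from the rate $\varepsilon_n$). Up to an additive term free of $f$, $\ell_n(f)=n\sum_kf_kY^n_k-\frac n2\|f\|_2^2$. $P_0$ is the law under $f_0$; $o_P(1)$ is in $P_0$-probability. The $\alpha_n$-posterior is $\Pi_{\alpha_n}(B\mid Y^n)=\int_Be^{\alpha_n\ell_n}d\Pi/\int e^{\alpha_n\ell_n}d\Pi$. For a mean-zero Gaussian random element $W$ of a Banach space $(\mathbb B,\|\cdot\|)$ with law $\Pi$ and RKHS $(\mathbb H,\|\cdot\|_{\mathbb H})$, the concentration function at $\eta_0\in\mathbb B$ is $$\varphi_{\eta_0}(\varepsilon)=-\log\Pi(\|W\|\le\varepsilon)+\tfrac12\inf_{h\in\mathbb H:\|h-\eta_0\|<\varepsilon}\|h\|_{\mathbb H}^2;$$ here $\mathbb B=L^2[0,1]$. A data-dependent law $Q_Y$ on $\mathbb R$ converges weakly in $P_0$-probability to $\mathcal N(0,V)$ if $d_{BL}(Q_Y,\mathcal N(0,V))\to0$ in $P_0$-probability, with $d_{BL}$ the bounded Lipschitz distance; the $\alpha_n$-posterior distribution of a function of $f$ is the push-forward of $\Pi_{\alpha_n}(\cdot\mid Y^n)$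 by that function. *)

theory Defs
  imports "HOL-Probability.Probability"
begin

section \<open>The Hilbert space \<open>L\<^sup>2[0,1]\<close>\<close>

abbreviation unit_lebesgue :: "real measure" where
  "unit_lebesgue \<equiv> lebesgue_on {0..1}"

definition square_integrable :: "(real \<Rightarrow> real) \<Rightarrow> bool" where
  "square_integrable f \<longleftrightarrow>
     f \<in> borel_measurable unit_lebesgue \<and> integrable unit_lebesgue (\<lambda>x. (f x)\<^sup>2)"

definition L2_rel :: "(real \<Rightarrow> real) \<Rightarrow> (real \<Rightarrow> real) \<Rightarrow> bool" where
  "L2_rel f g \<longleftrightarrow>
     square_integrable f \<and> square_integrable g \<and> (AE x in unit_lebesgue. f x = g x)"

lemma square_integrable_zero: "square_integrable (\<lambda>x. 0)"
  by (simp add: square_integrable_def)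

lemma square_integrable_scale:
  assumes "square_integrable f" shows "square_integrable (\<lambda>x. c * f x)"
  using assms unfolding square_integrable_def by (auto simp: power_mult_distrib)

lemma integrable_mult_of_square_integrable:
  assumes "square_integrable f" "square_integrable g"
  shows "integrable unit_lebesgue (\<lambda>x. f x * g x)"
proof (rule Bochner_Integration.integrable_bound)
  show "integrable unit_lebesgue (\<lambda>x. (f x)\<^sup>2 + (g x)\<^sup>2)"
    using assms by (auto simp: square_integrable_def)
  show "(\<lambda>x. f x * g x) \<in> borel_measurable unit_lebesgue"
    using assms by (auto simp: square_integrable_def)
  have "\<bar>a * b\<bar> \<le> a\<^sup>2 + b\<^sup>2" for a b :: real
  proof -
    have "2 * (\<bar>a\<bar> * \<bar>b\<bar>) \<le> a\<^sup>2 + b\<^sup>2"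
      using sum_squares_bound[of "\<bar>a\<bar>" "\<bar>b\<bar>"] by (simp add: mult.assoc)
    moreover have "0 \<le> \<bar>a\<bar> * \<bar>b\<bar>" by simp
    ultimately show ?thesis unfolding abs_mult by linarith
  qed
  then show "AE x in unit_lebesgue. norm (f x * g x) \<le> norm ((f x)\<^sup>2 + (g x)\<^sup>2)"
    by (auto intro!: AE_I2 simp: abs_of_nonneg)
qed

lemma square_integrable_add:
  assumes "square_integrable f" "square_integrable g"
  shows "square_integrable (\<lambda>x. f x + g x)"
proof -
  have "integrable unit_lebesgue (\<lambda>x. (f x)\<^sup>2 + (g x)\<^sup>2 + 2 * (f x * g x))"
    using assms integrable_mult_of_square_integrable[OF assms]
    by (auto simp: square_integrable_def)
  also have "(\<lambda>x. (f x)\<^sup>2 + (g x)\<^sup>2 + 2 * (f x * g x)) = (\<lambda>x. (f x + g x)\<^sup>2)"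
    by (auto simp: power2_sum)
  finally show ?thesis using assms by (auto simp: square_integrable_def)
qed

quotient_type L2 = "real \<Rightarrow> real" / partial: L2_rel
proof (rule part_equivpI)
  show "\<exists>f. L2_rel f f"
    using square_integrable_zero by (auto simp: L2_rel_def)
  show "symp L2_rel"
    by (rule sympI) (auto simp: L2_rel_def elim: AE_mp)
  show "transp L2_rel"
    by (rule transpI) (auto simp: L2_rel_def elim: AE_mp)
qed

instantiation L2 :: real_inner
begin

lift_definition zero_L2 :: L2 is "\<lambda>x. 0"
  by (simp add: L2_rel_def square_integrable_zero)

lift_definition plus_L2 :: "L2 \<Rightarrow> L2 \<Rightarrow> L2" is "\<lambda>f g x. f x + g x"
  by (auto simp: L2_rel_def square_integrable_add)

lift_definition scaleR_L2 :: "real \<Rightarrow> L2 \<Rightarrow> L2" is "\<lambda>c f x. c * f x"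
  by (auto simp: L2_rel_def square_integrable_scale)

lift_definition uminus_L2 :: "L2 \<Rightarrow> L2" is "\<lambda>f x. - f x"
  by (auto simp: L2_rel_def square_integrable_def)

lift_definition inner_L2 :: "L2 \<Rightarrow> L2 \<Rightarrow> real" is "\<lambda>f g. \<integral>x. f x * g x \<partial>unit_lebesgue"
  by (auto intro!: integral_cong_AE simp: L2_rel_def square_integrable_def)

definition minus_L2 :: "L2 \<Rightarrow> L2 \<Rightarrow> L2" where
  "minus_L2 f g = f + - g"

definition norm_L2 :: "L2 \<Rightarrow> real" where
  "norm_L2 f = sqrt (inner f f)"

definition sgn_L2 :: "L2 \<Rightarrow> L2" where
  "sgn_L2 f = scaleR (inverse (norm f)) f"

definition dist_L2 :: "L2 \<Rightarrow> L2 \<Rightarrow> real" where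
  "dist_L2 f g = norm (f - g)"

definition uniformity_L2 :: "(L2 \<times> L2) filter" where
  "uniformity_L2 = (INF e\<in>{0 <..}. principal {(f, g). dist f g < e})"

definition open_L2 :: "L2 set \<Rightarrow> bool" where
  "open_L2 S = (\<forall>f\<in>S. \<forall>\<^sub>F (f', g) in uniformity. f' = f \<longrightarrow> g \<in> S)"

instance
proof
  fix f g h :: L2 and a b :: real
  show "f + g + h = f + (g + h)"
    by transfer (auto simp: L2_rel_def square_integrable_add add.assoc)
  show "f + g = g + f"
    by transfer (auto simp: L2_rel_def square_integrable_add add.commute)
  show "0 + f = f"
    by transfer (auto simp: L2_rel_def)
  show "- f + f = 0"
    by transfer (auto simp: L2_rel_def square_integrable_def)
  show "f - g = f + - g"
    by (simp add: minus_L2_def)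
  show "a *\<^sub>R (f + g) = a *\<^sub>R f + a *\<^sub>R g"
    by transfer
      (auto simp: L2_rel_def distrib_left intro!: square_integrable_add square_integrable_scale)
  show "(a + b) *\<^sub>R f = a *\<^sub>R f + b *\<^sub>R f"
    by transfer
      (auto simp: L2_rel_def distrib_right intro!: square_integrable_add square_integrable_scale)
  show "a *\<^sub>R b *\<^sub>R f = (a * b) *\<^sub>R f"
    by transfer (auto simp: L2_rel_def mult.assoc intro!: square_integrable_scale)
  show "1 *\<^sub>R f = f"
    by transfer (auto simp: L2_rel_def)
  show "sgn f = scaleR (inverse (norm f)) f"
    by (rule sgn_L2_def)
  show "dist f g = norm (f - g)"
    by (rule dist_L2_def)
  show "norm f = sqrt (inner f f)"
    by (rule norm_L2_def)
  show "inner f g = inner g f"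
    by transfer (simp add: mult.commute)
  show "inner (f + g) h = inner f h + inner g h"
    by transfer
      (auto simp: L2_rel_def distrib_right intro!: Bochner_Integration.integral_add integrable_mult_of_square_integrable)
  show "inner (a *\<^sub>R f) g = a * inner f g"
    by transfer (simp add: mult.assoc)
  show "0 \<le> inner f f"
    by transfer simp
  show "(inner f f = 0) = (f = 0)"
  proof (transfer)
    fix f assume "L2_rel f f"
    then have f: "square_integrable f" by (simp add: L2_rel_def)
    then have "integrable unit_lebesgue (\<lambda>x. f x * f x)"
      by (intro integrable_mult_of_square_integrable)
    then have "(\<integral>x. f x * f x \<partial>unit_lebesgue) = 0 \<longleftrightarrow> (AE x in unit_lebesgue. f x * f x = 0)"
      by (intro integral_nonneg_eq_0_iff_AE) auto
    then show "((\<integral>x. f x * f x \<partial>unit_lebesgue) = 0) = L2_rel f (\<lambda>x. 0)"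
      using f square_integrable_zero by (simp add: L2_rel_def)
  qed
next
  show "uniformity = (INF e\<in>{0 <..}. principal {(f :: L2, g). dist f g < e})"
    by (rule uniformity_L2_def)
  show "open U = (\<forall>f\<in>U. \<forall>\<^sub>F (f', g) in uniformity. f' = f \<longrightarrow> g \<in> U)" for U :: "L2 set"
    by (rule open_L2_def)
qed

end

definition orthonormal_basis :: "(nat \<Rightarrow> 'b::real_inner) \<Rightarrow> bool" where
  "orthonormal_basis \<phi> \<longleftrightarrow>
     (\<forall>i j. inner (\<phi> i) (\<phi> j) = (if i = j then 1 else 0)) \<and> closure (span (range \<phi>)) = UNIV"


section \<open>Gaussian measures, RKHS and concentration function\<close>

text \<open>The parameter \<open>V\<close> is the variance; \<open>V = 0\<close> gives the Dirac measure.\<close>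

definition normal_law :: "real \<Rightarrow> real \<Rightarrow> real measure" where
  "normal_law m V =
     (if V = 0 then return borel m else density lborel (\<lambda>x. ennreal (normal_density m (sqrt V) x)))"

definition mean_zero_gaussian :: "'b::real_normed_vector measure \<Rightarrow> bool" where
  "mean_zero_gaussian \<mu> \<longleftrightarrow> prob_space \<mu> \<and> sets \<mu> = sets borel \<and>
     (\<forall>L :: 'b \<Rightarrow> real. bounded_linear L \<longrightarrow> (\<exists>V\<ge>0. distr \<mu> borel L = normal_law 0 V))"

definition has_pettis_integral ::
    "'a measure \<Rightarrow> ('a \<Rightarrow> 'b::real_normed_vector) \<Rightarrow> 'b \<Rightarrow> bool" where
  "has_pettis_integral M F h \<longleftrightarrow>
     (\<forall>L :: 'b \<Rightarrow> real. bounded_linear L \<longrightarrow>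
        integrable M (\<lambda>w. L (F w)) \<and> (\<integral>w. L (F w) \<partial>M) = L h)"

text \<open>The closure in \<open>L\<^sup>2(\<mu>)\<close> of the dual space, whose elements are regarded as random variables.\<close>

definition dual_closure :: "'b::real_normed_vector measure \<Rightarrow> ('b \<Rightarrow> real) set" where
  "dual_closure \<mu> = {\<xi> \<in> borel_measurable \<mu>. integrable \<mu> (\<lambda>w. (\<xi> w)\<^sup>2) \<and>
     (\<forall>e>0. \<exists>L :: 'b \<Rightarrow> real. bounded_linear L \<and>
        (\<integral>\<^sup>+ w. ennreal ((\<xi> w - L w)\<^sup>2) \<partial>\<mu>) < ennreal e)}"

text \<open>
  The RKHS is the completion of \<open>{E[W L(W)] | L in the dual space}\<close> (Pettis integrals) under the
  inner product \<open>\<langle>E[W L(W)], E[W L'(W)]\<rangle> = E[L(W) L'(W)]\<close>.  It is realised inside the Banach space as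
  \<open>{E[W \<xi>(W)] | \<xi> \<in> dual_closure \<mu>}\<close>, with the norm of \<open>E[W \<xi>(W)]\<close> equal to the \<open>L\<^sup>2(\<mu>)\<close> norm
  of \<open>\<xi>\<close>; lemmas \<open>dual_closure_unique\<close> and \<open>rkhs_norm_eq\<close> show that this is well defined.
\<close>

definition rkhs :: "'b::real_normed_vector measure \<Rightarrow> 'b set" where
  "rkhs \<mu> = {h. \<exists>\<xi>\<in>dual_closure \<mu>. has_pettis_integral \<mu> (\<lambda>w. \<xi> w *\<^sub>R w) h}"

definition rkhs_norm :: "'b::real_normed_vector measure \<Rightarrow> 'b \<Rightarrow> real" where
  "rkhs_norm \<mu> h = (THE r. \<exists>\<xi>\<in>dual_closure \<mu>.
     has_pettis_integral \<mu> (\<lambda>w. \<xi> w *\<^sub>R w) h \<and> r = sqrt (\<integral>w. (\<xi> w)\<^sup>2 \<partial>\<mu>))"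

lemma dual_closure_unique:
  fixes \<mu> :: "'b::real_normed_vector measure"
  assumes sets: "sets \<mu> = sets borel"
    and \<xi>: "\<xi> \<in> dual_closure \<mu>" "has_pettis_integral \<mu> (\<lambda>w. \<xi> w *\<^sub>R w) h"
    and \<eta>: "\<eta> \<in> dual_closure \<mu>" "has_pettis_integral \<mu> (\<lambda>w. \<eta> w *\<^sub>R w) h"
  shows "AE w in \<mu>. \<xi> w = \<eta> w"
proof -
  define d where "d w = \<xi> w - \<eta> w" for w
  have meas: "\<xi> \<in> borel_measurable \<mu>" "\<eta> \<in> borel_measurable \<mu>"
    and sq: "integrable \<mu> (\<lambda>w. (\<xi> w)\<^sup>2)" "integrable \<mu> (\<lambda>w. (\<eta> w)\<^sup>2)"
    using \<xi>(1) \<eta>(1) by (auto simp: dual_closure_def)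
  have L_meas: "L \<in> borel_measurable \<mu>" if "bounded_linear L" for L :: "'b \<Rightarrow> real"
  proof -
    have "L \<in> borel_measurable borel"
      using that by (intro borel_measurable_continuous_onI linear_continuous_on)
    then show ?thesis by (simp cong: measurable_cong_sets add: measurable_def sets sets_eq_imp_space_eq[OF sets])
  qed
  have sq_bound: "(a - b)\<^sup>2 \<le> 2 * a\<^sup>2 + 2 * b\<^sup>2" for a b :: real
    using zero_le_power2[of "a + b"] unfolding power2_sum power2_diff by linarith
  have d_sq: "integrable \<mu> (\<lambda>w. (d w)\<^sup>2)"
  proof (rule Bochner_Integration.integrable_bound)
    show "integrable \<mu> (\<lambda>w. 2 * (\<xi> w)\<^sup>2 + 2 * (\<eta> w)\<^sup>2)"
      using sq by simp
    show "(\<lambda>w. (d w)\<^sup>2) \<in> borel_measurable \<mu>"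
      using meas by (simp add: d_def)
  qed (use sq_bound in \<open>auto simp: d_def\<close>)
  have small: "(\<integral>w. (d w)\<^sup>2 \<partial>\<mu>) \<le> 4 * e" if "e > 0" for e
  proof -
    have approx: "\<exists>L. bounded_linear L \<and> integrable \<mu> (\<lambda>w. (g w - L w)\<^sup>2) \<and> (\<integral>w. (g w - L w)\<^sup>2 \<partial>\<mu>) \<le> e"
      if g: "g \<in> dual_closure \<mu>" for g
    proof -
      obtain L where L: "bounded_linear L" "(\<integral>\<^sup>+ w. ennreal ((g w - L w)\<^sup>2) \<partial>\<mu>) < ennreal e"
        using g \<open>e > 0\<close> by (auto simp: dual_closure_def)
      have m: "(\<lambda>w. (g w - L w)\<^sup>2) \<in> borel_measurable \<mu>"
        using g L_meas[OF L(1)] by (auto simp: dual_closure_def)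
      have int: "integrable \<mu> (\<lambda>w. (g w - L w)\<^sup>2)"
        using m L(2) by (intro integrableI_nonneg) (auto intro: less_trans)
      have "ennreal (\<integral>w. (g w - L w)\<^sup>2 \<partial>\<mu>) \<le> ennreal e"
        using nn_integral_eq_integral[OF int] L(2) by simp
      then have "(\<integral>w. (g w - L w)\<^sup>2 \<partial>\<mu>) \<le> e"
        using \<open>e > 0\<close> by (simp add: ennreal_le_iff)
      with L(1) int show ?thesis by blast
    qed
    obtain K where K: "bounded_linear K" "integrable \<mu> (\<lambda>w. (\<xi> w - K w)\<^sup>2)"
        "(\<integral>w. (\<xi> w - K w)\<^sup>2 \<partial>\<mu>) \<le> e"
      using approx[OF \<xi>(1)] by auto
    obtain L where L: "bounded_linear L" "integrable \<mu> (\<lambda>w. (\<eta> w - L w)\<^sup>2)"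
        "(\<integral>w. (\<eta> w - L w)\<^sup>2 \<partial>\<mu>) \<le> e"
      using approx[OF \<eta>(1)] by auto
    have orth: "integrable \<mu> (\<lambda>w. d w * J w) \<and> (\<integral>w. d w * J w \<partial>\<mu>) = 0"
      if J: "bounded_linear J" for J :: "'b \<Rightarrow> real"
    proof -
      have "integrable \<mu> (\<lambda>w. \<xi> w * J w) \<and> (\<integral>w. \<xi> w * J w \<partial>\<mu>) = J h"
        "integrable \<mu> (\<lambda>w. \<eta> w * J w) \<and> (\<integral>w. \<eta> w * J w \<partial>\<mu>) = J h"
        using \<xi>(2) \<eta>(2) J
        by (auto simp: has_pettis_integral_def linear_cmul[OF bounded_linear.linear[OF J]])
      then show ?thesis by (simp add: d_def left_diff_distrib)
    qed
    define J where "J w = K w - L w" for w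
    have J: "bounded_linear J"
      unfolding J_def using K(1) L(1) by (rule bounded_linear_sub)
    have "(\<integral>w. (d w)\<^sup>2 \<partial>\<mu>) = (\<integral>w. (d w)\<^sup>2 - 2 * (d w * J w) \<partial>\<mu>)"
      using orth[OF J] d_sq by simp
    also have "\<dots> \<le> (\<integral>w. 2 * (\<xi> w - K w)\<^sup>2 + 2 * (\<eta> w - L w)\<^sup>2 \<partial>\<mu>)"
    proof (rule integral_mono)
      show "integrable \<mu> (\<lambda>w. (d w)\<^sup>2 - 2 * (d w * J w))"
        using orth[OF J] d_sq by simp
      show "integrable \<mu> (\<lambda>w. 2 * (\<xi> w - K w)\<^sup>2 + 2 * (\<eta> w - L w)\<^sup>2)"
        using K(2) L(2) by simp
      show "(d w)\<^sup>2 - 2 * (d w * J w) \<le> 2 * (\<xi> w - K w)\<^sup>2 + 2 * (\<eta> w - L w)\<^sup>2" for w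
      proof -
        have "(d w)\<^sup>2 - 2 * (d w * J w) \<le> (d w - J w)\<^sup>2"
          by (simp add: power2_diff)
        also have "d w - J w = (\<xi> w - K w) - (\<eta> w - L w)"
          by (simp add: d_def J_def)
        also have "\<dots>\<^sup>2 \<le> 2 * (\<xi> w - K w)\<^sup>2 + 2 * (\<eta> w - L w)\<^sup>2"
          by (rule sq_bound)
        finally show ?thesis .
      qed
    qed
    also have "\<dots> \<le> 4 * e"
      using K(2,3) L(2,3) by simp
    finally show ?thesis .
  qed
  have "(\<integral>w. (d w)\<^sup>2 \<partial>\<mu>) \<le> 0"
  proof (rule field_le_epsilon)
    fix e :: real assume "0 < e"
    then show "(\<integral>w. (d w)\<^sup>2 \<partial>\<mu>) \<le> 0 + e" using small[of "e / 4"] by simp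
  qed
  moreover have "0 \<le> (\<integral>w. (d w)\<^sup>2 \<partial>\<mu>)" by simp
  ultimately have "(\<integral>w. (d w)\<^sup>2 \<partial>\<mu>) = 0" by linarith
  then have "AE w in \<mu>. (d w)\<^sup>2 = 0"
    using integral_nonneg_eq_0_iff_AE[OF d_sq] by simp
  then show ?thesis by (simp add: d_def)
qed

lemma rkhs_norm_eq:
  assumes "sets \<mu> = sets borel"
    and "\<xi> \<in> dual_closure \<mu>" "has_pettis_integral \<mu> (\<lambda>w. \<xi> w *\<^sub>R w) h"
  shows "rkhs_norm \<mu> h = sqrt (\<integral>w. (\<xi> w)\<^sup>2 \<partial>\<mu>)"
  unfolding rkhs_norm_def
proof (rule the_equality)
  fix s assume "\<exists>\<eta>\<in>dual_closure \<mu>.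
    has_pettis_integral \<mu> (\<lambda>w. \<eta> w *\<^sub>R w) h \<and> s = sqrt (\<integral>w. (\<eta> w)\<^sup>2 \<partial>\<mu>)"
  then obtain \<eta> where \<eta>: "\<eta> \<in> dual_closure \<mu>" "has_pettis_integral \<mu> (\<lambda>w. \<eta> w *\<^sub>R w) h"
    and s: "s = sqrt (\<integral>w. (\<eta> w)\<^sup>2 \<partial>\<mu>)"
    by blast
  have "(\<integral>w. (\<eta> w)\<^sup>2 \<partial>\<mu>) = (\<integral>w. (\<xi> w)\<^sup>2 \<partial>\<mu>)"
    using dual_closure_unique[OF assms(1) \<eta> assms(2,3)] \<eta>(1) assms(2)
    by (intro integral_cong_AE) (auto simp: dual_closure_def)
  then show "s = sqrt (\<integral>w. (\<xi> w)\<^sup>2 \<partial>\<mu>)" using s by simp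
qed (use assms(2,3) in blast)

text \<open>Extended-real valued, so that \<open>- log 0 = \<infinity>\<close> and an infimum over the empty set is \<open>\<infinity>\<close>.\<close>

definition concentration_function ::
    "'b::real_normed_vector measure \<Rightarrow> 'b \<Rightarrow> real \<Rightarrow> ereal" where
  "concentration_function \<mu> \<eta> e =
     (let p = measure \<mu> {w. norm w \<le> e} in if p = 0 then \<infinity> else ereal (- ln p)) +
     ereal (1 / 2) * (INF h\<in>{h \<in> rkhs \<mu>. norm (h - \<eta>) < e}. ereal ((rkhs_norm \<mu> h)\<^sup>2))"


section \<open>Gaussian white noise model and tempered posterior\<close>

definition iid_std_normal :: "'w measure \<Rightarrow> (nat \<Rightarrow> 'w \<Rightarrow> real) \<Rightarrow> bool" where
  "iid_std_normal M \<epsilon> \<longleftrightarrow> prob_space.indep_vars M (\<lambda>_. borel) \<epsilon> UNIV \<and>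
     (\<forall>k. distributed M lborel (\<epsilon> k) std_normal_density)"

text \<open>
  The basis and the coordinates of the data are indexed from \<open>0\<close>.  For each fixed \<open>f\<close> the series in
  the log-likelihood converges almost surely.
\<close>

definition white_noise_obs ::
    "(nat \<Rightarrow> L2) \<Rightarrow> L2 \<Rightarrow> (nat \<Rightarrow> 'w \<Rightarrow> real) \<Rightarrow> nat \<Rightarrow> 'w \<Rightarrow> nat \<Rightarrow> real" where
  "white_noise_obs \<phi> f \<epsilon> n \<omega> k = inner f (\<phi> k) + \<epsilon> k \<omega> / sqrt (real n)"

definition log_likelihood :: "(nat \<Rightarrow> L2) \<Rightarrow> nat \<Rightarrow> (nat \<Rightarrow> real) \<Rightarrow> L2 \<Rightarrow> real" where
  "log_likelihood \<phi> n y f =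
     real n * (\<Sum>k. inner f (\<phi> k) * y k) - real n / 2 * (norm f)\<^sup>2"

definition tempered_posterior ::
    "L2 measure \<Rightarrow> (nat \<Rightarrow> L2) \<Rightarrow> real \<Rightarrow> nat \<Rightarrow> (nat \<Rightarrow> real) \<Rightarrow> L2 measure" where
  "tempered_posterior \<mu> \<phi> a n y =
     density \<mu> (\<lambda>f. ennreal (exp (a * log_likelihood \<phi> n y f)) /
       (\<integral>\<^sup>+ g. ennreal (exp (a * log_likelihood \<phi> n y g)) \<partial>\<mu>))"


section \<open>Convergence in probability\<close>

text \<open>
  Stated with measurable covers, so that no event is assigned probability zero merely because it is
  not measurable; for measurable \<open>X n\<close> this is the usual notion.  Extended-real values are allowed
  because suprema may be infinite; the supremum over the empty set, \<open>-\<infinity>\<close>, is not small.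
\<close>

definition o_P_1 :: "'w measure \<Rightarrow> (nat \<Rightarrow> 'w \<Rightarrow> ereal) \<Rightarrow> bool" where
  "o_P_1 M X \<longleftrightarrow> (\<forall>\<delta>>0. \<exists>E. (\<forall>n. E n \<in> sets M \<and> {\<omega> \<in> space M. ereal \<delta> < \<bar>X n \<omega>\<bar>} \<subseteq> E n) \<and>
     (\<lambda>n. measure M (E n)) \<longlonglongrightarrow> 0)"

definition d_BL :: "real measure \<Rightarrow> real measure \<Rightarrow> real" where
  "d_BL P Q = (SUP g\<in>{g :: real \<Rightarrow> real. (\<forall>x. \<bar>g x\<bar> \<le> 1) \<and> (\<forall>x y. \<bar>g x - g y\<bar> \<le> \<bar>x - y\<bar>)}.
     \<bar>(\<integral>x. g x \<partial>P) - (\<integral>x. g x \<partial>Q)\<bar>)"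

definition weakly_in_prob :: "'w measure \<Rightarrow> (nat \<Rightarrow> 'w \<Rightarrow> real measure) \<Rightarrow> real measure \<Rightarrow> bool" where
  "weakly_in_prob M Q N \<longleftrightarrow> o_P_1 M (\<lambda>n \<omega>. ereal (d_BL (Q n \<omega>) N))"

end

theory Submission
  imports Defs
begin

text \<open>
  Prior and likelihood are both Gaussian, so with \<open>N = n \<alpha>\<^sub>n\<close> the posterior law of every linear
  functional is normal. If the likelihood is truncated to the first \<open>m\<close> coordinates this holds with
  an explicit mean and covariance \<open>c\<^sub>m\<close>, by conditioning on one coordinate at a time; as
  \<open>m \<rightarrow> \<infinity>\<close> the truncated posterior approaches the posterior in total variation, in probability.
  Hence it suffices to show that mean and variance of \<open>\<langle>\<psi>\<^sub>0, f\<rangle>\<close> have the right limits.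

  Let \<open>h = E[W \<xi>\<^sub>h(W)]\<close> be an element of the RKHS and \<open>P\<close> the projection on the first \<open>m\<close> coordinates.
  The covariance satisfies \<open>N c\<^sub>m(Ph, v) = E[\<xi>\<^sub>h v] - c\<^sub>m(\<xi>\<^sub>h, v)\<close>, together with the two bounds
  \<open>N c\<^sub>m(Pg, Pg) \<le> \<parallel>g\<parallel>\<^sup>2\<close> and \<open>c\<^sub>m(\<xi>\<^sub>h, \<xi>\<^sub>h) \<le> \<parallel>h\<parallel>\<^sup>2\<close> (RKHS norm). Splitting \<open>\<psi>\<^sub>0\<close> into \<open>\<psi>\<^sub>n\<close> and a
  remainder of norm \<open>\<zeta>\<^sub>n\<close>, and \<open>f\<^sub>0\<close> into an RKHS element of norm at most \<open>2 \<surd>N \<epsilon>\<^sub>n\<close> (which the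
  concentration function provides) and a remainder of norm \<open>\<epsilon>\<^sub>n\<close>, Cauchy-Schwarz bounds the error of
  the variance by a multiple of \<open>\<zeta>\<^sub>n\<close>, the bias by \<open>9 \<surd>N \<epsilon>\<^sub>n \<zeta>\<^sub>n\<close>, and the standard deviation of the
  remaining noise by \<open>3 \<zeta>\<^sub>n\<close>, up to terms that vanish as \<open>m \<rightarrow> \<infinity>\<close>.
\<close>

section \<open>Normal laws and Gaussian integrals\<close>

text \<open>The likelihood series converges almost surely only for each fixed \<open>f\<close>, with
  a null set depending on \<open>f\<close>, whereas the posterior integrates over \<open>f\<close>
  along one noise path. Truncation keeps each conditioning step finite, and Fubini carries the
  convergence at fixed \<open>f\<close> over to the prior integral. No rate in \<open>m\<close>
  arises: for each \<open>n\<close>, \<open>m\<close> is chosen after everything else is fixed. The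
  obstacle in the estimates is that the prior covariance need not be diagonal in the basis and may
  be degenerate, so there is no closed form for the posterior covariance. RKHS elements provide the
  way round: covariance with a representer is an inner product with \<open>h\<close>, so that N
  times the posterior covariance acts on \<open>h\<close> as the identity up to one controllable
  term. A representer is merely an L2 limit of bounded linear functionals, so it is adjoined to the
  Gaussian process as an extra direction that is never observed. The factor 2 leaves room for a
  near-minimiser: half the infimum of the squared RKHS norms is at most N times the squared rate, so
  some element has squared norm below four times that. The 9 is 2 + 1 + 2 + 4, one summand for each
  term of a bilinear splitting.\<close>

lemma normal_law_eq_distr:
  assumes "0 \<le> V"
  shows "normal_law m V = distr std_normal_distribution borel (\<lambda>z. m + sqrt V * z)"
\<comment> \<open>\<open>normal_law\<close> is a point mass for \<open>V = 0\<close> and a density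
  otherwise; the affine image of a standard normal treats both cases uniformly from here on.\<close>
proof (cases "V = 0")
  case True
  interpret real_distribution std_normal_distribution by (rule real_dist_normal_dist)
  show ?thesis using True prob_space_axioms by (simp add: normal_law_def distr_const)
next
  case False
  then have s: "0 < sqrt V" using assms by simp
  interpret real_distribution std_normal_distribution by (rule real_dist_normal_dist)
  have "distributed std_normal_distribution lborel (\<lambda>z. z) std_normal_density"
    by (auto simp: distributed_def intro: distr_id2)
  from normal_density_affine[OF this, of "sqrt V" m] s
  have "distributed std_normal_distribution lborel (\<lambda>z. m + sqrt V * z) (normal_density m (sqrt V))"
    by simp
  then have "distr std_normal_distribution lborel (\<lambda>z. m + sqrt V * z) = normal_law m V"
    using False by (simp add: distributed_def normal_law_def)
  moreover have "distr std_normal_distribution lborel (\<lambda>z. m + sqrt V * z)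
      = distr std_normal_distribution borel (\<lambda>z. m + sqrt V * z)"
    by (rule distr_cong) auto
  ultimately show ?thesis by simp
qed

lemma sets_normal_law [simp, measurable_cong]: "sets (normal_law m V) = sets borel"
  by (simp add: normal_law_def)

lemma real_distribution_normal_law:
  assumes "0 \<le> V" shows "real_distribution (normal_law m V)"
proof -
  interpret real_distribution std_normal_distribution by (rule real_dist_normal_dist)
  show ?thesis unfolding normal_law_eq_distr[OF assms]
    by (intro real_distribution_distr) auto
qed

lemma char_normal_law:
  assumes "0 \<le> V"
  shows "char (normal_law m V) t = exp (\<i> * complex_of_real (t * m) - complex_of_real (t\<^sup>2 * V / 2))"
proof -
  have "char (normal_law m V) t = (LINT z|std_normal_distribution. iexp (t * m) * iexp ((t * sqrt V) * z))"
    unfolding char_def normal_law_eq_distr[OF assms]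
    by (subst integral_distr) (auto simp: algebra_simps exp_add[symmetric] intro!: Bochner_Integration.integral_cong)
  also have "\<dots> = iexp (t * m) * char std_normal_distribution (t * sqrt V)"
    unfolding char_def by (simp add: mult.assoc)
  also have "char std_normal_distribution (t * sqrt V) = exp (- complex_of_real (t\<^sup>2 * V / 2))"
  proof -
    have "(t * sqrt V)\<^sup>2 = t\<^sup>2 * V" using assms by (simp add: power_mult_distrib)
    then show ?thesis
      unfolding char_std_normal_distribution of_real_minus[symmetric] exp_of_real by simp
  qed
  also have "iexp (t * m) * exp (- complex_of_real (t\<^sup>2 * V / 2))
      = exp (\<i> * complex_of_real (t * m) - complex_of_real (t\<^sup>2 * V / 2))"
    by (simp only: exp_add[symmetric] diff_conv_add_uminus)
  finally show ?thesis .
qed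

lemma real_distribution_eq_normal_law:
  assumes "real_distribution P" "0 \<le> V"
    and "\<And>t. char P t = exp (\<i> * complex_of_real (t * m) - complex_of_real (t\<^sup>2 * V / 2))"
  shows "P = normal_law m V"
  using assms char_normal_law by (intro Levy_uniqueness real_distribution_normal_law) auto

lemma normal_law_second_moment:
  assumes "0 \<le> V"
  shows "integrable (normal_law 0 V) (\<lambda>x. x\<^sup>2)" "(\<integral>x. x\<^sup>2 \<partial>normal_law 0 V) = V"
  unfolding normal_law_eq_distr[OF assms]
  using std_normal_distribution_even_moments[of 1] assms
  by (simp_all add: integrable_distr_eq integral_distr power_mult_distrib)

text \<open>Completing the square: the tilted exponent is centred at \<open>p / (1 + a)\<close> with
  variance \<open>1 / (1 + a)\<close>, and \<open>1 / sqrt (1 + a)\<close> is the ratio of the two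
  normalising constants.\<close>

lemma std_normal_tilt:
  assumes "0 \<le> a"
  shows "std_normal_density z * exp (p * z - a * z\<^sup>2 / 2) =
    exp (p\<^sup>2 / (2 * (1 + a))) / sqrt (1 + a) * normal_density (p / (1 + a)) (sqrt (1 / (1 + a))) z"
proof -
  have a: "1 + a > 0" using assms by simp
  then have s: "sqrt (1 + a) > 0" by simp
  have e: "- z\<^sup>2 / 2 + (p * z - a * z\<^sup>2 / 2) =
      p\<^sup>2 / (2 * (1 + a)) + (- (z - p / (1 + a))\<^sup>2 / (2 * (1 / (1 + a))))"
  proof -
    have "p\<^sup>2 / (2 * A) - A * (z - p / A)\<^sup>2 / 2 = p * z - A * z\<^sup>2 / 2" if "A > 0" for A
    proof -
      have "A * (z - p / A)\<^sup>2 = A * z\<^sup>2 - 2 * p * z + p\<^sup>2 / A"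
        using that by (simp add: power2_diff field_simps power2_eq_square)
      then show ?thesis by (simp add: diff_divide_distrib add_divide_distrib)
    qed
    from this[OF a] have "p * z - (1 + a) * z\<^sup>2 / 2 =
        p\<^sup>2 / (2 * (1 + a)) + (- (z - p / (1 + a))\<^sup>2 / (2 * (1 / (1 + a))))"
      by (simp add: mult.commute)
    then show ?thesis by (simp add: algebra_simps add_divide_distrib)
  qed
  have r: "sqrt (2 * pi * (1 / (1 + a))) = sqrt (2 * pi) / sqrt (1 + a)"
    by (simp add: real_sqrt_divide)
  have sq: "(sqrt (1 / (1 + a)))\<^sup>2 = 1 / (1 + a)" using a by simp
  have "std_normal_density z * exp (p * z - a * z\<^sup>2 / 2)
      = 1 / sqrt (2 * pi) * exp (- z\<^sup>2 / 2 + (p * z - a * z\<^sup>2 / 2))"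
    by (simp only: std_normal_density_def exp_add mult.assoc)
  also have "\<dots> = 1 / sqrt (2 * pi) * (exp (p\<^sup>2 / (2 * (1 + a))) *
      exp (- (z - p / (1 + a))\<^sup>2 / (2 * (1 / (1 + a)))))"
    unfolding e exp_add by simp
  also have "\<dots> = exp (p\<^sup>2 / (2 * (1 + a))) / sqrt (1 + a) *
      normal_density (p / (1 + a)) (sqrt (1 / (1 + a))) z"
    unfolding normal_density_def sq r using s by simp
  finally show ?thesis .
qed

text \<open>The real Gaussian integral with \<open>p\<close> replaced by \<open>p + i q\<close>. The
  tilt turns the integral into the characteristic function at \<open>q\<close> of a shifted normal
  law, which takes the place of analytic continuation.\<close>

lemma std_normal_quadratic_exponential:
  assumes "0 \<le> a"
  shows "(LINT z|std_normal_distribution.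
      complex_of_real (exp (p * z - a * z\<^sup>2 / 2)) * iexp (q * z)) =
    complex_of_real (1 / sqrt (1 + a)) * exp ((complex_of_real p + \<i> * complex_of_real q)\<^sup>2 / complex_of_real (2 * (1 + a)))"
proof -
  define K where "K = exp (p\<^sup>2 / (2 * (1 + a))) / sqrt (1 + a)"
  define V where "V = 1 / (1 + a)"
  have V: "V > 0" using assms by (simp add: V_def)
  have "(LINT z|std_normal_distribution. complex_of_real (exp (p * z - a * z\<^sup>2 / 2)) * iexp (q * z))
     = (LINT z|lborel. std_normal_density z *\<^sub>R (complex_of_real (exp (p * z - a * z\<^sup>2 / 2)) * iexp (q * z)))"
    by (subst integral_density) auto
  also have "\<dots> = (LINT z|lborel. complex_of_real K * (normal_density (p * V) (sqrt V) z *\<^sub>R iexp (q * z)))"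
  proof (rule Bochner_Integration.integral_cong)
    fix z
    have "std_normal_density z * exp (p * z - a * z\<^sup>2 / 2) = K * normal_density (p * V) (sqrt V) z"
      using std_normal_tilt[OF assms, of z p] by (simp add: K_def V_def)
    then show "std_normal_density z *\<^sub>R (complex_of_real (exp (p * z - a * z\<^sup>2 / 2)) * iexp (q * z)) =
        complex_of_real K * (normal_density (p * V) (sqrt V) z *\<^sub>R iexp (q * z))"
      by (metis (no_types) mult.assoc of_real_mult scaleR_conv_of_real)
  qed simp
  also have "\<dots> = complex_of_real K * char (normal_law (p * V) V) q"
    unfolding integral_mult_right_zero using V by (simp add: char_def normal_law_def integral_density)
  also have "\<dots> = complex_of_real (1 / sqrt (1 + a)) *
      (exp (complex_of_real (p\<^sup>2 / (2 * (1 + a)))) * exp (\<i> * complex_of_real (q * (p * V)) - complex_of_real (q\<^sup>2 * V / 2)))"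
    using V by (simp add: char_normal_law K_def flip: exp_of_real)
  also have "exp (complex_of_real (p\<^sup>2 / (2 * (1 + a)))) * exp (\<i> * complex_of_real (q * (p * V)) - complex_of_real (q\<^sup>2 * V / 2))
     = exp ((complex_of_real p + \<i> * complex_of_real q)\<^sup>2 / complex_of_real (2 * (1 + a)))"
  proof -
    have "complex_of_real (p\<^sup>2 / (2 * (1 + a))) + (\<i> * complex_of_real (q * (p * V)) - complex_of_real (q\<^sup>2 * V / 2))
      = (complex_of_real p + \<i> * complex_of_real q)\<^sup>2 / complex_of_real (2 * (1 + a))"
    proof -
      have "\<i> * (complex_of_real q * complex_of_real p) / (1 + complex_of_real a) =
          2 * complex_of_real p * (\<i> * complex_of_real q) / (2 * (1 + complex_of_real a))"
        by (simp only: mult.assoc mult_divide_mult_cancel_left_if) (simp add: ac_simps)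
      then show ?thesis
        using assms by (simp add: V_def power2_sum power_mult_distrib add_divide_distrib diff_divide_distrib algebra_simps)
    qed
    then show ?thesis by (simp add: exp_add[symmetric])
  qed
  finally show ?thesis .
qed

lemma std_normal_exponential_moment:
  "(\<integral>\<^sup>+z. ennreal (exp (c * z)) \<partial>std_normal_distribution) = ennreal (exp (c\<^sup>2 / 2))"
proof -
  have "(\<integral>\<^sup>+z. ennreal (exp (c * z)) \<partial>std_normal_distribution)
      = (\<integral>\<^sup>+z. ennreal (exp (c\<^sup>2 / 2)) * ennreal (normal_density c 1 z) \<partial>lborel)"
    using std_normal_tilt[of 0 _ c]
    by (auto simp: nn_integral_density ennreal_mult[symmetric] intro!: nn_integral_cong)
  also have "\<dots> = ennreal (exp (c\<^sup>2 / 2)) * (\<integral>\<^sup>+z. ennreal (normal_density c 1 z) \<partial>lborel)"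
    by (rule nn_integral_cmult) simp
  also have "(\<integral>\<^sup>+z. ennreal (normal_density c 1 z) \<partial>lborel) = 1"
    using prob_space.emeasure_space_1[OF prob_space_normal_density[of 1 c]] by (simp add: emeasure_density)
  finally show ?thesis by simp
qed

lemma normal_law_exponential_moment:
  assumes "0 \<le> V"
  shows "(\<integral>\<^sup>+x. ennreal (exp (c * x)) \<partial>normal_law 0 V) = ennreal (exp (c\<^sup>2 * V / 2))"
  unfolding normal_law_eq_distr[OF assms]
  using std_normal_exponential_moment[of "c * sqrt V"] assms
  by (simp add: nn_integral_distr power_mult_distrib mult.assoc)

text \<open>
  Writing a Gaussian weight as a mixture of characters reduces integrals against it to characteristic
  functions of the unweighted measure.
\<close>

lemma gaussian_weight_linearisation:
  assumes "0 < N"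
  shows "complex_of_real (exp (y * x - N * x\<^sup>2 / 2)) =
    complex_of_real (exp (y\<^sup>2 / (2 * N))) *
    (LINT z|std_normal_distribution. iexp (z * (sqrt N * x - y / sqrt N)))"
proof -
  have "(LINT z|std_normal_distribution. iexp (z * (sqrt N * x - y / sqrt N)))
      = char std_normal_distribution (sqrt N * x - y / sqrt N)"
    by (simp add: char_def mult.commute)
  also have "\<dots> = complex_of_real (exp (- (sqrt N * x - y / sqrt N)\<^sup>2 / 2))"
    by (simp add: char_std_normal_distribution)
  also have "- (sqrt N * x - y / sqrt N)\<^sup>2 / 2 = (y * x - N * x\<^sup>2 / 2) - y\<^sup>2 / (2 * N)"
    using assms by (simp add: power2_diff power_mult_distrib power_divide diff_divide_distrib add_divide_distrib)
  finally show ?thesis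
    by (simp flip: of_real_mult exp_add)
qed

section \<open>Conjugate Gaussian updates\<close>

locale psd_form =
  fixes c :: "'v::real_vector \<Rightarrow> 'v \<Rightarrow> real"
  assumes add_left: "c (u + v) w = c u w + c v w"
    and scale_left: "c (r *\<^sub>R v) w = r * c v w"
    and sym: "c v w = c w v"
    and nonneg: "0 \<le> c v v"
begin

lemma add_right: "c u (v + w) = c u v + c u w"
  by (metis add_left sym)

lemma scale_right: "c v (r *\<^sub>R w) = r * c v w"
  by (metis scale_left sym)

lemma diff_left: "c (u - v) w = c u w - c v w"
  using add_left[of "u - v" v w] by simp

lemma diff_right: "c u (v - w) = c u v - c u w"
  by (metis diff_left sym)

lemma sum_left: "c (\<Sum>k\<in>K. f k) w = (\<Sum>k\<in>K. c (f k) w)"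
proof -
  have "c 0 w = 0" using scale_left[of 0 0 w] by simp
  then show ?thesis
    by (induction K rule: infinite_finite_induct) (simp_all add: add_left)
qed

lemma sum_right: "c v (\<Sum>k\<in>K. f k) = (\<Sum>k\<in>K. c v (f k))"
  by (simp add: sum_left sym[of v])

lemma Cauchy_Schwarz: "(c v w)\<^sup>2 \<le> c v v * c w w"
proof -
  have q: "0 \<le> c v v - 2 * t * c v w + t\<^sup>2 * c w w" for t
    using nonneg[of "v - t *\<^sub>R w"]
    by (simp add: diff_left diff_right scale_left scale_right sym[of w v] power2_eq_square algebra_simps)
  show ?thesis
  proof (cases "c w w = 0")
    case True
    have "c v w = 0"
    proof (rule ccontr)
      assume "c v w \<noteq> 0"
      \<comment> \<open>This \<open>t\<close> makes the quadratic equal to -1 when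
        \<open>c w w = 0\<close>.\<close>
      with q[of "(c v v + 1) / (2 * c v w)"] True show False by (simp add: field_simps)
    qed
    then show ?thesis by (simp add: True)
  next
    case False
    then have p: "c w w > 0" using nonneg[of w] by simp
    from q[of "c v w / c w w"] p have "0 \<le> c v v - (c v w)\<^sup>2 / c w w"
      by (simp add: power2_eq_square)
    then show ?thesis using p by (simp add: field_simps)
  qed
qed

lemma abs_le: "\<bar>c v w\<bar> \<le> sqrt (c v v) * sqrt (c w w)"
  using real_sqrt_le_mono[OF Cauchy_Schwarz[of v w]] by (simp add: real_sqrt_mult)

lemma abs_le':
  assumes "sqrt (c v v) \<le> a" "sqrt (c w w) \<le> b"
  shows "\<bar>c v w\<bar> \<le> a * b"
proof -
  have "sqrt (c v v) * sqrt (c w w) \<le> a * b"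
    using assms by (intro mult_mono) (auto intro: order_trans[OF real_sqrt_ge_zero[OF nonneg]] simp: nonneg)
  then show ?thesis using abs_le[of v w] by simp
qed

lemma seminorm_triangle: "sqrt (c (v + w) (v + w)) \<le> sqrt (c v v) + sqrt (c w w)"
proof (rule real_le_lsqrt)
  have "c (v + w) (v + w) = c v v + 2 * c v w + c w w"
    by (simp add: add_left add_right sym[of w v])
  also have "\<dots> \<le> c v v + 2 * (sqrt (c v v) * sqrt (c w w)) + c w w"
    using abs_le[of v w] by simp
  also have "\<dots> = (sqrt (c v v) + sqrt (c w w))\<^sup>2"
    by (simp add: power2_sum nonneg)
  finally show "c (v + w) (v + w) \<le> (sqrt (c v v) + sqrt (c w w))\<^sup>2" .
qed (simp_all add: nonneg)

end

text \<open>
  The covariance left after observing \<open>e 0, \<dots>, e (m - 1)\<close>, each with independent Gaussian noise of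
  variance \<open>1 / N\<close>, and the resulting mean when \<open>y k / N\<close> is the observed value of \<open>e k\<close>.
\<close>

fun postcov :: "real \<Rightarrow> ('v \<Rightarrow> 'v \<Rightarrow> real) \<Rightarrow> (nat \<Rightarrow> 'v) \<Rightarrow> nat \<Rightarrow> 'v \<Rightarrow> 'v \<Rightarrow> real" where
  "postcov N c e 0 v w = c v w"
| "postcov N c e (Suc m) v w = postcov N c e m v w -
     N * postcov N c e m v (e m) * postcov N c e m (e m) w / (1 + N * postcov N c e m (e m) (e m))"

definition postmean ::
    "real \<Rightarrow> ('v \<Rightarrow> 'v \<Rightarrow> real) \<Rightarrow> (nat \<Rightarrow> 'v) \<Rightarrow> (nat \<Rightarrow> real) \<Rightarrow> nat \<Rightarrow> 'v \<Rightarrow> real" where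
  "postmean N c e y m v = (\<Sum>k<m. y k * postcov N c e m v (e k))"

section \<open>Covariance and mean under successive noisy observations\<close>

locale gaussian_update = prior: psd_form c for c :: "'v::real_vector \<Rightarrow> 'v \<Rightarrow> real" +
  fixes N :: real and e :: "nat \<Rightarrow> 'v"
  assumes N_pos: "0 < N"
begin

abbreviation cov :: "nat \<Rightarrow> 'v \<Rightarrow> 'v \<Rightarrow> real" where
  "cov \<equiv> postcov N c e"

text \<open>Only nonnegativity has content: by Cauchy-Schwarz for the old form, the subtracted term
  is at most the old variance of \<open>v\<close>.\<close>

lemma psd_form_cov: "psd_form (cov m)"
proof (induction m)
  case 0
  have "cov 0 = c" by (simp add: fun_eq_iff)
  then show ?case using prior.psd_form_axioms by simp
next
  case (Suc m)
  interpret b: psd_form "cov m" by (rule Suc.IH)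
  have d: "1 + N * cov m (e m) (e m) > 0"
    using N_pos b.nonneg[of "e m"] by (simp add: add_pos_nonneg)
  show ?case
  proof
    fix u v w :: 'v and r :: real
    show "cov (Suc m) (u + v) w = cov (Suc m) u w + cov (Suc m) v w"
      by (simp add: b.add_left add_divide_distrib algebra_simps)
    show "cov (Suc m) (r *\<^sub>R v) w = r * cov (Suc m) v w"
      by (simp add: b.scale_left algebra_simps)
    show "cov (Suc m) v w = cov (Suc m) w v"
      by (simp add: b.sym[of w v] b.sym[of w "e m"] b.sym[of "e m" v] mult.commute mult.left_commute)
    have "N * (cov m v (e m))\<^sup>2 \<le> N * (cov m v v * cov m (e m) (e m))"
      using N_pos b.Cauchy_Schwarz by (intro mult_left_mono) auto
    also have "\<dots> \<le> cov m v v * (1 + N * cov m (e m) (e m))"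
      using b.nonneg[of v] by (simp add: algebra_simps)
    finally have "N * (cov m v (e m))\<^sup>2 / (1 + N * cov m (e m) (e m)) \<le> cov m v v"
      using d by (simp add: pos_divide_le_eq)
    then show "0 \<le> cov (Suc m) v v"
      by (simp add: b.sym[of "e m" v] power2_eq_square mult.assoc)
  qed
qed

sublocale cov: psd_form "cov m" for m
  by (rule psd_form_cov)

lemma denominator_pos: "1 + N * cov m (e m) (e m) > 0"
  using N_pos cov.nonneg[of m "e m"] by (simp add: add_pos_nonneg)

lemma cov_le_prior: "cov m v v \<le> c v v"
proof (induction m)
  case (Suc m)
  have "0 \<le> N * (cov m v (e m))\<^sup>2 / (1 + N * cov m (e m) (e m))"
    using N_pos denominator_pos[of m] by (intro divide_nonneg_pos) auto
  then have "cov (Suc m) v v \<le> cov m v v"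
    by (simp add: cov.sym[of m "e m" v] power2_eq_square mult.assoc)
  then show ?case using Suc.IH by simp
qed simp

text \<open>The updated variance is the minimum over \<open>t\<close> of the right-hand side.\<close>

lemma cov_Suc_le: "cov (Suc m) v v \<le> cov m (v - t *\<^sub>R e m) (v - t *\<^sub>R e m) + t\<^sup>2 / N"
proof -
  define x where "x = cov m (e m) (e m)"
  define y where "y = cov m v (e m)"
  have x: "x \<ge> 0" by (simp add: x_def cov.nonneg)
  have d: "1 + N * x > 0" using denominator_pos[of m] by (simp add: x_def)
  have "cov m (v - t *\<^sub>R e m) (v - t *\<^sub>R e m) + t\<^sup>2 / N - cov (Suc m) v v
      = t\<^sup>2 * x - 2 * t * y + t\<^sup>2 / N + N * y\<^sup>2 / (1 + N * x)"
    by (simp add: cov.diff_left cov.diff_right cov.scale_left cov.scale_right x_def y_def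
        cov.sym[of m "e m" v] power2_eq_square algebra_simps)
  \<comment> \<open>The square vanishes at \<open>t = N * y / (1 + N * x)\<close>, the regression
    coefficient of \<open>v\<close> on the new observation.\<close>
  also have "\<dots> = (t * (1 + N * x) - N * y)\<^sup>2 / (N * (1 + N * x))"
    using N_pos d by (simp add: field_simps power2_eq_square)
  also have "\<dots> \<ge> 0" using N_pos d by simp
  finally show ?thesis by simp
qed

text \<open>Estimating each \<open>e k\<close> by its noisy observation has error variance
  \<open>1 / N\<close>, and the conditional variance cannot exceed that of this estimate. In the
  induction, \<open>t = a m\<close> in \<open>cov_Suc_le\<close> strips the last summand at the cost
  \<open>(a m)\<^sup>2 / N\<close>.\<close>

lemma cov_span_le: "N * cov m (\<Sum>k<m. a k *\<^sub>R e k) (\<Sum>k<m. a k *\<^sub>R e k) \<le> (\<Sum>k<m. (a k)\<^sup>2)"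
proof (induction m)
  case 0
  show ?case using cov.scale_left[of 0 0 0 0] by simp
next
  case (Suc m)
  let ?v = "\<Sum>k<Suc m. a k *\<^sub>R e k"
  have "N * cov (Suc m) ?v ?v \<le> N * (cov m (?v - a m *\<^sub>R e m) (?v - a m *\<^sub>R e m) + (a m)\<^sup>2 / N)"
    by (intro mult_left_mono cov_Suc_le less_imp_le N_pos)
  also have "\<dots> = N * cov m (\<Sum>k<m. a k *\<^sub>R e k) (\<Sum>k<m. a k *\<^sub>R e k) + (a m)\<^sup>2"
    using N_pos by (simp add: algebra_simps)
  finally show ?case using Suc.IH by simp
qed

text \<open>The dual of \<open>cov_span_le\<close>. For the test vector \<open>?w\<close> built from
  the covariances themselves, \<open>S = cov m v ?w\<close>; Cauchy-Schwarz and
  \<open>cov_span_le\<close> give \<open>N * S\<^sup>2 \<le> cov m v v * S\<close>, and one factor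
  \<open>S\<close> cancels.\<close>

lemma sum_cov_square_le: "N * (\<Sum>k<m. (cov m v (e k))\<^sup>2) \<le> cov m v v"
proof -
  let ?w = "\<Sum>k<m. cov m v (e k) *\<^sub>R e k"
  define S where "S = (\<Sum>k<m. (cov m v (e k))\<^sup>2)"
  have S0: "S \<ge> 0" by (simp add: S_def sum_nonneg)
  have "S = cov m v ?w"
    by (simp add: S_def cov.sum_right cov.scale_right power2_eq_square)
  then have "N * S\<^sup>2 \<le> N * (cov m v v * cov m ?w ?w)"
    using N_pos cov.Cauchy_Schwarz[of m v ?w] by (intro mult_left_mono) auto
  also have "\<dots> = cov m v v * (N * cov m ?w ?w)" by simp
  also have "\<dots> \<le> cov m v v * S"
    unfolding S_def by (intro mult_left_mono cov_span_le cov.nonneg)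
  finally have "S * (N * S) \<le> S * cov m v v"
    by (simp add: power2_eq_square mult_ac)
  then have "N * S \<le> cov m v v"
    using S0 cov.nonneg[of m v] by (cases "S = 0") auto
  then show ?thesis by (simp add: S_def)
qed

text \<open>A resolvent identity: formally the posterior precision is the prior precision plus N
  times the observed squares. The asymmetric form, prior covariance on the left and posterior
  covariance on the right, is the useful one, since the prior covariance of a representer with
  \<open>e k\<close> is a basis coefficient of the RKHS element.\<close>

lemma prior_decomposition:
  "c v w = cov m v w + N * (\<Sum>k<m. c v (e k) * cov m (e k) w)"
proof (induction m arbitrary: w)
  case (Suc m)
  define x where "x = cov m (e m) (e m)"
  have d: "1 + N * x \<noteq> 0" using denominator_pos[of m] by (simp add: x_def)
  have "N * (\<Sum>k<Suc m. c v (e k) * cov (Suc m) (e k) w)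
      = N * (\<Sum>k<m. c v (e k) * cov m (e k) w)
        - N * (N * (\<Sum>k<m. c v (e k) * cov m (e k) (e m))) * cov m (e m) w / (1 + N * x)
        + N * c v (e m) * (cov m (e m) w - N * x * cov m (e m) w / (1 + N * x))"
    by (simp add: x_def algebra_simps sum.distrib sum_subtractf sum_distrib_left sum_distrib_right sum_divide_distrib)
  also have "N * (\<Sum>k<m. c v (e k) * cov m (e k) w) = c v w - cov m v w"
    using Suc.IH[of w] by simp
  also have "N * (\<Sum>k<m. c v (e k) * cov m (e k) (e m)) = c v (e m) - cov m v (e m)"
    using Suc.IH[of "e m"] by simp
  finally have "N * (\<Sum>k<Suc m. c v (e k) * cov (Suc m) (e k) w)
     = c v w - cov m v w - N * (c v (e m) - cov m v (e m)) * cov m (e m) w / (1 + N * x)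
        + N * c v (e m) * (cov m (e m) w - N * x * cov m (e m) w / (1 + N * x))" .
  also have "cov m (e m) w - N * x * cov m (e m) w / (1 + N * x) = cov m (e m) w / (1 + N * x)"
    using d by (simp add: diff_divide_eq_iff) (simp add: eq_divide_eq algebra_simps)
  also have "c v w - cov m v w - N * (c v (e m) - cov m v (e m)) * cov m (e m) w / (1 + N * x)
      + N * c v (e m) * (cov m (e m) w / (1 + N * x)) = c v w - cov (Suc m) v w"
    by (simp add: x_def diff_divide_distrib algebra_simps)
  finally show ?case by simp
qed simp

text \<open>The Kalman update: the gain
  \<open>N * cov m v (e m) / (1 + N * cov m (e m) (e m))\<close> times the innovation
  \<open>y m / N - postmean N c e y m (e m)\<close>.\<close>

lemma postmean_Suc:
  "postmean N c e y (Suc m) v = postmean N c e y m v -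
     (N * postmean N c e y m (e m) - y m) * cov m v (e m) / (1 + N * cov m (e m) (e m))"
proof -
  define x where "x = cov m (e m) (e m)"
  have d: "1 + N * x \<noteq> 0" using denominator_pos[of m] by (simp add: x_def)
  have "postmean N c e y (Suc m) v
      = (\<Sum>k<m. y k * cov m v (e k)) - N * cov m v (e m) * (\<Sum>k<m. y k * cov m (e m) (e k)) / (1 + N * x)
        + y m * (cov m v (e m) - N * cov m v (e m) * x / (1 + N * x))"
    by (simp add: postmean_def x_def algebra_simps sum.distrib sum_subtractf sum_distrib_left sum_distrib_right sum_divide_distrib)
  also have "cov m v (e m) - N * cov m v (e m) * x / (1 + N * x) = cov m v (e m) / (1 + N * x)"
    using d by (simp add: diff_divide_eq_iff) (simp add: eq_divide_eq algebra_simps)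
  also have "(\<Sum>k<m. y k * cov m v (e k)) - N * cov m v (e m) * (\<Sum>k<m. y k * cov m (e m) (e k)) / (1 + N * x)
        + y m * (cov m v (e m) / (1 + N * x))
      = postmean N c e y m v - (N * postmean N c e y m (e m) - y m) * cov m v (e m) / (1 + N * x)"
    by (simp add: postmean_def[symmetric] diff_divide_distrib algebra_simps)
  finally show ?thesis by (simp add: x_def)
qed

lemma postmean_add: "postmean N c e y m (v + w) = postmean N c e y m v + postmean N c e y m w"
  by (simp add: postmean_def cov.add_left algebra_simps sum.distrib)

lemma postmean_scale: "postmean N c e y m (r *\<^sub>R v) = r * postmean N c e y m v"
  by (simp add: postmean_def cov.scale_left algebra_simps sum_distrib_left)

end

text \<open>By linearity, replacing \<open>v\<close> by \<open>t *\<^sub>R v\<close> in the last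
  assumption gives the whole characteristic function, so every \<open>\<Lambda> v\<close> is centred
  normal with variance \<open>c v v\<close> and the family is jointly Gaussian. \<open>\<mu>\<close>
  lives on an abstract space, so that \<open>\<Lambda> v\<close> need not be a continuous
  functional.\<close>

locale gaussian_process = gaussian_update c N e + prob_space \<mu>
  for c :: "'v::real_vector \<Rightarrow> 'v \<Rightarrow> real" and N e and \<mu> :: "'a measure" +
  fixes \<Lambda> :: "'v \<Rightarrow> 'a \<Rightarrow> real"
  assumes \<Lambda>_add: "\<Lambda> (v + w) x = \<Lambda> v x + \<Lambda> w x"
    and \<Lambda>_scale: "\<Lambda> (r *\<^sub>R v) x = r * \<Lambda> v x"
    and \<Lambda>_measurable [measurable]: "\<Lambda> v \<in> borel_measurable \<mu>"
    and \<Lambda>_char: "(\<integral>x. iexp (\<Lambda> v x) \<partial>\<mu>) = complex_of_real (exp (- c v v / 2))"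
begin

text \<open>Up to a factor free of \<open>x\<close>, the likelihood of observing
  \<open>y k / N\<close> as the value of \<open>\<Lambda> (e k)\<close> under independent normal
  noise of variance \<open>1 / N\<close>.\<close>

definition weight :: "(nat \<Rightarrow> real) \<Rightarrow> nat \<Rightarrow> 'a \<Rightarrow> real" where
  "weight y m x = exp (\<Sum>k<m. y k * \<Lambda> (e k) x - N * (\<Lambda> (e k) x)\<^sup>2 / 2)"

lemma weight_measurable [measurable]: "weight y m \<in> borel_measurable \<mu>"
  unfolding weight_def[abs_def] by measurable

lemma weight_pos: "0 < weight y m x"
  by (simp add: weight_def)

lemma weight_le: "weight y m x \<le> exp (\<Sum>k<m. (y k)\<^sup>2 / (2 * N))"
proof -
  have "y k * t - N * t\<^sup>2 / 2 \<le> (y k)\<^sup>2 / (2 * N)" for k t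
  proof -
    have "0 \<le> (y k - N * t)\<^sup>2 / (2 * N)" using N_pos by simp
    also have "\<dots> = (y k)\<^sup>2 / (2 * N) - (y k * t - N * t\<^sup>2 / 2)"
      using N_pos by (simp add: power2_diff field_simps power2_eq_square)
    finally show ?thesis by simp
  qed
  then show ?thesis unfolding weight_def by (intro iffD2[OF exp_le_cancel_iff] sum_mono)
qed

lemma integrable_weight: "integrable \<mu> (weight y m)"
  by (rule integrable_const_bound[where B="exp (\<Sum>k<m. (y k)\<^sup>2 / (2 * N))"])
    (use weight_le weight_pos in \<open>auto simp: less_imp_le\<close>)

text \<open>Conditioning is carried out on characteristic functions, without densities or
  disintegrations: the weight of one more coordinate becomes a Gaussian mixture of characters,
  Fubini moves the mixture outside, and the induction hypothesis leaves a one-dimensional Gaussian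
  integral. \<open>Z\<close> is the same for all \<open>v\<close>; its value is recovered later from
  \<open>v = 0\<close>.\<close>

lemma weighted_char:
  "\<exists>Z. \<forall>v. (\<integral>x. complex_of_real (weight y m x) * iexp (\<Lambda> v x) \<partial>\<mu>) =
     complex_of_real Z * exp (\<i> * complex_of_real (postmean N c e y m v) - complex_of_real (cov m v v / 2))"
proof (induction m)
  case 0
  show ?case
    by (rule exI[of _ 1]) (simp add: weight_def postmean_def \<Lambda>_char exp_of_real[symmetric])
next
  case (Suc m)
  define pm where "pm = postmean N c e y m"
  from Suc.IH obtain Z where Z: "\<And>v. (\<integral>x. complex_of_real (weight y m x) * iexp (\<Lambda> v x) \<partial>\<mu>) =
     complex_of_real Z * exp (\<i> * complex_of_real (pm v) - complex_of_real (cov m v v / 2))"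
    unfolding pm_def by blast
  define C where "C = exp ((y m)\<^sup>2 / (2 * N))"
  define a where "a = N * cov m (e m) (e m)"
  define q where "q = sqrt N * pm (e m) - y m / sqrt N"
  have a0: "a \<ge> 0" using N_pos by (simp add: a_def cov.nonneg)
  interpret G: real_distribution std_normal_distribution by (rule real_dist_normal_dist)
  interpret P: pair_prob_space \<mu> std_normal_distribution ..
  show ?case
  proof (intro exI allI)
    fix v
    define p where "p = - (sqrt N * cov m v (e m))"
    define f where "f x z = complex_of_real (weight y m x) * iexp (\<Lambda> v x) *
        iexp (z * (sqrt N * \<Lambda> (e m) x - y m / sqrt N))" for x z
    have f_int: "integrable (\<mu> \<Otimes>\<^sub>M std_normal_distribution) (\<lambda>(x, z). f x z)"
      unfolding f_def
      by (rule P.integrable_const_bound[where B="exp (\<Sum>k<m. (y k)\<^sup>2 / (2 * N))"])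
        (use weight_le weight_pos in \<open>auto simp: norm_mult less_imp_le\<close>)
    have "(\<integral>x. complex_of_real (weight y (Suc m) x) * iexp (\<Lambda> v x) \<partial>\<mu>)
        = (\<integral>x. complex_of_real C * (LINT z|std_normal_distribution. f x z) \<partial>\<mu>)"
    proof (rule Bochner_Integration.integral_cong)
      fix x
      have "complex_of_real (weight y (Suc m) x) =
          complex_of_real (weight y m x) * complex_of_real (exp (y m * \<Lambda> (e m) x - N * (\<Lambda> (e m) x)\<^sup>2 / 2))"
        by (simp add: weight_def exp_add flip: of_real_mult)
      then show "complex_of_real (weight y (Suc m) x) * iexp (\<Lambda> v x) =
          complex_of_real C * (LINT z|std_normal_distribution. f x z)"
        unfolding f_def gaussian_weight_linearisation[OF N_pos] C_def integral_mult_right_zero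
        by (simp only: mult_ac)
    qed simp
    also have "\<dots> = complex_of_real C * (\<integral>x. (LINT z|std_normal_distribution. f x z) \<partial>\<mu>)"
      by simp
    also have "(\<integral>x. (LINT z|std_normal_distribution. f x z) \<partial>\<mu>) = (LINT z|std_normal_distribution. (\<integral>x. f x z \<partial>\<mu>))"
      using P.Fubini_integral[OF f_int] by simp
    also have "\<dots> = (LINT z|std_normal_distribution.
        complex_of_real Z * exp (\<i> * complex_of_real (pm v) - complex_of_real (cov m v v / 2)) *
        (complex_of_real (exp (p * z - a * z\<^sup>2 / 2)) * iexp (q * z)))"
    proof (rule Bochner_Integration.integral_cong)
      fix z
      \<comment> \<open>At fixed \<open>z\<close> the mixing character only shifts the index
        \<open>v\<close> by \<open>(z * sqrt N) *\<^sub>R e m\<close>, so the induction hypothesis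
        applies to the shifted index.\<close>
      have "(\<integral>x. f x z \<partial>\<mu>) = (\<integral>x. iexp (- (z * y m / sqrt N)) *
          (complex_of_real (weight y m x) * iexp (\<Lambda> (v + (z * sqrt N) *\<^sub>R e m) x)) \<partial>\<mu>)"
        unfolding f_def
        by (intro Bochner_Integration.integral_cong)
          (simp_all add: \<Lambda>_add \<Lambda>_scale algebra_simps exp_add[symmetric] exp_diff)
      also have "\<dots> = iexp (- (z * y m / sqrt N)) * (complex_of_real Z *
          exp (\<i> * complex_of_real (pm (v + (z * sqrt N) *\<^sub>R e m)) -
               complex_of_real (cov m (v + (z * sqrt N) *\<^sub>R e m) (v + (z * sqrt N) *\<^sub>R e m) / 2)))"
        unfolding integral_mult_right_zero Z ..
      also have "pm (v + (z * sqrt N) *\<^sub>R e m) = pm v + z * sqrt N * pm (e m)"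
        by (simp add: pm_def postmean_add postmean_scale)
      also have "cov m (v + (z * sqrt N) *\<^sub>R e m) (v + (z * sqrt N) *\<^sub>R e m)
          = cov m v v - 2 * (p * z) + a * z\<^sup>2"
        using N_pos
        by (simp add: cov.add_left cov.add_right cov.scale_left cov.scale_right cov.sym[of m "e m" v]
            p_def a_def algebra_simps power2_eq_square real_sqrt_mult_self)
      also have "iexp (- (z * y m / sqrt N)) * (complex_of_real Z *
          exp (\<i> * complex_of_real (pm v + z * sqrt N * pm (e m)) -
               complex_of_real ((cov m v v - 2 * (p * z) + a * z\<^sup>2) / 2)))
          = complex_of_real Z * exp (\<i> * complex_of_real (pm v) - complex_of_real (cov m v v / 2)) *
        (complex_of_real (exp (p * z - a * z\<^sup>2 / 2)) * iexp (q * z))"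
      proof -
        have "\<i> * complex_of_real (- (z * y m / sqrt N)) + (\<i> * complex_of_real (pm v + z * sqrt N * pm (e m)) -
               complex_of_real ((cov m v v - 2 * (p * z) + a * z\<^sup>2) / 2))
            = (\<i> * complex_of_real (pm v) - complex_of_real (cov m v v / 2)) +
              (complex_of_real (p * z - a * z\<^sup>2 / 2) + \<i> * complex_of_real (q * z))"
          by (simp add: complex_eq_iff q_def field_simps)
        then have "iexp (- (z * y m / sqrt N)) * exp (\<i> * complex_of_real (pm v + z * sqrt N * pm (e m)) -
               complex_of_real ((cov m v v - 2 * (p * z) + a * z\<^sup>2) / 2))
            = exp (\<i> * complex_of_real (pm v) - complex_of_real (cov m v v / 2)) *
              (complex_of_real (exp (p * z - a * z\<^sup>2 / 2)) * iexp (q * z))"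
          by (simp only: exp_add[symmetric] exp_of_real[symmetric])
        then show ?thesis by (simp only: mult_ac)
      qed
      finally show "(\<integral>x. f x z \<partial>\<mu>) = complex_of_real Z * exp (\<i> * complex_of_real (pm v) - complex_of_real (cov m v v / 2)) *
        (complex_of_real (exp (p * z - a * z\<^sup>2 / 2)) * iexp (q * z))" .
    qed simp
    also have "\<dots> = complex_of_real Z * exp (\<i> * complex_of_real (pm v) - complex_of_real (cov m v v / 2)) *
        (complex_of_real (1 / sqrt (1 + a)) * exp ((complex_of_real p + \<i> * complex_of_real q)\<^sup>2 / complex_of_real (2 * (1 + a))))"
      unfolding integral_mult_right_zero std_normal_quadratic_exponential[OF a0] ..
    also have "complex_of_real C * \<dots> = complex_of_real (C * Z / sqrt (1 + a)) *
        (exp (\<i> * complex_of_real (pm v) - complex_of_real (cov m v v / 2)) *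
         exp ((complex_of_real p + \<i> * complex_of_real q)\<^sup>2 / complex_of_real (2 * (1 + a))))"
      by simp
    \<comment> \<open>Expanding the square of \<open>p + i q\<close>: \<open>p\<^sup>2\<close>
      lowers the variance, the cross term \<open>p * q\<close> shifts the mean, and the
      \<open>q\<^sup>2\<close> part is free of \<open>v\<close> and is absorbed into the
      constant.\<close>
    also have "exp (\<i> * complex_of_real (pm v) - complex_of_real (cov m v v / 2)) *
         exp ((complex_of_real p + \<i> * complex_of_real q)\<^sup>2 / complex_of_real (2 * (1 + a)))
       = complex_of_real (exp (- q\<^sup>2 / (2 * (1 + a)))) *
         exp (\<i> * complex_of_real (postmean N c e y (Suc m) v) - complex_of_real (cov (Suc m) v v / 2))"
    proof -
      have sq: "(complex_of_real p + \<i> * complex_of_real q)\<^sup>2 / complex_of_real (2 * (1 + a))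
         = complex_of_real ((p\<^sup>2 - q\<^sup>2) / (2 * (1 + a))) + \<i> * complex_of_real (p * q / (1 + a))"
      proof -
        have "(complex_of_real p + \<i> * complex_of_real q)\<^sup>2
            = complex_of_real (p\<^sup>2 - q\<^sup>2) + \<i> * complex_of_real (2 * (p * q))"
          by (simp add: power2_sum power_mult_distrib)
        moreover have "p * q / (1 + a) = (2 * (p * q)) / (2 * (1 + a))"
          by (simp only: mult_divide_mult_cancel_left_if) simp
        ultimately show ?thesis
          by (simp only: add_divide_distrib of_real_divide times_divide_eq_right)
      qed
      have "p * q = - ((N * pm (e m) - y m) * cov m v (e m))"
        using N_pos by (simp add: p_def q_def algebra_simps)
      then have pm': "postmean N c e y (Suc m) v = pm v + p * q / (1 + a)"
        by (simp add: postmean_Suc pm_def a_def)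
      have "p\<^sup>2 = N * cov m v (e m) * cov m (e m) v"
        using N_pos by (simp add: p_def power_mult_distrib cov.sym[of m "e m" v] power2_eq_square)
      then have cov': "cov (Suc m) v v = cov m v v - p\<^sup>2 / (1 + a)"
        by (simp add: a_def)
      have "\<i> * complex_of_real (pm v) - complex_of_real (cov m v v / 2) +
          (complex_of_real ((p\<^sup>2 - q\<^sup>2) / (2 * (1 + a))) + \<i> * complex_of_real (p * q / (1 + a)))
        = complex_of_real (- q\<^sup>2 / (2 * (1 + a))) +
          (\<i> * complex_of_real (postmean N c e y (Suc m) v) - complex_of_real (cov (Suc m) v v / 2))"
        unfolding pm' cov' by (simp add: algebra_simps diff_divide_distrib)
      then show ?thesis
        unfolding sq by (simp only: exp_add[symmetric] exp_of_real[symmetric])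
    qed
    finally show "(\<integral>x. complex_of_real (weight y (Suc m) x) * iexp (\<Lambda> v x) \<partial>\<mu>)
      = complex_of_real (C * Z / sqrt (1 + a) * exp (- q\<^sup>2 / (2 * (1 + a)))) *
        exp (\<i> * complex_of_real (postmean N c e y (Suc m) v) - complex_of_real (cov (Suc m) v v / 2))"
      by (simp add: mult.assoc)
  qed
qed

lemma integral_weight_pos: "0 < (\<integral>x. weight y m x \<partial>\<mu>)"
proof -
  have "(\<integral>x. weight y m x \<partial>\<mu>) \<noteq> 0"
    using integral_nonneg_eq_0_iff_AE[OF integrable_weight, of y m] weight_pos AE_False
    by (auto simp: less_imp_le less_imp_neq[symmetric])
  moreover have "0 \<le> (\<integral>x. weight y m x \<partial>\<mu>)"
    by (simp add: weight_pos less_imp_le)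
  ultimately show ?thesis by simp
qed

lemma weighted_normal:
  fixes g :: "real \<Rightarrow> real"
  assumes g [measurable]: "g \<in> borel_measurable borel"
  shows "(\<integral>x. weight y m x * g (\<Lambda> v x) \<partial>\<mu>) =
    (\<integral>x. weight y m x \<partial>\<mu>) * (\<integral>t. g t \<partial>normal_law (postmean N c e y m v) (cov m v v))"
proof -
  define D where "D = (\<integral>x. weight y m x \<partial>\<mu>)"
  have D: "D > 0" unfolding D_def by (rule integral_weight_pos)
  define \<nu> where "\<nu> = density \<mu> (\<lambda>x. ennreal (weight y m x / D))"
  have w: "0 \<le> weight y m x / D" for x using D weight_pos[of y m x] by simp
  have "emeasure \<nu> (space \<nu>) = (\<integral>\<^sup>+x. ennreal (weight y m x / D) \<partial>\<mu>)"
    unfolding \<nu>_def by (simp add: emeasure_density cong: nn_integral_cong)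
  also have "\<dots> = ennreal (\<integral>x. weight y m x / D \<partial>\<mu>)"
    using w by (intro nn_integral_eq_integral) (auto intro: integrable_weight)
  also have "\<dots> = 1" using D by (simp add: D_def)
  finally interpret \<nu>: prob_space \<nu> by (rule prob_spaceI)
  have sets_\<nu> [simp, measurable_cong]: "sets \<nu> = sets \<mu>" by (simp add: \<nu>_def)
  obtain Z where Z: "\<And>v. (\<integral>x. complex_of_real (weight y m x) * iexp (\<Lambda> v x) \<partial>\<mu>) =
     complex_of_real Z * exp (\<i> * complex_of_real (postmean N c e y m v) - complex_of_real (cov m v v / 2))"
    using weighted_char by blast
  \<comment> \<open>At \<open>v = 0\<close> the exponential factor is 1, which identifies the
    constant as the total weight.\<close>
  have "Z = D"
  proof -
    have "\<Lambda> 0 x = 0" for x using \<Lambda>_scale[of 0 0 x] by simp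
    moreover have "postmean N c e y m 0 = 0" using postmean_scale[of y m 0 0] by simp
    moreover have "cov m 0 0 = 0" using cov.scale_left[of m 0 0 0] by simp
    ultimately show ?thesis using Z[of 0] by (simp add: D_def)
  qed
  have "distr \<nu> borel (\<Lambda> v) = normal_law (postmean N c e y m v) (cov m v v)"
  proof (rule real_distribution_eq_normal_law)
    show "real_distribution (distr \<nu> borel (\<Lambda> v))"
      by (rule \<nu>.real_distribution_distr) measurable
    fix t
    have "char (distr \<nu> borel (\<Lambda> v)) t = (\<integral>x. iexp (\<Lambda> (t *\<^sub>R v) x) \<partial>\<nu>)"
      by (simp add: char_def integral_distr \<Lambda>_scale)
    also have "\<dots> = (\<integral>x. (weight y m x / D) *\<^sub>R iexp (\<Lambda> (t *\<^sub>R v) x) \<partial>\<mu>)"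
      unfolding \<nu>_def using w by (subst integral_density) auto
    also have "\<dots> = (\<integral>x. complex_of_real (1 / D) * (complex_of_real (weight y m x) * iexp (\<Lambda> (t *\<^sub>R v) x)) \<partial>\<mu>)"
      by (intro Bochner_Integration.integral_cong) (auto simp: scaleR_conv_of_real)
    also have "\<dots> = complex_of_real (1 / D) * (complex_of_real D *
        exp (\<i> * complex_of_real (postmean N c e y m (t *\<^sub>R v)) - complex_of_real (cov m (t *\<^sub>R v) (t *\<^sub>R v) / 2)))"
      unfolding integral_mult_right_zero Z \<open>Z = D\<close> ..
    also have "\<dots> = exp (\<i> * complex_of_real (t * postmean N c e y m v) - complex_of_real (t\<^sup>2 * cov m v v / 2))"
      using D by (simp add: postmean_scale cov.scale_left cov.scale_right power2_eq_square mult.assoc)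
    finally show "char (distr \<nu> borel (\<Lambda> v)) t
      = exp (\<i> * complex_of_real (t * postmean N c e y m v) - complex_of_real (t\<^sup>2 * cov m v v / 2))" .
  qed (rule cov.nonneg)
  then have "(\<integral>t. g t \<partial>normal_law (postmean N c e y m v) (cov m v v)) = (\<integral>x. g (\<Lambda> v x) \<partial>\<nu>)"
    by (simp add: integral_distr flip: \<open>distr \<nu> borel (\<Lambda> v) = _\<close>)
  also have "\<dots> = (\<integral>x. (weight y m x * g (\<Lambda> v x)) / D \<partial>\<mu>)"
    unfolding \<nu>_def using w by (subst integral_density) auto
  finally show ?thesis using D by (simp add: D_def[symmetric])
qed

end

section \<open>Orthonormal bases\<close>

definition proj :: "(nat \<Rightarrow> 'b::real_inner) \<Rightarrow> nat \<Rightarrow> 'b \<Rightarrow> 'b" where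
  "proj \<phi> m f = (\<Sum>k<m. inner f (\<phi> k) *\<^sub>R \<phi> k)"

lemma inner_proj_left: "inner (proj \<phi> m f) g = (\<Sum>k<m. inner f (\<phi> k) * inner g (\<phi> k))"
  by (simp add: proj_def inner_sum_left inner_commute[of g])

lemma inner_proj_right: "inner f (proj \<phi> m g) = inner (proj \<phi> m f) g"
  by (subst inner_commute) (simp add: inner_proj_left mult.commute)

lemma proj_add: "proj \<phi> m (f + g) = proj \<phi> m f + proj \<phi> m g"
  by (simp add: proj_def inner_add_left scaleR_add_left sum.distrib)

lemma proj_diff: "proj \<phi> m (f - g) = proj \<phi> m f - proj \<phi> m g"
  by (simp add: proj_def inner_diff_left scaleR_diff_left sum_subtractf)

lemma proj_scaleR: "proj \<phi> m (a *\<^sub>R f) = a *\<^sub>R proj \<phi> m f"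
  by (simp add: proj_def scaleR_sum_right)

context
  fixes \<phi> :: "nat \<Rightarrow> 'b::real_inner"
  assumes onb: "orthonormal_basis \<phi>"
begin

lemma inner_proj_basis: "inner (proj \<phi> m f) (\<phi> k) = (if k < m then inner f (\<phi> k) else 0)"
  using onb by (simp add: inner_proj_left orthonormal_basis_def mult_delta_right)

lemma inner_proj_proj: "inner (proj \<phi> m f) (proj \<phi> m g) = inner (proj \<phi> m f) g"
  unfolding inner_proj_left[of \<phi> m f] by (simp add: inner_proj_basis)

lemma norm_proj_sq: "(norm (proj \<phi> m f))\<^sup>2 = (\<Sum>k<m. (inner f (\<phi> k))\<^sup>2)"
  unfolding power2_norm_eq_inner inner_proj_proj by (simp add: inner_proj_left power2_eq_square)

lemma pythagoras_proj: "(norm f)\<^sup>2 = (norm (proj \<phi> m f))\<^sup>2 + (norm (f - proj \<phi> m f))\<^sup>2"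
  unfolding power2_norm_eq_inner
  by (simp add: inner_diff_left inner_diff_right inner_proj_proj inner_commute[of f "proj \<phi> m f"] del: dot_square_norm)

lemma norm_proj_le: "norm (proj \<phi> m f) \<le> norm f"
  by (rule power2_le_imp_le, subst pythagoras_proj[of f m]) simp_all

lemma norm_proj_residual_le: "norm (f - proj \<phi> m f) \<le> norm f"
  by (rule power2_le_imp_le, subst pythagoras_proj[of f m]) simp_all

text \<open>An element \<open>s\<close> of the span is fixed by all late projections, so
  \<open>f - proj \<phi> m f = (f - s) - proj \<phi> m (f - s)\<close>, and the residual map does
  not increase norms. Density of the span makes \<open>f - s\<close> small.\<close>

lemma proj_tendsto: "(\<lambda>m. proj \<phi> m f) \<longlonglongrightarrow> f"
proof (rule metric_LIMSEQ_I)
  fix r :: real assume "0 < r"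
  have "f \<in> closure (span (range \<phi>))" using onb unfolding orthonormal_basis_def by (metis UNIV_I)
  then obtain s where s: "s \<in> span (range \<phi>)" "dist s f < r"
    using \<open>0 < r\<close> unfolding closure_approachable by blast
  from s(1) have "\<exists>M. \<forall>m\<ge>M. proj \<phi> m s = s"
  proof (induction rule: span_induct_alt)
    case base
    show ?case unfolding proj_def by simp
  next
    case (step a x y)
    from step(2) obtain M where M: "\<And>m. m \<ge> M \<Longrightarrow> proj \<phi> m y = y" by blast
    from step(1) obtain k where k: "x = \<phi> k" by blast
    have "proj \<phi> m x = x" if "k < m" for m
    proof -
      have "proj \<phi> m x = (\<Sum>i<m. if k = i then \<phi> i else 0)"
        unfolding proj_def k using onb by (intro sum.cong) (auto simp: orthonormal_basis_def)
      then show ?thesis using that by (simp add: k)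
    qed
    then have "\<forall>m\<ge>max M (Suc k). proj \<phi> m (a *\<^sub>R x + y) = a *\<^sub>R x + y"
      using M by (simp add: proj_add proj_scaleR)
    then show ?case by blast
  qed
  then obtain M where M: "\<And>m. m \<ge> M \<Longrightarrow> proj \<phi> m s = s" by blast
  have "dist (proj \<phi> m f) f < r" if "m \<ge> M" for m
  proof -
    have "f - proj \<phi> m f = (f - s) - proj \<phi> m (f - s)"
      using M[OF that] by (simp add: proj_diff)
    then have "norm (f - proj \<phi> m f) \<le> norm (f - s)"
      using norm_proj_residual_le[of "f - s" m] by (simp only:)
    then show ?thesis using s(2) by (simp add: dist_norm norm_minus_commute)
  qed
  then show "\<exists>M. \<forall>m\<ge>M. dist (proj \<phi> m f) f < r" by blast
qed

lemma parseval: "(\<lambda>k. inner f (\<phi> k) * inner g (\<phi> k)) sums inner f g"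
  unfolding sums_def inner_proj_left[symmetric]
  by (intro tendsto_inner proj_tendsto tendsto_const)

lemma parseval_norm: "(\<lambda>k. (inner f (\<phi> k))\<^sup>2) sums (norm f)\<^sup>2"
  using parseval[of f f] unfolding power2_norm_eq_inner by (simp add: power2_eq_square)

end

section \<open>Almost sure convergence of Gaussian series\<close>

text \<open>
  The partial sums of \<open>X\<close>, frozen once their absolute value has reached \<open>l\<close>: their second moments
  grow no faster than those of the partial sums, which yields Kolmogorov's maximal inequality.
\<close>

primrec stopped_sum :: "real \<Rightarrow> nat \<Rightarrow> (nat \<Rightarrow> real) \<Rightarrow> real" where
  "stopped_sum l 0 x = 0"
| "stopped_sum l (Suc m) x =
     (if l \<le> \<bar>stopped_sum l m x\<bar> then stopped_sum l m x else stopped_sum l m x + x m)"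

lemma stopped_sum_cong: "(\<And>i. i < m \<Longrightarrow> x i = x' i) \<Longrightarrow> stopped_sum l m x = stopped_sum l m x'"
  by (induction m) auto

text \<open>A frozen value keeps absolute value at least \<open>l\<close>, so a value below
  \<open>l\<close> at time \<open>m\<close> means that no freezing took place before.\<close>

lemma stopped_sum_small:
  "\<bar>stopped_sum l m x\<bar> < l \<Longrightarrow> stopped_sum l m x = sum x {..<m} \<and> (\<forall>j\<le>m. \<bar>sum x {..<j}\<bar> < l)"
  by (induction m) (auto simp: le_Suc_eq split: if_splits)

lemma stopped_sum_measurable:
  "m \<le> n \<Longrightarrow> (\<lambda>x. stopped_sum l m x) \<in> borel_measurable (PiM {..<n} (\<lambda>_. borel))"
proof (induction m)
  case 0
  have "stopped_sum l 0 = (\<lambda>x. 0)" by (simp add: fun_eq_iff)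
  then show ?case by simp
next
  case (Suc m)
  have [measurable]: "(\<lambda>x. stopped_sum l m x) \<in> borel_measurable (PiM {..<n} (\<lambda>_. borel))"
    using Suc by simp
  have [measurable]: "(\<lambda>x. x m) \<in> borel_measurable (PiM {..<n} (\<lambda>_. borel))"
    using Suc.prems by (intro measurable_component_singleton) auto
  show ?case unfolding stopped_sum.simps by measurable
qed

section \<open>Kolmogorov's maximal inequality and series of independent variables\<close>

context prob_space
begin

lemma kolmogorov_maximal:
  fixes X :: "nat \<Rightarrow> 'a \<Rightarrow> real"
  assumes ind: "indep_vars (\<lambda>_. borel) X UNIV"
    and sq: "\<And>k. integrable M (\<lambda>\<omega>. (X k \<omega>)\<^sup>2)"
    and mean: "\<And>k. expectation (X k) = 0"
    and l: "0 < l"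
  shows "prob {\<omega>\<in>space M. \<exists>j\<le>m. l \<le> \<bar>\<Sum>k<j. X k \<omega>\<bar>} \<le> (\<Sum>k<m. expectation (\<lambda>\<omega>. (X k \<omega>)\<^sup>2)) / l\<^sup>2"
proof -
  have [measurable]: "X k \<in> borel_measurable M" for k
    using ind by (simp add: indep_vars_def)
  have Xint: "integrable M (X k)" for k
    by (rule square_integrable_imp_integrable) (use sq in auto)
  define T where "T m \<omega> = stopped_sum l m (\<lambda>k. X k \<omega>)" for m \<omega>
  have Tm [measurable]: "T m \<in> borel_measurable M" for m
    by (induction m) (simp_all add: T_def[abs_def])
  have "integrable M (\<lambda>\<omega>. (T m \<omega>)\<^sup>2) \<and>
      expectation (\<lambda>\<omega>. (T m \<omega>)\<^sup>2) \<le> (\<Sum>k<m. expectation (\<lambda>\<omega>. (X k \<omega>)\<^sup>2))"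
  proof (induction m)
    case 0
    show ?case by (simp add: T_def)
  next
    case (Suc m)
    \<comment> \<open>The square of the new stopped sum splits into the old square, a cross term
      \<open>2 * b * X m\<close> and the increment \<open>I\<close>. Since \<open>b\<close> is
      bounded and depends only on the first \<open>m\<close> variables, the cross term has mean
      zero, and \<open>I\<close> is at most the square of \<open>X m\<close>.\<close>
    define b where "b \<omega> = (if l \<le> \<bar>T m \<omega>\<bar> then 0 else T m \<omega>)" for \<omega>
    define I where "I \<omega> = (if l \<le> \<bar>T m \<omega>\<bar> then 0 else (X m \<omega>)\<^sup>2)" for \<omega>
    have bm [measurable]: "b \<in> borel_measurable M" "I \<in> borel_measurable M"
      unfolding b_def[abs_def] I_def[abs_def] by measurable
    have eq: "(T (Suc m) \<omega>)\<^sup>2 = (T m \<omega>)\<^sup>2 + 2 * (b \<omega> * X m \<omega>) + I \<omega>" for \<omega>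
      by (simp add: T_def b_def I_def power2_sum)
    have b_int: "integrable M b"
      by (rule integrable_const_bound[where B=l]) (use l in \<open>auto simp: b_def\<close>)
    have I_int: "integrable M I"
      by (rule Bochner_Integration.integrable_bound[OF sq[of m]]) (auto simp: I_def)
    have I_le: "expectation I \<le> expectation (\<lambda>\<omega>. (X m \<omega>)\<^sup>2)"
      by (rule integral_mono[OF I_int sq]) (simp add: I_def)
    have indep: "indep_var borel b borel (X m)"
    proof -
      let ?h = "\<lambda>x. if l \<le> \<bar>stopped_sum l m x\<bar> then 0 else stopped_sum l m x"
      have hm: "?h \<in> borel_measurable (PiM {..<m} (\<lambda>_. borel))"
        using stopped_sum_measurable[of m m l] by measurable
      have "indep_var borel (?h \<circ> (\<lambda>\<omega>. restrict (\<lambda>i. X i \<omega>) {..<m}))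
        borel ((\<lambda>x. x m) \<circ> (\<lambda>\<omega>. restrict (\<lambda>i. X i \<omega>) {m}))"
        by (rule indep_var_compose[OF indep_var_restrict[OF ind] hm]) auto
      moreover have "?h \<circ> (\<lambda>\<omega>. restrict (\<lambda>i. X i \<omega>) {..<m}) = b"
        by (rule ext) (simp add: b_def T_def stopped_sum_cong[of m "restrict _ {..<m}"] cong: if_cong)
      moreover have "(\<lambda>x. x m) \<circ> (\<lambda>\<omega>. restrict (\<lambda>i. X i \<omega>) {m}) = X m" by auto
      ultimately show ?thesis by simp
    qed
    have bX: "integrable M (\<lambda>\<omega>. b \<omega> * X m \<omega>)" "expectation (\<lambda>\<omega>. b \<omega> * X m \<omega>) = 0"
      using indep_var_integrable[OF indep b_int Xint] indep_var_lebesgue_integral[OF indep b_int Xint]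
      by (simp_all add: mean)
    show ?case unfolding eq using Suc.IH bX I_int I_le by simp
  qed
  then have T2: "integrable M (\<lambda>\<omega>. (T m \<omega>)\<^sup>2)"
    "expectation (\<lambda>\<omega>. (T m \<omega>)\<^sup>2) \<le> (\<Sum>k<m. expectation (\<lambda>\<omega>. (X k \<omega>)\<^sup>2))" by auto
  have "prob {\<omega>\<in>space M. \<exists>j\<le>m. l \<le> \<bar>\<Sum>k<j. X k \<omega>\<bar>} \<le> prob {\<omega>\<in>space M. l\<^sup>2 \<le> (T m \<omega>)\<^sup>2}"
  proof (rule finite_measure_mono)
    show "{\<omega>\<in>space M. \<exists>j\<le>m. l \<le> \<bar>\<Sum>k<j. X k \<omega>\<bar>} \<subseteq> {\<omega>\<in>space M. l\<^sup>2 \<le> (T m \<omega>)\<^sup>2}"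
    proof safe
      fix \<omega> j assume "j \<le> m" "l \<le> \<bar>\<Sum>k<j. X k \<omega>\<bar>"
      then have "l \<le> \<bar>T m \<omega>\<bar>"
        using stopped_sum_small[of l m "\<lambda>k. X k \<omega>"] unfolding T_def by (meson not_less)
      then show "l\<^sup>2 \<le> (T m \<omega>)\<^sup>2" using l abs_le_square_iff[of l "T m \<omega>"] by simp
    qed
  qed measurable
  also have "\<dots> \<le> expectation (\<lambda>\<omega>. (T m \<omega>)\<^sup>2) / l\<^sup>2"
    using l T2(1) by (intro integral_Markov_inequality_measure[where A="{}"]) auto
  also have "\<dots> \<le> (\<Sum>k<m. expectation (\<lambda>\<omega>. (X k \<omega>)\<^sup>2)) / l\<^sup>2"
    using T2(2) by (intro divide_right_mono) auto
  finally show ?thesis .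
qed

text \<open>The series in \<open>log_likelihood\<close> and in the centring of the theorem are
  pointwise sums, so almost sure convergence is required. The maximal inequality applied to the
  tails bounds their oscillation: the event that every tail reaches level \<open>l\<close> has
  probability at most \<open>V n / l\<^sup>2\<close> for every \<open>n\<close>, hence zero.\<close>

lemma AE_summable_indep:
  fixes X :: "nat \<Rightarrow> 'a \<Rightarrow> real"
  assumes ind: "indep_vars (\<lambda>_. borel) X UNIV"
    and sq: "\<And>k. integrable M (\<lambda>\<omega>. (X k \<omega>)\<^sup>2)"
    and mean: "\<And>k. expectation (X k) = 0"
    and var: "summable (\<lambda>k. expectation (\<lambda>\<omega>. (X k \<omega>)\<^sup>2))"
  shows "AE \<omega> in M. summable (\<lambda>k. X k \<omega>)"
proof -
  define v where "v k = expectation (\<lambda>\<omega>. (X k \<omega>)\<^sup>2)" for k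
  have v0: "v k \<ge> 0" for k by (simp add: v_def)
  have vs: "summable v" using var by (simp add: v_def[abs_def])
  have [measurable]: "X k \<in> borel_measurable M" for k
    using ind by (simp add: indep_vars_def)
  define V where "V n = suminf v - (\<Sum>k<n. v k)" for n
  have V_lim: "V \<longlonglongrightarrow> 0"
    using tendsto_diff[OF tendsto_const[of "suminf v"] summable_LIMSEQ[OF vs]] by (simp add: V_def[abs_def])
  \<comment> \<open>Zeroing the first \<open>n\<close> terms turns tails of the series into ordinary
    partial sums, to which the maximal inequality applies.\<close>
  define X' where "X' n k \<omega> = (if k < n then 0 else X k \<omega>)" for n k \<omega>
  have [measurable]: "X' n k \<in> borel_measurable M" for n k
    unfolding X'_def[abs_def] by measurable
  have X'_sum: "(\<Sum>k<j. X' n k \<omega>) = (\<Sum>k<max j n. X k \<omega>) - (\<Sum>k<n. X k \<omega>)" for j n \<omega>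
    by (induction j) (auto simp: X'_def max_def not_le le_Suc_eq)
  have "AE \<omega> in M. \<exists>n. \<forall>j. \<bar>\<Sum>k<j. X' n k \<omega>\<bar> < l" if l: "l > 0" for l
  proof -
    define E where "E n m = {\<omega>\<in>space M. \<exists>j\<le>m. l \<le> \<bar>\<Sum>k<j. X' n k \<omega>\<bar>}" for n m
    have [measurable]: "E n m \<in> sets M" for n m unfolding E_def by measurable
    have E_le: "prob (E n m) \<le> V n / l\<^sup>2" for n m
    proof -
      have "indep_vars (\<lambda>_. borel) (X' n) UNIV"
        unfolding X'_def[abs_def]
        by (rule indep_vars_compose2[OF ind, of "\<lambda>k x. if k < n then 0 else x"]) simp
      moreover have "integrable M (\<lambda>\<omega>. (X' n k \<omega>)\<^sup>2)" "expectation (X' n k) = 0" for k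
        using sq mean by (cases "k < n"; simp add: X'_def[abs_def])+
      ultimately have "prob (E n m) \<le> (\<Sum>k<m. expectation (\<lambda>\<omega>. (X' n k \<omega>)\<^sup>2)) / l\<^sup>2"
        unfolding E_def by (intro kolmogorov_maximal l)
      also have "(\<Sum>k<m. expectation (\<lambda>\<omega>. (X' n k \<omega>)\<^sup>2)) = (\<Sum>k<max m n. v k) - (\<Sum>k<n. v k)"
        by (induction m) (auto simp: X'_def v_def max_def not_le le_Suc_eq less_Suc_eq)
      also have "\<dots> \<le> V n"
        using vs v0 by (simp add: V_def sum_le_suminf)
      finally show ?thesis by (simp add: divide_right_mono)
    qed
    have U_le: "prob (\<Union>m. E n m) \<le> V n / l\<^sup>2" for n
    proof (rule LIMSEQ_le_const2)
      show "(\<lambda>m. prob (E n m)) \<longlonglongrightarrow> prob (\<Union>m. E n m)"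
        by (rule finite_Lim_measure_incseq) (auto simp: E_def incseq_def intro: order_trans)
    qed (use E_le in blast)
    define B where "B = (\<Inter>n. \<Union>m. E n m)"
    have [measurable]: "B \<in> sets M" unfolding B_def by measurable
    have "prob B \<le> 0"
    proof (rule LIMSEQ_le_const)
      show "(\<lambda>n. V n / l\<^sup>2) \<longlonglongrightarrow> 0"
        using tendsto_divide[OF V_lim tendsto_const[of "l\<^sup>2"]] l by simp
      have "prob B \<le> prob (\<Union>m. E n m)" for n
        by (rule finite_measure_mono) (auto simp: B_def)
      then show "\<exists>N. \<forall>n\<ge>N. prob B \<le> V n / l\<^sup>2"
        using U_le order_trans by blast
    qed
    then have "prob B = 0" using measure_nonneg[of M B] by simp
    then have "AE \<omega> in M. \<omega> \<notin> B"
      by (intro AE_not_in) (simp add: null_sets_def emeasure_eq_measure)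
    then show ?thesis
    proof (rule AE_mp, intro AE_I2 impI)
      fix \<omega> assume "\<omega> \<in> space M" "\<omega> \<notin> B"
      then show "\<exists>n. \<forall>j. \<bar>\<Sum>k<j. X' n k \<omega>\<bar> < l"
        by (auto simp: B_def E_def not_le)
    qed
  qed
  then have "AE \<omega> in M. \<forall>r::nat. \<exists>n. \<forall>j. \<bar>\<Sum>k<j. X' n k \<omega>\<bar> < 1 / real (Suc r)"
    by (subst AE_all_countable) auto
  then show ?thesis
  proof (rule AE_mp, intro AE_I2 impI)
    fix \<omega> assume *: "\<forall>r::nat. \<exists>n. \<forall>j. \<bar>\<Sum>k<j. X' n k \<omega>\<bar> < 1 / real (Suc r)"
    define S where "S n = (\<Sum>k<n. X k \<omega>)" for n
    have "Cauchy S"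
    proof (rule metric_CauchyI)
      fix d :: real assume "0 < d"
      then obtain r :: nat where r: "1 / real (Suc r) < d / 2"
        using reals_Archimedean[of "d / 2"] by (auto simp: inverse_eq_divide)
      from * obtain n where n: "\<And>j. \<bar>S (max j n) - S n\<bar> < 1 / real (Suc r)"
        unfolding X'_sum S_def by blast
      have "dist (S i) (S j) < d" if "i \<ge> n" "j \<ge> n" for i j
        using n[of i] n[of j] that r by (simp add: dist_real_def max_absorb1)
      then show "\<exists>M. \<forall>m\<ge>M. \<forall>n\<ge>M. dist (S m) (S n) < d" by blast
    qed
    then show "summable (\<lambda>k. X k \<omega>)"
      by (simp add: summable_iff_convergent S_def[abs_def] Cauchy_convergent)
  qed
qed

end

section \<open>Moments and series of the standard normal noise\<close>

locale std_noise = prob_space M for M :: "'w measure" +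
  fixes \<epsilon> :: "nat \<Rightarrow> 'w \<Rightarrow> real"
  assumes noise: "iid_std_normal M \<epsilon>"
begin

lemma noise_indep: "indep_vars (\<lambda>_. borel) \<epsilon> UNIV"
  using noise by (simp add: iid_std_normal_def)

lemma noise_measurable [measurable]: "\<epsilon> k \<in> borel_measurable M"
  using noise_indep by (simp add: indep_vars_def)

lemma distr_noise: "distr M borel (\<epsilon> k) = std_normal_distribution"
proof -
  have "distr M lborel (\<epsilon> k) = std_normal_distribution"
    using noise by (simp add: iid_std_normal_def distributed_def)
  moreover have "distr M lborel (\<epsilon> k) = distr M borel (\<epsilon> k)"
    by (rule distr_cong) auto
  ultimately show ?thesis by simp
qed

lemma integral_noise:
  fixes g :: "real \<Rightarrow> real"
  assumes [measurable]: "g \<in> borel_measurable borel"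
  shows "expectation (\<lambda>\<omega>. g (\<epsilon> k \<omega>)) = (\<integral>z. g z \<partial>std_normal_distribution)"
    and "integrable M (\<lambda>\<omega>. g (\<epsilon> k \<omega>)) \<longleftrightarrow> integrable std_normal_distribution g"
  unfolding distr_noise[of k, symmetric] by (simp_all add: integral_distr integrable_distr_eq)

lemma noise_moments:
  "integrable M (\<epsilon> k)" "expectation (\<epsilon> k) = 0"
  "integrable M (\<lambda>\<omega>. (\<epsilon> k \<omega>)\<^sup>2)" "expectation (\<lambda>\<omega>. (\<epsilon> k \<omega>)\<^sup>2) = 1"
  using integral_noise[of "\<lambda>z. z" k] integral_noise[of "\<lambda>z. z\<^sup>2" k]
    integrable_std_normal_distribution_moment[of 1] integral_std_normal_distribution_moment_odd[of 1]
    std_normal_distribution_even_moments[of 1]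
  by simp_all

lemma AE_summable_noise:
  assumes "summable (\<lambda>k. (a k)\<^sup>2)"
  shows "AE \<omega> in M. summable (\<lambda>k. a k * \<epsilon> k \<omega>)"
proof (rule AE_summable_indep)
  show "indep_vars (\<lambda>_. borel) (\<lambda>k \<omega>. a k * \<epsilon> k \<omega>) UNIV"
    by (rule indep_vars_compose2[OF noise_indep, of "\<lambda>k z. a k * z"]) simp
qed (use assms noise_moments in \<open>simp_all add: power_mult_distrib\<close>)

lemma noise_sum_second_moment:
  "integrable M (\<lambda>\<omega>. (\<Sum>k<m. a k * \<epsilon> k \<omega>)\<^sup>2) \<and>
   expectation (\<lambda>\<omega>. (\<Sum>k<m. a k * \<epsilon> k \<omega>)\<^sup>2) = (\<Sum>k<m. (a k)\<^sup>2)"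
proof (induction m)
  case (Suc m)
  let ?S = "\<lambda>\<omega>. \<Sum>k<m. a k * \<epsilon> k \<omega>"
  have "indep_vars (\<lambda>_. borel) (\<lambda>k \<omega>. a k * \<epsilon> k \<omega>) (insert m {..<m})"
    by (rule indep_vars_subset[OF indep_vars_compose2[OF noise_indep, of "\<lambda>k z. a k * z"]]) auto
  from indep_vars_sum[OF _ _ this]
  have ind: "indep_var borel (\<lambda>\<omega>. a m * \<epsilon> m \<omega>) borel ?S" by simp
  have int: "integrable M (\<lambda>\<omega>. a m * \<epsilon> m \<omega>)" "integrable M ?S"
    using noise_moments by auto
  have cross: "integrable M (\<lambda>\<omega>. a m * \<epsilon> m \<omega> * ?S \<omega>)" "expectation (\<lambda>\<omega>. a m * \<epsilon> m \<omega> * ?S \<omega>) = 0"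
    using indep_var_integrable[OF ind int] indep_var_lebesgue_integral[OF ind int] noise_moments
    by simp_all
  have eq: "(\<Sum>k<Suc m. a k * \<epsilon> k \<omega>)\<^sup>2 = (?S \<omega>)\<^sup>2 + (a m)\<^sup>2 * (\<epsilon> m \<omega>)\<^sup>2 + 2 * (a m * \<epsilon> m \<omega> * ?S \<omega>)" for \<omega>
    by (simp add: power2_sum power_mult_distrib)
  show ?case unfolding eq using Suc.IH cross noise_moments by simp
qed simp

lemma noise_sum_deviation:
  assumes "0 < d"
  shows "prob {\<omega>\<in>space M. d \<le> \<bar>\<Sum>k<m. a k * \<epsilon> k \<omega>\<bar>} \<le> (\<Sum>k<m. (a k)\<^sup>2) / d\<^sup>2"
proof -
  have "{\<omega>\<in>space M. d \<le> \<bar>\<Sum>k<m. a k * \<epsilon> k \<omega>\<bar>} = {\<omega>\<in>space M. d\<^sup>2 \<le> (\<Sum>k<m. a k * \<epsilon> k \<omega>)\<^sup>2}"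
    using assms abs_le_square_iff[of d] by auto
  then show ?thesis
    using integral_Markov_inequality_measure[of M "\<lambda>\<omega>. (\<Sum>k<m. a k * \<epsilon> k \<omega>)\<^sup>2" "{}" "d\<^sup>2"]
      noise_sum_second_moment[of a m] assms by simp
qed

lemma noise_exponential_moment:
  "(\<integral>\<^sup>+\<omega>. ennreal (exp (\<Sum>k<m. a k * \<epsilon> k \<omega> + b k)) \<partial>M) = ennreal (exp (\<Sum>k<m. (a k)\<^sup>2 / 2 + b k))"
proof -
  have "(\<integral>\<^sup>+\<omega>. ennreal (exp (\<Sum>k<m. a k * \<epsilon> k \<omega> + b k)) \<partial>M)
      = (\<integral>\<^sup>+\<omega>. (\<Prod>k<m. ennreal (exp (a k * \<epsilon> k \<omega> + b k))) \<partial>M)"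
    by (intro nn_integral_cong) (simp add: exp_sum prod_ennreal)
  also have "\<dots> = (\<Prod>k<m. \<integral>\<^sup>+\<omega>. ennreal (exp (a k * \<epsilon> k \<omega> + b k)) \<partial>M)"
  proof (rule indep_vars_nn_integral)
    show "indep_vars (\<lambda>_. borel) (\<lambda>k \<omega>. ennreal (exp (a k * \<epsilon> k \<omega> + b k))) {..<m}"
      by (rule indep_vars_subset[OF indep_vars_compose2[OF noise_indep, of "\<lambda>k z. ennreal (exp (a k * z + b k))"]]) auto
  qed auto
  also have "\<dots> = (\<Prod>k<m. ennreal (exp ((a k)\<^sup>2 / 2 + b k)))"
  proof (rule prod.cong)
    fix k
    have "(\<integral>\<^sup>+\<omega>. ennreal (exp (a k * \<epsilon> k \<omega> + b k)) \<partial>M)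
        = (\<integral>\<^sup>+\<omega>. ennreal (exp (a k * \<epsilon> k \<omega>)) * ennreal (exp (b k)) \<partial>M)"
      by (simp add: exp_add ennreal_mult)
    also have "\<dots> = (\<integral>\<^sup>+z. ennreal (exp (a k * z)) \<partial>std_normal_distribution) * ennreal (exp (b k))"
      unfolding distr_noise[of k, symmetric] by (simp add: nn_integral_multc nn_integral_distr)
    finally show "(\<integral>\<^sup>+\<omega>. ennreal (exp (a k * \<epsilon> k \<omega> + b k)) \<partial>M) = ennreal (exp ((a k)\<^sup>2 / 2 + b k))"
      by (simp add: std_normal_exponential_moment exp_add ennreal_mult)
  qed simp
  also have "\<dots> = ennreal (exp (\<Sum>k<m. (a k)\<^sup>2 / 2 + b k))"
    by (simp add: exp_sum prod_ennreal)
  finally show ?thesis .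
qed

end

text \<open>A bound on the second moments makes the \<open>X m\<close> uniformly integrable.\<close>

lemma nn_integral_tendsto_0_of_second_moment:
  fixes X :: "nat \<Rightarrow> 'a \<Rightarrow> ennreal"
  assumes "finite_measure M"
    and [measurable]: "\<And>m. X m \<in> borel_measurable M"
    and lim: "AE x in M. (\<lambda>m. X m x) \<longlonglongrightarrow> 0"
    and bound: "\<And>m. (\<integral>\<^sup>+x. (X m x)\<^sup>2 \<partial>M) \<le> B" and B: "B < \<infinity>"
  shows "(\<lambda>m. \<integral>\<^sup>+x. X m x \<partial>M) \<longlonglongrightarrow> 0"
proof (rule tendsto_zero_ennreal)
  interpret finite_measure M by fact
  fix r :: real assume r: "0 < r"
  obtain b where b: "B = ennreal b" "b \<ge> 0" using B by (cases B) auto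
  \<comment> \<open>With this level \<open>b / R \<le> r / 2\<close>, and the part of
    \<open>X m\<close> above \<open>R\<close> is bounded by its square divided by \<open>R\<close>;
    the part below is handled by dominated convergence.\<close>
  define R where "R = 2 * (b + 1) / r"
  have R: "R > 0" using b r by (simp add: R_def)
  have "(\<lambda>m. \<integral>\<^sup>+x. min (X m x) (ennreal R) \<partial>M) \<longlonglongrightarrow> (\<integral>\<^sup>+x. 0 \<partial>M)"
  proof (rule nn_integral_dominated_convergence[where w="\<lambda>_. ennreal R"])
    show "(\<integral>\<^sup>+x. ennreal R \<partial>M) < \<infinity>"
      by (simp add: ennreal_mult_less_top emeasure_eq_measure)
    show "AE x in M. (\<lambda>m. min (X m x) (ennreal R)) \<longlonglongrightarrow> 0"
      using lim
    proof eventually_elim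
      case (elim x)
      from tendsto_min[OF this tendsto_const[of "ennreal R"]] show ?case by simp
    qed
  qed auto
  then have "eventually (\<lambda>m. (\<integral>\<^sup>+x. min (X m x) (ennreal R) \<partial>M) < ennreal (r / 2)) sequentially"
    using r by (intro order_tendstoD(2)) auto
  then show "eventually (\<lambda>m. (\<integral>\<^sup>+x. X m x \<partial>M) < ennreal r) sequentially"
  proof eventually_elim
    case (elim m)
    have pw: "x \<le> min x (ennreal R) + ennreal (1 / R) * x\<^sup>2" for x :: ennreal
    proof (cases "x \<le> ennreal R")
      case True
      then show ?thesis by (simp add: min_absorb1)
    next
      case False
      then have "ennreal R \<le> x" by simp
      have "x = ennreal (1 / R) * (ennreal R * x)"
        using R by (simp add: mult.assoc[symmetric] ennreal_mult[symmetric])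
      also have "\<dots> \<le> ennreal (1 / R) * (x * x)"
        using \<open>ennreal R \<le> x\<close> by (intro mult_left_mono mult_right_mono) auto
      also have "\<dots> \<le> min x (ennreal R) + ennreal (1 / R) * x\<^sup>2"
        by (simp add: power2_eq_square add_increasing)
      finally show ?thesis .
    qed
    have "(\<integral>\<^sup>+x. X m x \<partial>M) \<le> (\<integral>\<^sup>+x. min (X m x) (ennreal R) + ennreal (1 / R) * (X m x)\<^sup>2 \<partial>M)"
      by (intro nn_integral_mono pw)
    also have "\<dots> = (\<integral>\<^sup>+x. min (X m x) (ennreal R) \<partial>M) + ennreal (1 / R) * (\<integral>\<^sup>+x. (X m x)\<^sup>2 \<partial>M)"
      by (simp add: nn_integral_add nn_integral_cmult)
    also have "\<dots> \<le> (\<integral>\<^sup>+x. min (X m x) (ennreal R) \<partial>M) + ennreal (r / 2)"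
    proof (rule add_left_mono)
      have "ennreal (1 / R) * (\<integral>\<^sup>+x. (X m x)\<^sup>2 \<partial>M) \<le> ennreal (1 / R) * ennreal b"
        using bound[of m] b by (intro mult_left_mono) auto
      also have "\<dots> \<le> ennreal (r / 2)"
        using R b r by (simp add: ennreal_mult[symmetric] R_def field_simps)
      finally show "ennreal (1 / R) * (\<integral>\<^sup>+x. (X m x)\<^sup>2 \<partial>M) \<le> ennreal (r / 2)" .
    qed
    also have "\<dots> = ennreal (r / 2) + (\<integral>\<^sup>+x. min (X m x) (ennreal R) \<partial>M)"
      by (rule add.commute)
    also have "\<dots> < ennreal (r / 2) + ennreal (r / 2)"
      using elim by (simp add: ennreal_add_left_cancel_less)
    also have "\<dots> = ennreal r" using r by (simp flip: ennreal_plus)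
    finally show ?case .
  qed
qed

section \<open>Gaussian measures and the closure of the dual\<close>

lemma integrable_mult_of_squares:
  fixes f g :: "'a \<Rightarrow> real"
  assumes [measurable]: "f \<in> borel_measurable M" "g \<in> borel_measurable M"
    and "integrable M (\<lambda>x. (f x)\<^sup>2)" "integrable M (\<lambda>x. (g x)\<^sup>2)"
  shows "integrable M (\<lambda>x. f x * g x)"
proof (rule Bochner_Integration.integrable_bound)
  show "integrable M (\<lambda>x. (f x)\<^sup>2 + (g x)\<^sup>2)" using assms by simp
  have "\<bar>a * b\<bar> \<le> a\<^sup>2 + b\<^sup>2" for a b :: real
  proof -
    have "2 * (\<bar>a\<bar> * \<bar>b\<bar>) \<le> a\<^sup>2 + b\<^sup>2"
      using sum_squares_bound[of "\<bar>a\<bar>" "\<bar>b\<bar>"] by (simp add: mult.assoc)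
    moreover have "0 \<le> \<bar>a\<bar> * \<bar>b\<bar>" by simp
    ultimately show ?thesis unfolding abs_mult by linarith
  qed
  then show "AE x in M. norm (f x * g x) \<le> norm ((f x)\<^sup>2 + (g x)\<^sup>2)"
    by (auto intro!: AE_I2 simp: abs_of_nonneg)
qed measurable

lemma integrable_square_lincomb:
  fixes f g :: "'a \<Rightarrow> real"
  assumes "f \<in> borel_measurable M" "g \<in> borel_measurable M"
    and "integrable M (\<lambda>x. (f x)\<^sup>2)" "integrable M (\<lambda>x. (g x)\<^sup>2)"
  shows "integrable M (\<lambda>x. (a * f x + b * g x)\<^sup>2)"
proof -
  have "integrable M (\<lambda>x. a\<^sup>2 * (f x)\<^sup>2 + b\<^sup>2 * (g x)\<^sup>2 + 2 * a * b * (f x * g x))"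
    using integrable_mult_of_squares[OF assms] assms by simp
  then show ?thesis by (simp add: power2_sum power_mult_distrib mult_ac)
qed

locale centred_gaussian =
  fixes \<mu> :: "'b::real_normed_vector measure"
  assumes gaussian: "mean_zero_gaussian \<mu>"
begin

sublocale prob_space \<mu>
  using gaussian by (simp add: mean_zero_gaussian_def)

lemma sets_\<mu> [measurable_cong]: "sets \<mu> = sets borel"
  using gaussian by (simp add: mean_zero_gaussian_def)

lemma continuous_measurable:
  fixes f :: "'b \<Rightarrow> 'c::topological_space"
  assumes "continuous_on UNIV f"
  shows "f \<in> borel_measurable \<mu>"
  using borel_measurable_continuous_onI[OF assms] by measurable

lemma bounded_linear_measurable:
  fixes L :: "'b \<Rightarrow> real"
  shows "bounded_linear L \<Longrightarrow> L \<in> borel_measurable \<mu>"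
  by (intro continuous_measurable linear_continuous_on)

lemma bounded_linear_gaussian:
  fixes L :: "'b \<Rightarrow> real"
  assumes L: "bounded_linear L"
  shows "integrable \<mu> (\<lambda>w. (L w)\<^sup>2)"
    and "(\<integral>w. iexp (L w) \<partial>\<mu>) = complex_of_real (exp (- (\<integral>w. (L w)\<^sup>2 \<partial>\<mu>) / 2))"
    and "(\<integral>\<^sup>+w. ennreal (exp (t * L w)) \<partial>\<mu>) = ennreal (exp (t\<^sup>2 * (\<integral>w. (L w)\<^sup>2 \<partial>\<mu>) / 2))"
proof -
  note [measurable] = bounded_linear_measurable[OF L]
  obtain V where V: "V \<ge> 0" "distr \<mu> borel L = normal_law 0 V"
    using gaussian L by (auto simp: mean_zero_gaussian_def)
  show "integrable \<mu> (\<lambda>w. (L w)\<^sup>2)"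
    using normal_law_second_moment(1)[OF V(1)] by (simp add: V(2)[symmetric] integrable_distr_eq)
  have V_eq: "V = (\<integral>w. (L w)\<^sup>2 \<partial>\<mu>)"
    using normal_law_second_moment(2)[OF V(1)] by (simp add: V(2)[symmetric] integral_distr)
  show "(\<integral>w. iexp (L w) \<partial>\<mu>) = complex_of_real (exp (- (\<integral>w. (L w)\<^sup>2 \<partial>\<mu>) / 2))"
    using char_normal_law[OF V(1), of 0 1]
    by (simp add: V(2)[symmetric] char_def integral_distr V_eq[symmetric] flip: exp_of_real)
  show "(\<integral>\<^sup>+w. ennreal (exp (t * L w)) \<partial>\<mu>) = ennreal (exp (t\<^sup>2 * (\<integral>w. (L w)\<^sup>2 \<partial>\<mu>) / 2))"
    using normal_law_exponential_moment[OF V(1), of t]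
    by (simp add: V(2)[symmetric] nn_integral_distr V_eq[symmetric])
qed

lemma bounded_linear_dual_closure:
  fixes L :: "'b \<Rightarrow> real"
  assumes "bounded_linear L" shows "L \<in> dual_closure \<mu>"
  using assms bounded_linear_measurable bounded_linear_gaussian(1)
  by (auto simp: dual_closure_def intro!: exI[of _ L])

lemma dual_closure_measurable: "\<xi> \<in> dual_closure \<mu> \<Longrightarrow> \<xi> \<in> borel_measurable \<mu>"
  by (simp add: dual_closure_def)

lemma dual_closure_square: "\<xi> \<in> dual_closure \<mu> \<Longrightarrow> integrable \<mu> (\<lambda>w. (\<xi> w)\<^sup>2)"
  by (simp add: dual_closure_def)

lemma dual_closure_approx:
  assumes \<xi>: "\<xi> \<in> dual_closure \<mu>" and d: "0 < d"
  obtains L :: "'b \<Rightarrow> real" where "bounded_linear L" "integrable \<mu> (\<lambda>w. (\<xi> w - L w)\<^sup>2)"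
    "(\<integral>w. (\<xi> w - L w)\<^sup>2 \<partial>\<mu>) \<le> d"
proof -
  obtain L where L: "bounded_linear L" "(\<integral>\<^sup>+ w. ennreal ((\<xi> w - L w)\<^sup>2) \<partial>\<mu>) < ennreal d"
    using \<xi> d by (auto simp: dual_closure_def)
  note [measurable] = dual_closure_measurable[OF \<xi>] bounded_linear_measurable[OF L(1)]
  have int: "integrable \<mu> (\<lambda>w. (\<xi> w - L w)\<^sup>2)"
    using integrable_square_lincomb[of \<xi> \<mu> L 1 "-1"] \<xi> bounded_linear_gaussian(1)[OF L(1)]
    by (simp add: dual_closure_square)
  then have "ennreal (\<integral>w. (\<xi> w - L w)\<^sup>2 \<partial>\<mu>) \<le> ennreal d"
    using L(2) by (simp add: nn_integral_eq_integral)
  then show thesis using that[OF L(1) int] d by (simp add: ennreal_le_iff)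
qed

lemma dual_closure_lincomb:
  assumes \<xi>: "\<xi> \<in> dual_closure \<mu>" and \<eta>: "\<eta> \<in> dual_closure \<mu>"
  shows "(\<lambda>w. a * \<xi> w + b * \<eta> w) \<in> dual_closure \<mu>"
proof -
  note [measurable] = dual_closure_measurable[OF \<xi>] dual_closure_measurable[OF \<eta>]
  have "\<exists>L :: 'b \<Rightarrow> real. bounded_linear L \<and>
      (\<integral>\<^sup>+ w. ennreal ((a * \<xi> w + b * \<eta> w - L w)\<^sup>2) \<partial>\<mu>) < ennreal e" if e: "0 < e" for e
  proof -
    \<comment> \<open>The summand 1 keeps the denominator positive when \<open>a = b = 0\<close>;
      the total error is then at most
      \<open>2 * (a\<^sup>2 + b\<^sup>2 + 1) * d = e / 2\<close>.\<close>
    define d where "d = e / (4 * (a\<^sup>2 + b\<^sup>2 + 1))"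
    have p: "a\<^sup>2 + b\<^sup>2 + 1 > 0" by (simp add: add_nonneg_pos)
    have d: "d > 0" using e p by (simp add: d_def)
    obtain K where K: "bounded_linear K" "integrable \<mu> (\<lambda>w. (\<xi> w - K w)\<^sup>2)" "(\<integral>w. (\<xi> w - K w)\<^sup>2 \<partial>\<mu>) \<le> d"
      using dual_closure_approx[OF \<xi> d] by blast
    obtain L where L: "bounded_linear L" "integrable \<mu> (\<lambda>w. (\<eta> w - L w)\<^sup>2)" "(\<integral>w. (\<eta> w - L w)\<^sup>2 \<partial>\<mu>) \<le> d"
      using dual_closure_approx[OF \<eta> d] by blast
    note [measurable] = bounded_linear_measurable[OF K(1)] bounded_linear_measurable[OF L(1)]
    define J where "J w = a * K w + b * L w" for w
    have J: "bounded_linear J"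
      unfolding J_def using K(1) L(1) by (intro bounded_linear_add bounded_linear_const_mult)
    have pw: "(a * \<xi> w + b * \<eta> w - J w)\<^sup>2 \<le> 2 * a\<^sup>2 * (\<xi> w - K w)\<^sup>2 + 2 * b\<^sup>2 * (\<eta> w - L w)\<^sup>2" for w
    proof -
      have "a * \<xi> w + b * \<eta> w - J w = a * (\<xi> w - K w) + b * (\<eta> w - L w)"
        by (simp add: J_def algebra_simps)
      moreover have "(s + t)\<^sup>2 \<le> 2 * s\<^sup>2 + 2 * t\<^sup>2" for s t :: real
        using zero_le_power2[of "s - t"] by (simp add: power2_sum power2_diff)
      ultimately have "(a * \<xi> w + b * \<eta> w - J w)\<^sup>2 \<le> 2 * (a * (\<xi> w - K w))\<^sup>2 + 2 * (b * (\<eta> w - L w))\<^sup>2"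
        by simp
      then show ?thesis by (simp only: power_mult_distrib mult.assoc)
    qed
    have "(\<integral>\<^sup>+ w. ennreal ((a * \<xi> w + b * \<eta> w - J w)\<^sup>2) \<partial>\<mu>)
        \<le> (\<integral>\<^sup>+ w. ennreal (2 * a\<^sup>2 * (\<xi> w - K w)\<^sup>2 + 2 * b\<^sup>2 * (\<eta> w - L w)\<^sup>2) \<partial>\<mu>)"
      using pw by (intro nn_integral_mono ennreal_leI)
    also have "\<dots> = ennreal (\<integral>w. 2 * a\<^sup>2 * (\<xi> w - K w)\<^sup>2 + 2 * b\<^sup>2 * (\<eta> w - L w)\<^sup>2 \<partial>\<mu>)"
      using K(2) L(2) by (intro nn_integral_eq_integral) auto
    finally have le: "(\<integral>\<^sup>+ w. ennreal ((a * \<xi> w + b * \<eta> w - J w)\<^sup>2) \<partial>\<mu>) \<le> \<dots>" .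
    have "(\<integral>w. 2 * a\<^sup>2 * (\<xi> w - K w)\<^sup>2 + 2 * b\<^sup>2 * (\<eta> w - L w)\<^sup>2 \<partial>\<mu>)
        = 2 * a\<^sup>2 * (\<integral>w. (\<xi> w - K w)\<^sup>2 \<partial>\<mu>) + 2 * b\<^sup>2 * (\<integral>w. (\<eta> w - L w)\<^sup>2 \<partial>\<mu>)"
      using K(2) L(2) by simp
    also have "\<dots> \<le> 2 * a\<^sup>2 * d + 2 * b\<^sup>2 * d"
      using K(3) L(3) by (intro add_mono mult_left_mono) auto
    also have "\<dots> < e"
    proof -
      have "2 * a\<^sup>2 * d + 2 * b\<^sup>2 * d \<le> 2 * ((a\<^sup>2 + b\<^sup>2 + 1) * d)" using d by (simp add: algebra_simps)
      also have "(a\<^sup>2 + b\<^sup>2 + 1) * d = e / 4"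
      proof -
        have "P * (e / (4 * P)) = e / 4" if "P > 0" for P :: real using that by simp
        from this[OF p] show ?thesis unfolding d_def .
      qed
      finally show ?thesis using e by simp
    qed
    finally have "ennreal (\<integral>w. 2 * a\<^sup>2 * (\<xi> w - K w)\<^sup>2 + 2 * b\<^sup>2 * (\<eta> w - L w)\<^sup>2 \<partial>\<mu>) < ennreal e"
      using e by (simp add: ennreal_lessI)
    with le J show ?thesis by (blast intro: le_less_trans)
  qed
  moreover have "integrable \<mu> (\<lambda>w. (a * \<xi> w + b * \<eta> w)\<^sup>2)"
    using \<xi> \<eta> by (intro integrable_square_lincomb) (auto simp: dual_closure_def)
  ultimately show ?thesis by (simp add: dual_closure_def)
qed

text \<open>Mean-square limits of centred Gaussian variables are centred Gaussian. This is what
  allows the representers of RKHS elements to join the Gaussian process.\<close>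

lemma dual_closure_char:
  assumes \<xi>: "\<xi> \<in> dual_closure \<mu>"
  shows "(\<integral>w. iexp (\<xi> w) \<partial>\<mu>) = complex_of_real (exp (- (\<integral>w. (\<xi> w)\<^sup>2 \<partial>\<mu>) / 2))"
proof -
  note [measurable] = dual_closure_measurable[OF \<xi>]
  define s where "s j = 1 / real (Suc j)" for j
  have s: "s j > 0" for j by (simp add: s_def)
  have s_lim: "s \<longlonglongrightarrow> 0" unfolding s_def[abs_def] by (rule LIMSEQ_Suc[OF lim_1_over_n])
  have "\<forall>j. \<exists>L :: 'b \<Rightarrow> real. bounded_linear L \<and> integrable \<mu> (\<lambda>w. (\<xi> w - L w)\<^sup>2) \<and>
      (\<integral>w. (\<xi> w - L w)\<^sup>2 \<partial>\<mu>) \<le> (s j)\<^sup>2"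
    using dual_closure_approx[OF \<xi>, of "(s _)\<^sup>2"] s by (metis zero_less_power)
  then obtain L :: "nat \<Rightarrow> 'b \<Rightarrow> real" where L: "\<And>j. bounded_linear (L j)"
    "\<And>j. integrable \<mu> (\<lambda>w. (\<xi> w - L j w)\<^sup>2)" "\<And>j. (\<integral>w. (\<xi> w - L j w)\<^sup>2 \<partial>\<mu>) \<le> (s j)\<^sup>2"
    by metis
  note [measurable] = bounded_linear_measurable[OF L(1)]
  note \<xi>2 = dual_closure_square[OF \<xi>]
  note L2 = bounded_linear_gaussian(1)[OF L(1)]
  define C where "C = (\<integral>w. (\<xi> w)\<^sup>2 \<partial>\<mu>)"
  have var_bound: "\<bar>(\<integral>w. (L j w)\<^sup>2 \<partial>\<mu>) - C\<bar> \<le> (s j)\<^sup>2 + s j + s j * C" for j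
  proof -
    have "\<bar>(\<integral>w. (L j w)\<^sup>2 \<partial>\<mu>) - C\<bar> = \<bar>\<integral>w. (L j w)\<^sup>2 - (\<xi> w)\<^sup>2 \<partial>\<mu>\<bar>"
      using \<xi>2 L2 by (simp add: C_def)
    also have "\<dots> \<le> (\<integral>w. \<bar>(L j w)\<^sup>2 - (\<xi> w)\<^sup>2\<bar> \<partial>\<mu>)" by (rule integral_abs_bound)
    \<comment> \<open>Young's inequality with weight \<open>s j\<close>: the approximation error is
      of order \<open>(s j)\<^sup>2\<close>, so it still vanishes after division by
      \<open>s j\<close>, and the other term carries the factor \<open>s j\<close>.\<close>
    also have "\<dots> \<le> (\<integral>w. (1 + 1 / s j) * (\<xi> w - L j w)\<^sup>2 + s j * (\<xi> w)\<^sup>2 \<partial>\<mu>)"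
    proof (rule integral_mono)
      fix w
      define a where "a = \<xi> w - L j w"
      define b where "b = \<xi> w"
      have "0 \<le> (a - s j * b)\<^sup>2 / s j" "0 \<le> (a + s j * b)\<^sup>2 / s j" using s[of j] by simp_all
      then have ab: "2 * \<bar>a * b\<bar> \<le> 1 / s j * a\<^sup>2 + s j * b\<^sup>2"
        using s[of j] by (simp add: power2_sum power2_diff field_simps power2_eq_square abs_if)
      have "L j w = b - a" by (simp add: a_def b_def)
      then have "(L j w)\<^sup>2 - (\<xi> w)\<^sup>2 = a\<^sup>2 - 2 * (a * b)"
        by (simp add: b_def[symmetric] power2_diff)
      then have "\<bar>(L j w)\<^sup>2 - (\<xi> w)\<^sup>2\<bar> \<le> a\<^sup>2 + 2 * \<bar>a * b\<bar>"
        using abs_ge_self[of "a * b"] abs_ge_minus_self[of "a * b"] zero_le_power2[of a]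
        unfolding abs_le_iff by linarith
      then show "\<bar>(L j w)\<^sup>2 - (\<xi> w)\<^sup>2\<bar> \<le> (1 + 1 / s j) * (\<xi> w - L j w)\<^sup>2 + s j * (\<xi> w)\<^sup>2"
        using ab by (simp add: a_def b_def distrib_right)
    qed (use \<xi>2 L2 L(2) in auto)
    also have "\<dots> = (1 + 1 / s j) * (\<integral>w. (\<xi> w - L j w)\<^sup>2 \<partial>\<mu>) + s j * C"
      using \<xi>2 L(2) by (simp add: C_def)
    also have "\<dots> \<le> (1 + 1 / s j) * (s j)\<^sup>2 + s j * C"
      using s[of j] L(3) by (intro add_right_mono mult_left_mono) auto
    also have "\<dots> = (s j)\<^sup>2 + s j + s j * C" using s[of j] by (simp add: distrib_right power2_eq_square)
    finally show ?thesis .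
  qed
  have bound_lim: "(\<lambda>j. (s j)\<^sup>2 + s j + s j * C) \<longlonglongrightarrow> 0"
    using tendsto_add[OF tendsto_add[OF tendsto_power[OF s_lim, of 2] s_lim] tendsto_mult[OF s_lim tendsto_const[of C]]]
    by simp
  have "(\<lambda>j. (\<integral>w. (L j w)\<^sup>2 \<partial>\<mu>) - C) \<longlonglongrightarrow> 0"
    by (rule Lim_null_comparison[OF _ bound_lim]) (simp only: real_norm_def var_bound eventually_True)
  then have var_lim: "(\<lambda>j. \<integral>w. (L j w)\<^sup>2 \<partial>\<mu>) \<longlonglongrightarrow> C" by (simp add: LIM_zero_iff)
  have char_bound: "norm ((\<integral>w. iexp (L j w) \<partial>\<mu>) - (\<integral>w. iexp (\<xi> w) \<partial>\<mu>)) \<le> s j" for j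
  proof -
    have i: "integrable \<mu> (\<lambda>w. iexp (L j w))" "integrable \<mu> (\<lambda>w. iexp (\<xi> w))"
      by (rule integrable_const_bound[where B=1]; simp)+
    have "norm ((\<integral>w. iexp (L j w) \<partial>\<mu>) - (\<integral>w. iexp (\<xi> w) \<partial>\<mu>)) = norm (\<integral>w. iexp (L j w) - iexp (\<xi> w) \<partial>\<mu>)"
      using i by simp
    also have "\<dots> \<le> (\<integral>w. norm (iexp (L j w) - iexp (\<xi> w)) \<partial>\<mu>)" by (rule integral_norm_bound)
    \<comment> \<open>The bound \<open>\<bar>x\<bar> \<le> x\<^sup>2 / (2 * s j) + s j / 2\<close>
      passes from the first moment to the second one without Jensen's inequality.\<close>
    also have "\<dots> \<le> (\<integral>w. (\<xi> w - L j w)\<^sup>2 / (2 * s j) + s j / 2 \<partial>\<mu>)"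
    proof (rule integral_mono)
      fix w
      have "iexp (L j w) - iexp (\<xi> w) = iexp (\<xi> w) * (iexp (L j w - \<xi> w) - 1)"
        by (simp add: algebra_simps flip: exp_add)
      then have "norm (iexp (L j w) - iexp (\<xi> w)) = norm (iexp (L j w - \<xi> w) - 1)"
        by (simp only: norm_mult norm_exp_i_times mult_1)
      also have "\<dots> \<le> \<bar>L j w - \<xi> w\<bar>"
        using iexp_approx1[of "L j w - \<xi> w" 0] by simp
      also have "\<dots> \<le> (\<xi> w - L j w)\<^sup>2 / (2 * s j) + s j / 2"
      proof -
        have "0 \<le> (\<bar>L j w - \<xi> w\<bar> - s j)\<^sup>2 / (2 * s j)" using s[of j] by simp
        also have "\<dots> = (\<xi> w - L j w)\<^sup>2 / (2 * s j) + s j / 2 - \<bar>L j w - \<xi> w\<bar>"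
          using s[of j] by (simp add: power2_diff[of "\<bar>_\<bar>"] power2_commute[of "L j w"] diff_divide_distrib add_divide_distrib)
            (simp add: power2_eq_square)
        finally show ?thesis by simp
      qed
      finally show "norm (iexp (L j w) - iexp (\<xi> w)) \<le> (\<xi> w - L j w)\<^sup>2 / (2 * s j) + s j / 2" .
    qed (use i L(2) in auto)
    also have "\<dots> = (\<integral>w. (\<xi> w - L j w)\<^sup>2 \<partial>\<mu>) / (2 * s j) + s j / 2"
      using L(2) by (simp add: prob_space)
    also have "\<dots> \<le> (s j)\<^sup>2 / (2 * s j) + s j / 2"
      using L(3)[of j] s[of j] by (intro add_right_mono divide_right_mono) auto
    also have "\<dots> = s j" using s[of j] by (simp add: power2_eq_square)
    finally show ?thesis .
  qed
  have "(\<lambda>j. (\<integral>w. iexp (L j w) \<partial>\<mu>) - (\<integral>w. iexp (\<xi> w) \<partial>\<mu>)) \<longlonglongrightarrow> 0"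
    by (rule Lim_null_comparison[OF _ s_lim]) (simp only: char_bound eventually_True)
  then have "(\<lambda>j. \<integral>w. iexp (L j w) \<partial>\<mu>) \<longlonglongrightarrow> (\<integral>w. iexp (\<xi> w) \<partial>\<mu>)" by (simp add: LIM_zero_iff)
  moreover have "(\<lambda>j. \<integral>w. iexp (L j w) \<partial>\<mu>) \<longlonglongrightarrow> complex_of_real (exp (- C / 2))"
    unfolding bounded_linear_gaussian(2)[OF L(1)] by (intro tendsto_intros var_lim) auto
  ultimately show ?thesis unfolding C_def by (rule LIMSEQ_unique)
qed

text \<open>For Gaussian variables pointwise convergence already forces the variances to vanish:
  dominated convergence applies to the characteristic functions, which are bounded by 1, and the
  variance is recovered by taking logarithms. No integrable bound on the squares is called
  for.\<close>

lemma variance_tendsto_0: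
  fixes L :: "nat \<Rightarrow> 'b \<Rightarrow> real"
  assumes L: "\<And>m. bounded_linear (L m)" and lim: "\<And>w. (\<lambda>m. L m w) \<longlonglongrightarrow> 0"
  shows "(\<lambda>m. \<integral>w. (L m w)\<^sup>2 \<partial>\<mu>) \<longlonglongrightarrow> 0"
proof -
  note [measurable] = bounded_linear_measurable[OF L]
  have "(\<lambda>m. \<integral>w. iexp (L m w) \<partial>\<mu>) \<longlonglongrightarrow> (\<integral>w. 1 \<partial>\<mu>)"
  proof (rule integral_dominated_convergence[where w="\<lambda>_. 1"])
    show "AE w in \<mu>. (\<lambda>m. iexp (L m w)) \<longlonglongrightarrow> 1"
    proof (rule AE_I2)
      fix w
      have "(\<lambda>m. iexp (L m w)) \<longlonglongrightarrow> iexp 0" by (intro tendsto_intros lim)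
      then show "(\<lambda>m. iexp (L m w)) \<longlonglongrightarrow> 1" by simp
    qed
  qed auto
  then have "(\<lambda>m. Re (complex_of_real (exp (- (\<integral>w. (L m w)\<^sup>2 \<partial>\<mu>) / 2)))) \<longlonglongrightarrow> Re 1"
    unfolding bounded_linear_gaussian(2)[OF L] by (intro tendsto_Re) (simp add: prob_space)
  then have "(\<lambda>m. ln (exp (- (\<integral>w. (L m w)\<^sup>2 \<partial>\<mu>) / 2))) \<longlonglongrightarrow> ln 1"
    by (intro tendsto_ln) simp_all
  then have "(\<lambda>m. -2 * (- (\<integral>w. (L m w)\<^sup>2 \<partial>\<mu>) / 2)) \<longlonglongrightarrow> -2 * 0"
    by (intro tendsto_mult tendsto_const) simp
  then show ?thesis by simp
qed

end

section \<open>Truncation of the likelihood\<close>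

locale white_noise_model = noise: std_noise M \<epsilon> + prior: centred_gaussian \<mu>
  for M :: "'w measure" and \<epsilon> and \<mu> :: "L2 measure" +
  fixes \<phi> :: "nat \<Rightarrow> L2" and f0 :: L2
  assumes onb: "orthonormal_basis \<phi>"
begin

sublocale joint: pair_prob_space M \<mu> ..

lemma inner_measurable [measurable (raw)]:
  assumes "F \<in> measurable P \<mu>"
  shows "(\<lambda>x. inner (F x) g) \<in> borel_measurable P"
  by (rule measurable_compose[OF assms])
    (intro prior.bounded_linear_measurable bounded_linear_inner_left)

lemma norm_measurable [measurable (raw)]:
  assumes "F \<in> measurable P \<mu>"
  shows "(\<lambda>x. norm (F x)) \<in> borel_measurable P"
  by (rule measurable_compose[OF assms]) (intro prior.continuous_measurable continuous_intros)

definition likelihood :: "real \<Rightarrow> nat \<Rightarrow> 'w \<Rightarrow> L2 \<Rightarrow> real" where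
  "likelihood a n \<omega> f = exp (a * log_likelihood \<phi> n (white_noise_obs \<phi> f0 \<epsilon> n \<omega>) f)"

text \<open>The squared norm is expanded by Parseval and cut off together with the data series. With
  \<open>N = real n * a\<close> and data scaled by \<open>N\<close>, this is
  \<open>weight\<close>.\<close>

definition truncated_likelihood :: "real \<Rightarrow> nat \<Rightarrow> nat \<Rightarrow> 'w \<Rightarrow> L2 \<Rightarrow> real" where
  "truncated_likelihood a n m \<omega> f =
     exp (\<Sum>k<m. real n * a * white_noise_obs \<phi> f0 \<epsilon> n \<omega> k * inner f (\<phi> k)
       - real n * a * (inner f (\<phi> k))\<^sup>2 / 2)"

lemma likelihood_measurable [measurable]:
  "(\<lambda>(\<omega>, f). likelihood a n \<omega> f) \<in> borel_measurable (M \<Otimes>\<^sub>M \<mu>)"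
  unfolding likelihood_def log_likelihood_def white_noise_obs_def split_beta' by measurable

lemma truncated_likelihood_measurable [measurable]:
  "(\<lambda>(\<omega>, f). truncated_likelihood a n m \<omega> f) \<in> borel_measurable (M \<Otimes>\<^sub>M \<mu>)"
  unfolding truncated_likelihood_def white_noise_obs_def split_beta' by measurable

lemma likelihood_measurable_section [measurable]:
  "likelihood a n \<omega> \<in> borel_measurable \<mu>"
  unfolding likelihood_def[abs_def] log_likelihood_def by measurable

lemma truncated_likelihood_measurable_section [measurable]:
  "truncated_likelihood a n m \<omega> \<in> borel_measurable \<mu>"
  unfolding truncated_likelihood_def[abs_def] by measurable

lemma likelihood_pos: "0 < likelihood a n \<omega> f"
  by (simp add: likelihood_def)

lemma truncated_likelihood_pos: "0 < truncated_likelihood a n m \<omega> f"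
  by (simp add: truncated_likelihood_def)

lemma basis_coefficients_summable: "summable (\<lambda>k. (inner g (\<phi> k))\<^sup>2)"
  using parseval_norm[OF onb] sums_summable by blast

text \<open>The exceptional null set depends on \<open>f\<close>. Later arguments therefore
  integrate over the noise first, at fixed \<open>f\<close>, and over the prior second.\<close>

lemma truncated_likelihood_tendsto:
  assumes "0 < n"
  shows "AE \<omega> in M. (\<lambda>m. truncated_likelihood a n m \<omega> f) \<longlonglongrightarrow> likelihood a n \<omega> f"
  using noise.AE_summable_noise[OF basis_coefficients_summable[of f]]
proof eventually_elim
  case (elim \<omega>)
  let ?Y = "white_noise_obs \<phi> f0 \<epsilon> n \<omega>"
  have "summable (\<lambda>k. inner f (\<phi> k) * inner f0 (\<phi> k))"
    using parseval[OF onb] sums_summable by blast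
  from summable_add[OF this summable_mult[OF elim, of "1 / sqrt n"]]
  have "summable (\<lambda>k. inner f (\<phi> k) * ?Y k)"
    by (simp add: white_noise_obs_def algebra_simps)
  from sums_diff[OF sums_mult[OF summable_sums[OF this], of "real n * a"]
      sums_mult[OF parseval_norm[OF onb, of f], of "real n * a / 2"]]
  have "(\<lambda>k. real n * a * ?Y k * inner f (\<phi> k) - real n * a * (inner f (\<phi> k))\<^sup>2 / 2)
      sums (a * log_likelihood \<phi> n ?Y f)"
    by (simp add: log_likelihood_def algebra_simps)
  then show ?case
    unfolding truncated_likelihood_def likelihood_def sums_def by (rule tendsto_exp)
qed

lemma truncated_likelihood_moment:
  assumes n: "0 < n"
  shows "(\<integral>\<^sup>+\<omega>. ennreal (truncated_likelihood a n m \<omega> f ^ r) \<partial>M) =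
    ennreal (exp (\<Sum>k<m. (real r * (real n * a / sqrt n) * inner f (\<phi> k))\<^sup>2 / 2 +
       (real r * (real n * a) * inner f0 (\<phi> k) * inner f (\<phi> k) - real r * (real n * a) * (inner f (\<phi> k))\<^sup>2 / 2)))"
proof -
  have "truncated_likelihood a n m \<omega> f ^ r =
    exp (\<Sum>k<m. (real r * (real n * a / sqrt n) * inner f (\<phi> k)) * \<epsilon> k \<omega> +
       (real r * (real n * a) * inner f0 (\<phi> k) * inner f (\<phi> k) - real r * (real n * a) * (inner f (\<phi> k))\<^sup>2 / 2))" for \<omega>
    unfolding truncated_likelihood_def exp_of_nat_mult[symmetric] sum_distrib_left
    by (intro arg_cong[where f=exp] sum.cong) (simp_all add: white_noise_obs_def algebra_simps)
  then show ?thesis by (simp only: noise.noise_exponential_moment)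
qed

text \<open>Here \<open>a \<le> 1\<close> enters: the variance \<open>n * a\<^sup>2\<close>
  multiplying the squared coefficients of \<open>f\<close> in an exponential moment is dominated by
  the factor \<open>n * a\<close> of the quadratic penalty.\<close>

lemma noise_scale:
  assumes "0 < n" "0 < a" "a \<le> 1"
  shows "(real n * a / sqrt n)\<^sup>2 \<le> real n * a"
proof -
  have "(real n * a / sqrt n)\<^sup>2 = real n * a * a"
    using assms by (simp add: power_divide power_mult_distrib power2_eq_square)
  also have "\<dots> \<le> real n * a * 1" using assms by (intro mult_left_mono) auto
  finally show ?thesis by simp
qed

text \<open>The penalty compensates the exponential moment of the noise, and what remains is linear
  in \<open>f\<close> in the exponent. Such a bound is integrable under every Gaussian
  prior.\<close>

lemma truncated_likelihood_expectation:
  assumes "0 < n" "0 < a" "a \<le> 1"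
  shows "(\<integral>\<^sup>+\<omega>. ennreal (truncated_likelihood a n m \<omega> f) \<partial>M)
    \<le> ennreal (exp (real n * a * inner f (proj \<phi> m f0)))"
proof -
  have "(\<Sum>k<m. (real 1 * (real n * a / sqrt n) * inner f (\<phi> k))\<^sup>2 / 2 +
       (real 1 * (real n * a) * inner f0 (\<phi> k) * inner f (\<phi> k) - real 1 * (real n * a) * (inner f (\<phi> k))\<^sup>2 / 2))
     \<le> (\<Sum>k<m. real n * a * (inner f0 (\<phi> k) * inner f (\<phi> k)))"
  proof (rule sum_mono)
    fix k
    have "(real n * a / sqrt n)\<^sup>2 * (inner f (\<phi> k))\<^sup>2 \<le> real n * a * (inner f (\<phi> k))\<^sup>2"
      using noise_scale[OF assms] by (intro mult_right_mono) auto
    then show "(real 1 * (real n * a / sqrt n) * inner f (\<phi> k))\<^sup>2 / 2 +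
       (real 1 * (real n * a) * inner f0 (\<phi> k) * inner f (\<phi> k) - real 1 * (real n * a) * (inner f (\<phi> k))\<^sup>2 / 2)
      \<le> real n * a * (inner f0 (\<phi> k) * inner f (\<phi> k))"
      unfolding power_mult_distrib of_nat_1 one_power2 mult_1_left by (simp only: mult.assoc)
  qed
  also have "\<dots> = real n * a * inner f (proj \<phi> m f0)"
    by (simp add: inner_commute[of f] inner_proj_left sum_distrib_left)
  finally show ?thesis
    using truncated_likelihood_moment[OF assms(1), of a m f 1] by (simp add: ennreal_leI)
qed

text \<open>Serves at fixed \<open>f\<close>, for uniform integrability in the noise. Its growth
  \<open>exp (N * (norm f)\<^sup>2)\<close> need not be integrable under the prior, which is why the
  integration over \<open>f\<close> rests on the first moment.\<close>

lemma truncated_likelihood_second_moment: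
  assumes "0 < n" "0 < a" "a \<le> 1"
  shows "(\<integral>\<^sup>+\<omega>. (ennreal (truncated_likelihood a n m \<omega> f))\<^sup>2 \<partial>M)
    \<le> ennreal (exp (2 * (real n * a) * (norm f * norm f0) + real n * a * (norm f)\<^sup>2))"
proof -
  let ?N = "real n * a"
  have N: "?N > 0" using assms by simp
  have "(\<Sum>k<m. (real 2 * (?N / sqrt n) * inner f (\<phi> k))\<^sup>2 / 2 +
       (real 2 * ?N * inner f0 (\<phi> k) * inner f (\<phi> k) - real 2 * ?N * (inner f (\<phi> k))\<^sup>2 / 2))
     \<le> (\<Sum>k<m. 2 * ?N * (inner f0 (\<phi> k) * inner f (\<phi> k)) + ?N * (inner f (\<phi> k))\<^sup>2)"
  proof (rule sum_mono)
    fix k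
    have "(?N / sqrt n)\<^sup>2 * (inner f (\<phi> k))\<^sup>2 \<le> ?N * (inner f (\<phi> k))\<^sup>2"
      using noise_scale[OF assms] by (intro mult_right_mono) auto
    moreover have "(real 2 * (?N / sqrt n) * inner f (\<phi> k))\<^sup>2 / 2 = 2 * ((?N / sqrt n)\<^sup>2 * (inner f (\<phi> k))\<^sup>2)"
      by (simp add: power_mult_distrib power_divide)
    moreover have "real 2 * ?N * inner f0 (\<phi> k) * inner f (\<phi> k) = 2 * ?N * (inner f0 (\<phi> k) * inner f (\<phi> k))"
      by simp
    moreover have "real 2 * ?N * (inner f (\<phi> k))\<^sup>2 / 2 = ?N * (inner f (\<phi> k))\<^sup>2" by simp
    ultimately show "(real 2 * (?N / sqrt n) * inner f (\<phi> k))\<^sup>2 / 2 +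
       (real 2 * ?N * inner f0 (\<phi> k) * inner f (\<phi> k) - real 2 * ?N * (inner f (\<phi> k))\<^sup>2 / 2)
      \<le> 2 * ?N * (inner f0 (\<phi> k) * inner f (\<phi> k)) + ?N * (inner f (\<phi> k))\<^sup>2"
      by linarith
  qed
  also have "\<dots> = 2 * ?N * inner f (proj \<phi> m f0) + ?N * (norm (proj \<phi> m f))\<^sup>2"
    by (simp add: inner_commute[of f "proj \<phi> m f0"] inner_proj_left norm_proj_sq[OF onb]
        sum.distrib flip: sum_distrib_left)
  also have "\<dots> \<le> 2 * ?N * (norm f * norm f0) + ?N * (norm f)\<^sup>2"
  proof (intro add_mono mult_left_mono power_mono norm_proj_le onb)
    have "inner f (proj \<phi> m f0) \<le> norm f * norm (proj \<phi> m f0)" by (rule norm_cauchy_schwarz)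
    also have "\<dots> \<le> norm f * norm f0" by (intro mult_left_mono norm_proj_le onb) simp
    finally show "inner f (proj \<phi> m f0) \<le> norm f * norm f0" .
  qed (use N in auto)
  finally show ?thesis
    using truncated_likelihood_moment[OF assms(1), of a m f 2] truncated_likelihood_pos[of a n m _ f]
    by (simp add: ennreal_leI ennreal_power less_imp_le)
qed

lemma likelihood_measurable_noise [measurable]: "(\<lambda>\<omega>. likelihood a n \<omega> f) \<in> borel_measurable M"
  unfolding likelihood_def[abs_def] log_likelihood_def white_noise_obs_def by measurable

lemma truncated_likelihood_measurable_noise [measurable]:
  "(\<lambda>\<omega>. truncated_likelihood a n m \<omega> f) \<in> borel_measurable M"
  unfolding truncated_likelihood_def[abs_def] white_noise_obs_def by measurable

lemma fatou_bound:
  fixes X :: "nat \<Rightarrow> 'w \<Rightarrow> ennreal"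
  assumes [measurable]: "\<And>m. X m \<in> borel_measurable M" "Z \<in> borel_measurable M"
    and lim: "AE \<omega> in M. (\<lambda>m. X m \<omega>) \<longlonglongrightarrow> Z \<omega>"
    and bound: "\<And>m. (\<integral>\<^sup>+\<omega>. X m \<omega> \<partial>M) \<le> B m" and B: "B \<longlonglongrightarrow> b"
  shows "(\<integral>\<^sup>+\<omega>. Z \<omega> \<partial>M) \<le> b"
proof -
  have "(\<integral>\<^sup>+\<omega>. Z \<omega> \<partial>M) = (\<integral>\<^sup>+\<omega>. liminf (\<lambda>m. X m \<omega>) \<partial>M)"
  proof (rule nn_integral_cong_AE)
    show "AE \<omega> in M. Z \<omega> = liminf (\<lambda>m. X m \<omega>)"
      using lim by eventually_elim (simp add: lim_imp_Liminf)
  qed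
  also have "\<dots> \<le> liminf (\<lambda>m. \<integral>\<^sup>+\<omega>. X m \<omega> \<partial>M)" by (rule nn_integral_liminf) measurable
  also have "\<dots> \<le> liminf B" using bound by (intro Liminf_mono) auto
  also have "\<dots> = b" using B by (intro lim_imp_Liminf) auto
  finally show ?thesis .
qed

lemma ennreal_diff_square_le:
  fixes s t :: real
  assumes "0 \<le> s" "0 \<le> t"
  shows "(ennreal \<bar>s - t\<bar>)\<^sup>2 \<le> 2 * (ennreal s)\<^sup>2 + 2 * (ennreal t)\<^sup>2"
proof -
  have "\<bar>s - t\<bar>\<^sup>2 \<le> 2 * s\<^sup>2 + 2 * t\<^sup>2"
    using zero_le_power2[of "s + t"] by (simp add: power2_sum power2_diff)
  then have "ennreal (\<bar>s - t\<bar>\<^sup>2) \<le> ennreal (2 * s\<^sup>2 + 2 * t\<^sup>2)" by (rule ennreal_leI)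
  then show ?thesis using assms by (simp add: ennreal_power ennreal_mult ennreal_plus)
qed

text \<open>The second moments of the truncated likelihoods are bounded uniformly in
  \<open>m\<close>, and Fatou gives the same bound for the limit; almost sure convergence then
  upgrades to convergence in mean.\<close>

lemma expected_truncation_error_tendsto:
  assumes na: "0 < n" "0 < a" "a \<le> 1"
  shows "(\<lambda>m. \<integral>\<^sup>+\<omega>. ennreal \<bar>truncated_likelihood a n m \<omega> f - likelihood a n \<omega> f\<bar> \<partial>M) \<longlonglongrightarrow> 0"
proof -
  define b where "b = ennreal (exp (2 * (real n * a) * (norm f * norm f0) + real n * a * (norm f)\<^sup>2))"
  note lim = truncated_likelihood_tendsto[OF na(1), of a f]
  have second: "(\<integral>\<^sup>+\<omega>. (ennreal (truncated_likelihood a n m \<omega> f))\<^sup>2 \<partial>M) \<le> b" for m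
    unfolding b_def by (rule truncated_likelihood_second_moment[OF na])
  have second': "(\<integral>\<^sup>+\<omega>. (ennreal (likelihood a n \<omega> f))\<^sup>2 \<partial>M) \<le> b"
  proof (rule fatou_bound[OF _ _ _ second tendsto_const])
    show "AE \<omega> in M. (\<lambda>m. (ennreal (truncated_likelihood a n m \<omega> f))\<^sup>2) \<longlonglongrightarrow> (ennreal (likelihood a n \<omega> f))\<^sup>2"
      using lim
    proof eventually_elim
      case (elim \<omega>)
      have "(\<lambda>m. ennreal ((truncated_likelihood a n m \<omega> f)\<^sup>2)) \<longlonglongrightarrow> ennreal ((likelihood a n \<omega> f)\<^sup>2)"
        by (intro tendsto_ennrealI tendsto_power elim)
      then show ?case
        using truncated_likelihood_pos likelihood_pos by (simp add: ennreal_power less_imp_le)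
    qed
  qed measurable
  show ?thesis
  proof (rule nn_integral_tendsto_0_of_second_moment[where B="2 * b + 2 * b"])
    show "finite_measure M" by unfold_locales
    show "AE \<omega> in M. (\<lambda>m. ennreal \<bar>truncated_likelihood a n m \<omega> f - likelihood a n \<omega> f\<bar>) \<longlonglongrightarrow> 0"
      using lim
    proof eventually_elim
      case (elim \<omega>)
      have "(\<lambda>m. \<bar>truncated_likelihood a n m \<omega> f - likelihood a n \<omega> f\<bar>) \<longlonglongrightarrow> 0"
        using elim by (intro tendsto_rabs_zero) (simp add: LIM_zero_iff)
      then show ?case by (metis ennreal_0 tendsto_ennrealI)
    qed
    show "2 * b + 2 * b < \<infinity>" by (simp add: b_def ennreal_mult_less_top)
    fix m
    have "(\<integral>\<^sup>+\<omega>. (ennreal \<bar>truncated_likelihood a n m \<omega> f - likelihood a n \<omega> f\<bar>)\<^sup>2 \<partial>M)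
        \<le> (\<integral>\<^sup>+\<omega>. 2 * (ennreal (truncated_likelihood a n m \<omega> f))\<^sup>2 + 2 * (ennreal (likelihood a n \<omega> f))\<^sup>2 \<partial>M)"
      by (intro nn_integral_mono ennreal_diff_square_le less_imp_le likelihood_pos truncated_likelihood_pos)
    also have "\<dots> = 2 * (\<integral>\<^sup>+\<omega>. (ennreal (truncated_likelihood a n m \<omega> f))\<^sup>2 \<partial>M) + 2 * (\<integral>\<^sup>+\<omega>. (ennreal (likelihood a n \<omega> f))\<^sup>2 \<partial>M)"
      by (simp add: nn_integral_add nn_integral_cmult)
    also have "\<dots> \<le> 2 * b + 2 * b"
      using second second' by (intro add_mono mult_left_mono) auto
    finally show "(\<integral>\<^sup>+\<omega>. (ennreal \<bar>truncated_likelihood a n m \<omega> f - likelihood a n \<omega> f\<bar>)\<^sup>2 \<partial>M) \<le> 2 * b + 2 * b" .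
  qed measurable
qed

lemma expected_truncation_error_le:
  assumes na: "0 < n" "0 < a" "a \<le> 1"
  shows "(\<integral>\<^sup>+\<omega>. ennreal \<bar>truncated_likelihood a n m \<omega> f - likelihood a n \<omega> f\<bar> \<partial>M)
    \<le> ennreal (exp (real n * a * inner f (proj \<phi> m f0)) + exp (real n * a * inner f f0))"
proof -
  let ?N = "real n * a"
  have first: "(\<integral>\<^sup>+\<omega>. ennreal (likelihood a n \<omega> f) \<partial>M) \<le> ennreal (exp (?N * inner f f0))"
  proof (rule fatou_bound)
    show "AE \<omega> in M. (\<lambda>m. ennreal (truncated_likelihood a n m \<omega> f)) \<longlonglongrightarrow> ennreal (likelihood a n \<omega> f)"
      using truncated_likelihood_tendsto[OF na(1), of a f] by eventually_elim (rule tendsto_ennrealI)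
    show "(\<lambda>m. ennreal (exp (?N * inner f (proj \<phi> m f0)))) \<longlonglongrightarrow> ennreal (exp (?N * inner f f0))"
      by (intro tendsto_ennrealI tendsto_intros proj_tendsto onb)
  qed (use truncated_likelihood_expectation[OF na] in measurable)
  have "(\<integral>\<^sup>+\<omega>. ennreal \<bar>truncated_likelihood a n m \<omega> f - likelihood a n \<omega> f\<bar> \<partial>M)
      \<le> (\<integral>\<^sup>+\<omega>. ennreal (truncated_likelihood a n m \<omega> f) + ennreal (likelihood a n \<omega> f) \<partial>M)"
  proof (intro nn_integral_mono)
    fix \<omega>
    show "ennreal \<bar>truncated_likelihood a n m \<omega> f - likelihood a n \<omega> f\<bar>
        \<le> ennreal (truncated_likelihood a n m \<omega> f) + ennreal (likelihood a n \<omega> f)"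
      using truncated_likelihood_pos[of a n m \<omega> f] likelihood_pos[of a n \<omega> f]
      by (simp flip: ennreal_plus)
  qed
  also have "\<dots> = (\<integral>\<^sup>+\<omega>. ennreal (truncated_likelihood a n m \<omega> f) \<partial>M) + (\<integral>\<^sup>+\<omega>. ennreal (likelihood a n \<omega> f) \<partial>M)"
    by (simp add: nn_integral_add)
  also have "\<dots> \<le> ennreal (exp (?N * inner f (proj \<phi> m f0))) + ennreal (exp (?N * inner f f0))"
    using truncated_likelihood_expectation[OF na] first by (intro add_mono)
  finally show ?thesis by (simp add: ennreal_plus)
qed

lemma residual_variance_tendsto:
  "(\<lambda>m. \<integral>w. (inner w (g - proj \<phi> m g))\<^sup>2 \<partial>\<mu>) \<longlonglongrightarrow> 0"
proof (rule prior.variance_tendsto_0)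
  fix w
  have "(\<lambda>m. inner w (g - proj \<phi> m g)) \<longlonglongrightarrow> inner w (g - g)"
    by (intro tendsto_intros proj_tendsto onb)
  then show "(\<lambda>m. inner w (g - proj \<phi> m g)) \<longlonglongrightarrow> 0" by simp
qed (rule bounded_linear_inner_left)

text \<open>After exchanging the integrals, the inner one tends to 0 for every \<open>f\<close> and
  is bounded by two exponentials of linear functionals of \<open>f\<close>. Their second moments
  under the prior are governed by the variances of the functionals given by \<open>f0\<close> and
  its projections. Those are bounded in \<open>m\<close>, because the residual variances
  converge.\<close>

lemma truncation_error_tendsto:
  assumes na: "0 < n" "0 < a" "a \<le> 1"
  shows "(\<lambda>m. \<integral>\<^sup>+\<omega>. (\<integral>\<^sup>+f. ennreal \<bar>truncated_likelihood a n m \<omega> f - likelihood a n \<omega> f\<bar> \<partial>\<mu>) \<partial>M) \<longlonglongrightarrow> 0"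
proof -
  let ?N = "real n * a"
  define T where "T m f = (\<integral>\<^sup>+\<omega>. ennreal \<bar>truncated_likelihood a n m \<omega> f - likelihood a n \<omega> f\<bar> \<partial>M)" for m f
  have Tm [measurable]: "T m \<in> borel_measurable \<mu>" for m
    unfolding T_def[abs_def] by measurable
  define v where "v g = (\<integral>w. (inner w g)\<^sup>2 \<partial>\<mu>)" for g
  obtain K where K: "\<And>m. v (f0 - proj \<phi> m f0) \<le> K"
  proof -
    have "Bseq (\<lambda>m. v (f0 - proj \<phi> m f0))"
      using residual_variance_tendsto[of f0] unfolding v_def by (intro convergent_imp_Bseq convergentI)
    then obtain K where "\<And>m. norm (v (f0 - proj \<phi> m f0)) \<le> K" by (auto simp: Bseq_def)
    then show thesis by (intro that[of K]) (metis abs_ge_self order_trans real_norm_def)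
  qed
  have sq_int: "integrable \<mu> (\<lambda>w. (inner w g)\<^sup>2)" for g
    by (rule prior.bounded_linear_gaussian(1)[OF bounded_linear_inner_left])
  have vproj: "v (proj \<phi> m f0) \<le> 2 * v f0 + 2 * K" for m
  proof -
    have "v (proj \<phi> m f0) \<le> (\<integral>w. 2 * (inner w f0)\<^sup>2 + 2 * (inner w (f0 - proj \<phi> m f0))\<^sup>2 \<partial>\<mu>)"
      unfolding v_def
    proof (rule integral_mono)
      fix w
      have "s\<^sup>2 \<le> 2 * t\<^sup>2 + 2 * (t - s)\<^sup>2" for s t :: real
        using zero_le_power2[of "2 * t - s"] by (simp add: power2_diff power_mult_distrib)
      from this[of "inner w (proj \<phi> m f0)" "inner w f0"]
      show "(inner w (proj \<phi> m f0))\<^sup>2 \<le> 2 * (inner w f0)\<^sup>2 + 2 * (inner w (f0 - proj \<phi> m f0))\<^sup>2"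
        by (simp add: inner_diff_right)
    qed (use sq_int in auto)
    also have "\<dots> = 2 * v f0 + 2 * v (f0 - proj \<phi> m f0)" using sq_int by (simp add: v_def)
    also have "\<dots> \<le> 2 * v f0 + 2 * K" using K by simp
    finally show ?thesis .
  qed
  have mgf: "(\<integral>\<^sup>+f. (ennreal (exp (?N * inner f g)))\<^sup>2 \<partial>\<mu>) = ennreal (exp (2 * ?N\<^sup>2 * v g))" for g
  proof -
    have "(ennreal (exp (?N * inner f g)))\<^sup>2 = ennreal (exp ((2 * ?N) * inner f g))" for f
      by (simp add: ennreal_power flip: exp_double)
    then show ?thesis
      using prior.bounded_linear_gaussian(3)[OF bounded_linear_inner_left[of g], of "2 * ?N"]
      by (simp add: v_def power_mult_distrib)
  qed
  have "(\<lambda>m. \<integral>\<^sup>+f. T m f \<partial>\<mu>) \<longlonglongrightarrow> 0"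
  proof (rule nn_integral_tendsto_0_of_second_moment)
    show "finite_measure \<mu>" by unfold_locales
    show "AE f in \<mu>. (\<lambda>m. T m f) \<longlonglongrightarrow> 0"
      unfolding T_def using expected_truncation_error_tendsto[OF na] by simp
    define B where "B = 2 * ennreal (exp (2 * ?N\<^sup>2 * (2 * v f0 + 2 * K))) + 2 * ennreal (exp (2 * ?N\<^sup>2 * v f0))"
    show "B < \<infinity>" by (simp add: B_def ennreal_mult_less_top)
    fix m
    have "(\<integral>\<^sup>+f. (T m f)\<^sup>2 \<partial>\<mu>)
        \<le> (\<integral>\<^sup>+f. 2 * (ennreal (exp (?N * inner f (proj \<phi> m f0))))\<^sup>2 + 2 * (ennreal (exp (?N * inner f f0)))\<^sup>2 \<partial>\<mu>)"
    proof (intro nn_integral_mono)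
      fix f
      define s t where "s = exp (?N * inner f (proj \<phi> m f0))" and "t = exp (?N * inner f f0)"
      have "(T m f)\<^sup>2 \<le> (ennreal (s + t))\<^sup>2"
        unfolding T_def s_def t_def by (intro power_mono expected_truncation_error_le na) simp
      also have "\<dots> = (ennreal \<bar>s - (- t)\<bar>)\<^sup>2" by (simp add: s_def t_def)
      also have "\<dots> = ennreal (\<bar>s - (- t)\<bar>\<^sup>2)" by (simp add: ennreal_power)
      also have "\<dots> \<le> ennreal (2 * s\<^sup>2 + 2 * t\<^sup>2)"
        using zero_le_power2[of "s - t"] by (intro ennreal_leI) (simp add: power2_sum power2_diff)
      also have "\<dots> = 2 * (ennreal s)\<^sup>2 + 2 * (ennreal t)\<^sup>2"
        by (simp add: ennreal_plus ennreal_mult ennreal_power s_def t_def)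
      finally show "(T m f)\<^sup>2 \<le> 2 * (ennreal (exp (?N * inner f (proj \<phi> m f0))))\<^sup>2 + 2 * (ennreal (exp (?N * inner f f0)))\<^sup>2"
        unfolding s_def t_def .
    qed
    also have "\<dots> = 2 * (\<integral>\<^sup>+f. (ennreal (exp (?N * inner f (proj \<phi> m f0))))\<^sup>2 \<partial>\<mu>)
        + 2 * (\<integral>\<^sup>+f. (ennreal (exp (?N * inner f f0)))\<^sup>2 \<partial>\<mu>)"
      by (simp add: nn_integral_add nn_integral_cmult)
    also have "\<dots> \<le> B"
      unfolding mgf B_def using vproj[of m]
      by (intro add_mono mult_left_mono ennreal_leI iffD2[OF exp_le_cancel_iff]) auto
    finally show "(\<integral>\<^sup>+f. (T m f)\<^sup>2 \<partial>\<mu>) \<le> B" .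
  qed measurable
  moreover have "(\<integral>\<^sup>+f. T m f \<partial>\<mu>) =
      (\<integral>\<^sup>+\<omega>. (\<integral>\<^sup>+f. ennreal \<bar>truncated_likelihood a n m \<omega> f - likelihood a n \<omega> f\<bar> \<partial>\<mu>) \<partial>M)" for m
    unfolding T_def by (rule joint.Fubini') measurable
  ultimately show ?thesis by simp
qed

end

lemma (in prob_space) AE_tendsto_0_imp_prob:
  fixes X :: "nat \<Rightarrow> 'a \<Rightarrow> real"
  assumes [measurable]: "\<And>m. X m \<in> borel_measurable M"
    and lim: "AE x in M. (\<lambda>m. X m x) \<longlonglongrightarrow> 0" and d: "0 < d"
  shows "(\<lambda>m. prob {x\<in>space M. d \<le> \<bar>X m x\<bar>}) \<longlonglongrightarrow> 0"
proof -
  let ?E = "\<lambda>m. {x\<in>space M. d \<le> \<bar>X m x\<bar>}"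
  have "(\<lambda>m. \<integral>\<^sup>+x. indicator (?E m) x \<partial>M) \<longlonglongrightarrow> 0"
  proof (rule nn_integral_tendsto_0_of_second_moment)
    show "finite_measure M" by unfold_locales
    show "AE x in M. (\<lambda>m. indicator (?E m) x :: ennreal) \<longlonglongrightarrow> 0"
      using lim
    proof eventually_elim
      case (elim x)
      then have "eventually (\<lambda>m. \<bar>X m x\<bar> < d) sequentially"
        using d by (auto simp: tendsto_iff dist_real_def)
      then have "eventually (\<lambda>m. (indicator (?E m) x :: ennreal) = 0) sequentially"
        by eventually_elim (auto simp: indicator_def)
      then show ?case by (rule tendsto_eventually)
    qed
    show "(\<integral>\<^sup>+x. (indicator (?E m) x)\<^sup>2 \<partial>M) \<le> 1" for m
    proof -
      have "(\<integral>\<^sup>+x. (indicator (?E m) x)\<^sup>2 \<partial>M) \<le> (\<integral>\<^sup>+x. 1 \<partial>M)"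
        by (intro nn_integral_mono) (auto simp: indicator_def)
      then show ?thesis by (simp add: emeasure_space_1)
    qed
  qed auto
  then have "(\<lambda>m. ennreal (prob (?E m))) \<longlonglongrightarrow> ennreal 0"
    by (simp add: emeasure_eq_measure)
  then show ?thesis by (subst (asm) tendsto_ennreal_iff) auto
qed

section \<open>Evidence, posterior and their approximation by truncation\<close>

context white_noise_model
begin

text \<open>Extended-valued, as it may be infinite for some \<open>\<omega>\<close>. There the
  posterior is the zero measure (\<open>posterior_null\<close>), and such \<open>\<omega>\<close>
  are ruled out in the theorem by the posterior mass of \<open>A n\<close>.\<close>

definition evidence :: "real \<Rightarrow> nat \<Rightarrow> 'w \<Rightarrow> ennreal" where
  "evidence a n \<omega> = (\<integral>\<^sup>+f. ennreal (likelihood a n \<omega> f) \<partial>\<mu>)"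

definition truncation_error :: "real \<Rightarrow> nat \<Rightarrow> nat \<Rightarrow> 'w \<Rightarrow> ennreal" where
  "truncation_error a n m \<omega> = (\<integral>\<^sup>+f. ennreal \<bar>truncated_likelihood a n m \<omega> f - likelihood a n \<omega> f\<bar> \<partial>\<mu>)"

definition posterior :: "real \<Rightarrow> nat \<Rightarrow> 'w \<Rightarrow> L2 measure" where
  "posterior a n \<omega> = tempered_posterior \<mu> \<phi> a n (white_noise_obs \<phi> f0 \<epsilon> n \<omega>)"

lemma evidence_measurable [measurable]: "evidence a n \<in> borel_measurable M"
  unfolding evidence_def[abs_def] by measurable

lemma truncation_error_measurable [measurable]: "truncation_error a n m \<in> borel_measurable M"
  unfolding truncation_error_def[abs_def] by measurable

lemma evidence_pos: "0 < evidence a n \<omega>"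
proof -
  have "evidence a n \<omega> \<noteq> 0"
    unfolding evidence_def
    by (subst nn_integral_0_iff_AE) (simp_all add: not_le[THEN iffD2, OF likelihood_pos] prior.AE_False ennreal_eq_0_iff)
  then show ?thesis by (simp add: zero_less_iff_neq_zero)
qed

text \<open>The truncation error vanishes in mean, but the posterior divides by the evidence, which
  is positive without a uniform lower bound. Outside an event of probability below
  \<open>r / 2\<close> the evidence exceeds some \<open>1 / real (Suc j)\<close>, and Markov's
  inequality at level \<open>q\<close> handles the rest.\<close>

lemma truncation_error_in_prob:
  assumes na: "0 < n" "0 < a" "a \<le> 1" and d: "0 < d"
  shows "(\<lambda>m. noise.prob {\<omega>\<in>space M. ennreal d * evidence a n \<omega> \<le> truncation_error a n m \<omega>}) \<longlonglongrightarrow> 0"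
proof (rule LIMSEQ_I)
  fix r :: real assume r: "0 < r"
  define E where "E j = {\<omega>\<in>space M. evidence a n \<omega> \<le> ennreal (1 / real (Suc j))}" for j
  have [measurable]: "E j \<in> sets M" for j unfolding E_def by measurable
  have "(\<lambda>j. noise.prob (E j)) \<longlonglongrightarrow> noise.prob (\<Inter>j. E j)"
  proof (rule noise.finite_Lim_measure_decseq)
    show "decseq E"
      unfolding decseq_def E_def
    proof safe
      fix i j :: nat and \<omega> assume "i \<le> j" "evidence a n \<omega> \<le> ennreal (1 / real (Suc j))"
      then show "evidence a n \<omega> \<le> ennreal (1 / real (Suc i))"
        by (elim order_trans) (intro ennreal_leI divide_left_mono, auto)
    qed
  qed auto
  also have "(\<Inter>j. E j) = {}"
  proof (rule equals0I)
    fix \<omega> assume "\<omega> \<in> (\<Inter>j. E j)"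
    then have le: "evidence a n \<omega> \<le> ennreal (1 / real (Suc j))" for j by (auto simp: E_def)
    have "(\<lambda>j. ennreal (1 / real (Suc j))) \<longlonglongrightarrow> ennreal 0"
      by (intro tendsto_ennrealI LIMSEQ_Suc[OF lim_1_over_n])
    then have "evidence a n \<omega> \<le> ennreal 0" by (rule LIMSEQ_le_const) (use le in auto)
    then show False using evidence_pos[of a n \<omega>] by simp
  qed
  finally have "eventually (\<lambda>j. noise.prob (E j) < r / 2) sequentially"
    using r by (intro order_tendstoD(2)) auto
  then obtain j where j: "noise.prob (E j) < r / 2" by (auto simp: eventually_sequentially)
  define q where "q = d * (1 / real (Suc j))"
  have q: "q > 0" using d by (simp add: q_def)
  have "eventually (\<lambda>m. (\<integral>\<^sup>+\<omega>. truncation_error a n m \<omega> \<partial>M) < ennreal (q * (r / 2))) sequentially"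
    unfolding truncation_error_def
    using q r by (intro order_tendstoD(2)[OF truncation_error_tendsto[OF na]]) auto
  then obtain m0 where m0: "\<And>m. m \<ge> m0 \<Longrightarrow> (\<integral>\<^sup>+\<omega>. truncation_error a n m \<omega> \<partial>M) < ennreal (q * (r / 2))"
    by (auto simp: eventually_sequentially)
  have "noise.prob {\<omega>\<in>space M. ennreal d * evidence a n \<omega> \<le> truncation_error a n m \<omega>} < r" if "m \<ge> m0" for m
  proof -
    let ?F = "{\<omega>\<in>space M. ennreal q \<le> truncation_error a n m \<omega>}"
    have "{\<omega>\<in>space M. ennreal d * evidence a n \<omega> \<le> truncation_error a n m \<omega>} \<subseteq> E j \<union> ?F"
    proof safe
      fix \<omega> assume *: "\<omega> \<in> space M" "ennreal d * evidence a n \<omega> \<le> truncation_error a n m \<omega>" "\<omega> \<notin> E j"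
      then have "ennreal (1 / real (Suc j)) \<le> evidence a n \<omega>" by (auto simp: E_def)
      then have "ennreal d * ennreal (1 / real (Suc j)) \<le> ennreal d * evidence a n \<omega>" by (intro mult_left_mono) auto
      also note *(2)
      finally show "ennreal q \<le> truncation_error a n m \<omega>" using d by (simp add: q_def flip: ennreal_mult)
    qed
    then have "noise.prob {\<omega>\<in>space M. ennreal d * evidence a n \<omega> \<le> truncation_error a n m \<omega>} \<le> noise.prob (E j \<union> ?F)"
      by (intro noise.finite_measure_mono) auto
    also have "\<dots> \<le> noise.prob (E j) + noise.prob ?F"
      by (intro measure_Un_le) auto
    also have "noise.prob ?F < r / 2"
    proof -
      have "ennreal q * emeasure M ?F \<le> (\<integral>\<^sup>+\<omega>. truncation_error a n m \<omega> \<partial>M)"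
      proof -
        have "ennreal q * emeasure M ?F = (\<integral>\<^sup>+\<omega>. ennreal q * indicator ?F \<omega> \<partial>M)"
          by (simp add: nn_integral_cmult)
        also have "\<dots> \<le> (\<integral>\<^sup>+\<omega>. truncation_error a n m \<omega> \<partial>M)"
          by (intro nn_integral_mono) (auto simp: indicator_def)
        finally show ?thesis .
      qed
      also have "\<dots> < ennreal (q * (r / 2))" by (rule m0[OF that])
      finally have "ennreal (q * noise.prob ?F) < ennreal (q * (r / 2))"
        using q by (simp add: noise.emeasure_eq_measure ennreal_mult)
      then have "q * noise.prob ?F < q * (r / 2)" using q r by (simp add: ennreal_less_iff)
      then show ?thesis using q by simp
    qed
    finally show ?thesis using j by simp
  qed
  then show "\<exists>no. \<forall>m\<ge>no. norm (noise.prob {\<omega>\<in>space M. ennreal d * evidence a n \<omega> \<le> truncation_error a n m \<omega>} - 0) < r"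
    by (intro exI[of _ m0]) simp
qed

lemma sets_posterior [measurable_cong]: "sets (posterior a n \<omega>) = sets \<mu>"
  by (simp add: posterior_def tempered_posterior_def)

lemma posterior_eq_density:
  "posterior a n \<omega> = density \<mu> (\<lambda>f. ennreal (likelihood a n \<omega> f) / evidence a n \<omega>)"
  by (simp add: posterior_def tempered_posterior_def likelihood_def evidence_def)

lemma posterior_null:
  assumes "evidence a n \<omega> = \<infinity>"
  shows "measure (posterior a n \<omega>) A = 0"
proof -
  have "posterior a n \<omega> = density \<mu> (\<lambda>f. 0)"
    using assms by (simp add: posterior_eq_density)
  then have "emeasure (posterior a n \<omega>) A = 0"
    by (cases "A \<in> sets \<mu>") (simp_all add: emeasure_density emeasure_notin_sets)
  then show ?thesis by (simp add: measure_def)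
qed

lemma posterior_real_density:
  assumes fin: "evidence a n \<omega> < \<infinity>"
  shows "integrable \<mu> (likelihood a n \<omega>)"
    and "0 < (\<integral>f. likelihood a n \<omega> f \<partial>\<mu>)"
    and "evidence a n \<omega> = ennreal (\<integral>f. likelihood a n \<omega> f \<partial>\<mu>)"
    and "posterior a n \<omega> = density \<mu> (\<lambda>f. ennreal (likelihood a n \<omega> f / (\<integral>f. likelihood a n \<omega> f \<partial>\<mu>)))"
proof -
  show int: "integrable \<mu> (likelihood a n \<omega>)"
    using fin likelihood_pos[of a n \<omega>]
    by (intro integrableI_nonneg) (auto simp: evidence_def less_imp_le)
  show ev: "evidence a n \<omega> = ennreal (\<integral>f. likelihood a n \<omega> f \<partial>\<mu>)"
    unfolding evidence_def using int likelihood_pos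
    by (intro nn_integral_eq_integral) (auto simp: less_imp_le)
  then show pos: "0 < (\<integral>f. likelihood a n \<omega> f \<partial>\<mu>)"
    using evidence_pos[of a n \<omega>] by (simp add: ennreal_less_zero_iff)
  show "posterior a n \<omega> = density \<mu> (\<lambda>f. ennreal (likelihood a n \<omega> f / (\<integral>f. likelihood a n \<omega> f \<partial>\<mu>)))"
    unfolding posterior_eq_density ev
    using pos likelihood_pos by (simp add: divide_ennreal less_imp_le)
qed

lemma prob_space_posterior:
  assumes fin: "evidence a n \<omega> < \<infinity>"
  shows "prob_space (posterior a n \<omega>)"
proof (rule prob_spaceI)
  have "emeasure (posterior a n \<omega>) (space (posterior a n \<omega>)) = (\<integral>\<^sup>+f. ennreal (likelihood a n \<omega> f) / evidence a n \<omega> \<partial>\<mu>)"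
    by (simp add: posterior_eq_density emeasure_density cong: nn_integral_cong)
  also have "\<dots> = evidence a n \<omega> / evidence a n \<omega>"
    by (simp add: nn_integral_divide evidence_def)
  also have "\<dots> = 1"
    using fin evidence_pos[of a n \<omega>] by (intro ennreal_divide_self) auto
  finally show "emeasure (posterior a n \<omega>) (space (posterior a n \<omega>)) = 1" .
qed

lemma posterior_truncation:
  fixes g :: "L2 \<Rightarrow> real"
  assumes fin: "evidence a n \<omega> < \<infinity>"
    and close: "truncation_error a n m \<omega> < ennreal d * evidence a n \<omega>" and d: "0 < d"
    and int: "integrable \<mu> (truncated_likelihood a n m \<omega>)"
    and pos: "0 < (\<integral>f. truncated_likelihood a n m \<omega> f \<partial>\<mu>)"
    and g [measurable]: "g \<in> borel_measurable \<mu>" and g1: "\<And>f. \<bar>g f\<bar> \<le> 1"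
  shows "\<bar>(\<integral>f. g f \<partial>posterior a n \<omega>) -
    (\<integral>f. truncated_likelihood a n m \<omega> f * g f \<partial>\<mu>) / (\<integral>f. truncated_likelihood a n m \<omega> f \<partial>\<mu>)\<bar> \<le> 2 * d"
proof -
  let ?p = "likelihood a n \<omega>" and ?q = "truncated_likelihood a n m \<omega>"
  define D where "D = (\<integral>f. ?p f \<partial>\<mu>)"
  define D' where "D' = (\<integral>f. ?q f \<partial>\<mu>)"
  note D = posterior_real_density[OF fin, folded D_def]
  have diff_int: "integrable \<mu> (\<lambda>f. \<bar>?q f - ?p f\<bar>)" using int D(1) by simp
  define K where "K = (\<integral>f. \<bar>?q f - ?p f\<bar> \<partial>\<mu>)"
  have K0: "K \<ge> 0" by (simp add: K_def)
  have "truncation_error a n m \<omega> = ennreal K"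
    unfolding truncation_error_def K_def by (rule nn_integral_eq_integral[OF diff_int]) simp
  then have "ennreal K < ennreal (d * D)" using close d D(2) by (simp add: D(3) ennreal_mult)
  then have K: "K < d * D" using K0 by (simp add: ennreal_less_iff)
  have bounded_int: "integrable \<mu> (\<lambda>f. h f * g f)" if "integrable \<mu> h" for h
    by (rule Bochner_Integration.integrable_bound[OF that])
      (use that g1 in \<open>auto simp: abs_mult mult_left_le\<close>)
  define I where "I = (\<integral>f. ?p f * g f \<partial>\<mu>)"
  define I' where "I' = (\<integral>f. ?q f * g f \<partial>\<mu>)"
  have "(\<integral>f. g f \<partial>posterior a n \<omega>) = (\<integral>f. (?p f * g f) / D \<partial>\<mu>)"
    unfolding D(4) using D(2) likelihood_pos
    by (subst integral_density) (auto simp: less_imp_le)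
  then have post: "(\<integral>f. g f \<partial>posterior a n \<omega>) = I / D" by (simp add: I_def)
  have abs_mult_g: "\<bar>h f * g f\<bar> \<le> \<bar>h f\<bar>" for h :: "L2 \<Rightarrow> real" and f
    using g1[of f] by (simp add: abs_mult mult_left_le)
  have "\<bar>I' - I\<bar> = \<bar>\<integral>f. (?q f - ?p f) * g f \<partial>\<mu>\<bar>"
    using bounded_int[OF int] bounded_int[OF D(1)] by (simp add: I_def I'_def left_diff_distrib)
  also have "\<dots> \<le> (\<integral>f. \<bar>(?q f - ?p f) * g f\<bar> \<partial>\<mu>)" by (rule integral_abs_bound)
  also have "\<dots> \<le> K"
    unfolding K_def using bounded_int[of "\<lambda>f. ?q f - ?p f"] int D(1)
    by (intro integral_mono abs_mult_g) auto
  finally have I: "\<bar>I' - I\<bar> \<le> K" .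
  have "\<bar>D' - D\<bar> = \<bar>\<integral>f. ?q f - ?p f \<partial>\<mu>\<bar>" using int D(1) by (simp add: D_def D'_def)
  also have "\<dots> \<le> K" unfolding K_def by (rule integral_abs_bound)
  finally have DD: "\<bar>D' - D\<bar> \<le> K" .
  have "\<bar>I'\<bar> \<le> (\<integral>f. \<bar>?q f * g f\<bar> \<partial>\<mu>)" unfolding I'_def by (rule integral_abs_bound)
  also have "\<dots> \<le> (\<integral>f. \<bar>?q f\<bar> \<partial>\<mu>)"
    using bounded_int[OF int] int by (intro integral_mono abs_mult_g) auto
  also have "\<dots> = D'" using truncated_likelihood_pos[of a n m \<omega>] by (simp add: D'_def less_imp_le abs_of_pos)
  finally have I': "\<bar>I'\<bar> \<le> D'" .
  have D'0: "D' > 0" using pos by (simp add: D'_def)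
  \<comment> \<open>One error comes from the numerator and one from the normalisation, each at most
    \<open>K / D < d\<close>; hence the bound \<open>2 * d\<close>.\<close>
  have "I / D - I' / D' = (I - I') / D + (I' / D') * ((D' - D) / D)"
    using D(2) D'0 by (simp add: field_simps)
  then have "\<bar>I / D - I' / D'\<bar> \<le> \<bar>(I - I') / D\<bar> + \<bar>I' / D'\<bar> * \<bar>(D' - D) / D\<bar>"
    by (metis abs_mult abs_triangle_ineq)
  also have "\<dots> \<le> K / D + 1 * (K / D)"
  proof (intro add_mono mult_mono)
    show "\<bar>(I - I') / D\<bar> \<le> K / D" using I D(2) by (simp add: abs_minus_commute divide_right_mono)
    show "\<bar>(D' - D) / D\<bar> \<le> K / D" using DD D(2) by (simp add: divide_right_mono)
    show "\<bar>I' / D'\<bar> \<le> 1" using I' D'0 by simp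
  qed auto
  also have "\<dots> \<le> 2 * d" using K D(2) by (simp add: pos_divide_le_eq)
  finally show ?thesis by (simp add: post I'_def D'_def)
qed

end

section \<open>Bias and variance of the truncated posterior\<close>

text \<open>
  The Gaussian process \<open>f \<mapsto> \<langle>f, g\<rangle> + s X f + t U f\<close> indexed by \<open>(g, s, t)\<close>; below \<open>X\<close> and \<open>U\<close>
  represent the approximations in the RKHS of \<open>\<psi>0\<close> and \<open>f0\<close>.
\<close>

definition feature :: "(L2 \<Rightarrow> real) \<Rightarrow> (L2 \<Rightarrow> real) \<Rightarrow> L2 \<times> real \<times> real \<Rightarrow> L2 \<Rightarrow> real" where
  "feature X U v f = inner f (fst v) + fst (snd v) * X f + snd (snd v) * U f"

definition feature_cov ::
    "L2 measure \<Rightarrow> (L2 \<Rightarrow> real) \<Rightarrow> (L2 \<Rightarrow> real) \<Rightarrow> L2 \<times> real \<times> real \<Rightarrow> L2 \<times> real \<times> real \<Rightarrow> real" where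
  "feature_cov \<mu> X U v w = (\<integral>f. feature X U v f * feature X U w f \<partial>\<mu>)"

text \<open>The situation at one fixed \<open>n\<close>. \<open>h\<close> is the given approximation
  of \<open>\<psi>0\<close>, and \<open>u\<close> the near-minimiser in the concentration function
  at \<open>f0\<close>, whence the factor 2. RKHS norms appear as L2 norms of the representers
  \<open>X\<close> and \<open>U\<close>, as \<open>rkhs_norm_eq\<close> permits.\<close>

locale posterior_estimates = white_noise_model M \<epsilon> \<mu> \<phi> f0
  for M :: "'w measure" and \<epsilon> \<mu> \<phi> f0 +
  fixes N :: real and \<psi>0 h u :: L2 and X U :: "L2 \<Rightarrow> real" and \<zeta> e :: real
  assumes N: "0 < N"
    and X: "X \<in> dual_closure \<mu>" "has_pettis_integral \<mu> (\<lambda>w. X w *\<^sub>R w) h"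
    and U: "U \<in> dual_closure \<mu>" "has_pettis_integral \<mu> (\<lambda>w. U w *\<^sub>R w) u"
    and h: "norm (h - \<psi>0) \<le> \<zeta>" and X_norm: "sqrt (\<integral>w. (X w)\<^sup>2 \<partial>\<mu>) \<le> sqrt N * \<zeta>"
    and u: "norm (u - f0) \<le> e" and U_norm: "sqrt (\<integral>w. (U w)\<^sup>2 \<partial>\<mu>) \<le> 2 * sqrt N * e"
begin

lemma feature_dual_closure: "feature X U v \<in> dual_closure \<mu>"
proof -
  have "(\<lambda>f. inner f (fst v)) \<in> dual_closure \<mu>"
    by (intro prior.bounded_linear_dual_closure bounded_linear_inner_left)
  from prior.dual_closure_lincomb[OF this
      prior.dual_closure_lincomb[OF X(1) U(1), of "fst (snd v)" "snd (snd v)"], of 1 1]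
  show ?thesis by (simp add: feature_def[abs_def] add.assoc)
qed

lemma feature_add: "feature X U (v + w) f = feature X U v f + feature X U w f"
  by (simp add: feature_def inner_add_right algebra_simps)

lemma feature_scale: "feature X U (r *\<^sub>R v) f = r * feature X U v f"
  by (simp add: feature_def algebra_simps)

lemma feature_product_integrable: "integrable \<mu> (\<lambda>f. feature X U v f * feature X U w f)"
  by (intro integrable_mult_of_squares prior.dual_closure_measurable prior.dual_closure_square
      feature_dual_closure)

text \<open>Only the directions \<open>(\<phi> k, 0, 0)\<close> are observed. The directions of
  \<open>X\<close> and \<open>U\<close> carry no data and enter through their covariances with the
  observed ones.\<close>

sublocale gaussian_process "feature_cov \<mu> X U" N "\<lambda>k. (\<phi> k, 0, 0)" \<mu> "feature X U"
proof
  fix v w z :: "L2 \<times> real \<times> real" and r :: real and f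
  show "feature_cov \<mu> X U (v + w) z = feature_cov \<mu> X U v z + feature_cov \<mu> X U w z"
    using feature_product_integrable by (simp add: feature_cov_def feature_add distrib_right)
  show "feature_cov \<mu> X U (r *\<^sub>R v) w = r * feature_cov \<mu> X U v w"
    by (simp add: feature_cov_def feature_scale mult.assoc)
  show "feature_cov \<mu> X U v w = feature_cov \<mu> X U w v"
    by (simp add: feature_cov_def mult.commute)
  show "0 \<le> feature_cov \<mu> X U v v" by (simp add: feature_cov_def)
  show "0 < N" by (rule N)
  show "feature X U (v + w) f = feature X U v f + feature X U w f" by (rule feature_add)
  show "feature X U (r *\<^sub>R v) f = r * feature X U v f" by (rule feature_scale)
  show "feature X U v \<in> borel_measurable \<mu>"
    by (intro prior.dual_closure_measurable feature_dual_closure)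
  show "(\<integral>f. iexp (feature X U v f) \<partial>\<mu>) = complex_of_real (exp (- feature_cov \<mu> X U v v / 2))"
    using prior.dual_closure_char[OF feature_dual_closure, of v]
    by (simp add: feature_cov_def power2_eq_square)
qed

abbreviation vec :: "L2 \<Rightarrow> L2 \<times> real \<times> real" where "vec g \<equiv> (g, 0, 0)"
abbreviation Xv :: "L2 \<times> real \<times> real" where "Xv \<equiv> (0, 1, 0)"
abbreviation Uv :: "L2 \<times> real \<times> real" where "Uv \<equiv> (0, 0, 1)"

lemma feature_cov_vec: "feature_cov \<mu> X U (vec g) (vec g) = (\<integral>f. (inner f g)\<^sup>2 \<partial>\<mu>)"
  by (simp add: feature_cov_def feature_def power2_eq_square)

text \<open>The Pettis integral tested against the functional given by \<open>g\<close>. This is how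
  the RKHS element takes the place of the prior covariance in all later estimates.\<close>

lemma feature_cov_X: "feature_cov \<mu> X U Xv (vec g) = inner h g"
  using X(2) bounded_linear_inner_left[of g]
  by (auto simp: has_pettis_integral_def feature_cov_def feature_def)

lemma feature_cov_U: "feature_cov \<mu> X U Uv (vec g) = inner u g"
  using U(2) bounded_linear_inner_left[of g]
  by (auto simp: has_pettis_integral_def feature_cov_def feature_def)

lemma cov_X_le: "sqrt (cov m Xv Xv) \<le> sqrt N * \<zeta>"
proof -
  have "cov m Xv Xv \<le> (\<integral>w. (X w)\<^sup>2 \<partial>\<mu>)"
    using cov_le_prior[of m Xv] by (simp add: feature_cov_def feature_def power2_eq_square)
  then show ?thesis using X_norm real_sqrt_le_mono order_trans by blast
qed

lemma cov_U_le: "sqrt (cov m Uv Uv) \<le> 2 * sqrt N * e"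
proof -
  have "cov m Uv Uv \<le> (\<integral>w. (U w)\<^sup>2 \<partial>\<mu>)"
    using cov_le_prior[of m Uv] by (simp add: feature_cov_def feature_def power2_eq_square)
  then show ?thesis using U_norm real_sqrt_le_mono order_trans by blast
qed

lemma zeta_nonneg: "0 \<le> \<zeta>" using h norm_ge_zero order_trans by blast

lemma vec_proj: "vec (proj \<phi> m g) = (\<Sum>k<m. inner g (\<phi> k) *\<^sub>R vec (\<phi> k))"
proof (induction m)
  case 0
  show ?case by (simp add: proj_def zero_prod_def)
next
  case (Suc m)
  have "vec (proj \<phi> (Suc m) g) = vec (proj \<phi> m g) + inner g (\<phi> m) *\<^sub>R vec (\<phi> m)"
    by (simp add: proj_def)
  then show ?case by (simp only: Suc.IH sum.lessThan_Suc)
qed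

lemma cov_vec_proj_le: "sqrt (cov m (vec (proj \<phi> m g)) (vec (proj \<phi> m g))) \<le> norm g / sqrt N"
proof -
  have "N * cov m (vec (proj \<phi> m g)) (vec (proj \<phi> m g)) \<le> (norm (proj \<phi> m g))\<^sup>2"
    unfolding vec_proj norm_proj_sq[OF onb] by (rule cov_span_le)
  also have "\<dots> \<le> (norm g)\<^sup>2" by (intro power_mono norm_proj_le onb) simp
  finally have "cov m (vec (proj \<phi> m g)) (vec (proj \<phi> m g)) \<le> (norm g / sqrt N)\<^sup>2"
    using N by (simp add: power_divide pos_le_divide_eq mult.commute)
  then show ?thesis by (simp add: real_le_lsqrt N less_imp_le cov.nonneg)
qed

lemma cov_X_decomposition: "N * cov m (vec (proj \<phi> m h)) w = feature_cov \<mu> X U Xv w - cov m Xv w"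
  using prior_decomposition[of Xv w m, unfolded feature_cov_X]
  unfolding vec_proj cov.sum_left cov.scale_left by linarith

lemma cov_U_decomposition: "N * cov m (vec (proj \<phi> m u)) w = feature_cov \<mu> X U Uv w - cov m Uv w"
  using prior_decomposition[of Uv w m, unfolded feature_cov_U]
  unfolding vec_proj cov.sum_left cov.scale_left by linarith

text \<open>With \<open>\<psi>0 = (\<psi>0 - h) + h\<close> in one argument, the part from
  \<open>h\<close> equals \<open>inner h (proj \<phi> m \<psi>0) - cov m Xv ?P\<close>. Three errors
  of size \<open>\<zeta> * norm \<psi>0\<close> arise: from the remainder, from the covariance with
  \<open>Xv\<close>, and from replacing \<open>h\<close> by \<open>\<psi>0\<close> in the inner
  product. The last term is the projection error.\<close>

lemma variance_estimate:
  "\<bar>N * cov m (vec (proj \<phi> m \<psi>0)) (vec (proj \<phi> m \<psi>0)) - (norm \<psi>0)\<^sup>2\<bar>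
    \<le> 3 * \<zeta> * norm \<psi>0 + norm \<psi>0 * norm (\<psi>0 - proj \<phi> m \<psi>0)"
proof -
  let ?P = "vec (proj \<phi> m \<psi>0)" and ?g = "\<psi>0 - h"
  have split: "?P = vec (proj \<phi> m ?g) + vec (proj \<phi> m h)" by (simp add: proj_diff)
  have sN: "sqrt N > 0" using N by simp
  have g: "norm ?g \<le> \<zeta>" using h by (simp add: norm_minus_commute)
  have "\<bar>cov m (vec (proj \<phi> m ?g)) ?P\<bar> \<le> (\<zeta> / sqrt N) * (norm \<psi>0 / sqrt N)"
    using cov_vec_proj_le[of m ?g] cov_vec_proj_le[of m \<psi>0] divide_right_mono[OF g, of "sqrt N"] sN
    by (intro cov.abs_le') (auto intro: order_trans)
  then have 1: "\<bar>N * cov m (vec (proj \<phi> m ?g)) ?P\<bar> \<le> \<zeta> * norm \<psi>0"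
    using N by (simp add: abs_mult field_simps)
  have "\<bar>cov m Xv ?P\<bar> \<le> (sqrt N * \<zeta>) * (norm \<psi>0 / sqrt N)"
    by (intro cov.abs_le' cov_X_le cov_vec_proj_le)
  then have 2: "\<bar>cov m Xv ?P\<bar> \<le> \<zeta> * norm \<psi>0" using sN by simp
  have "\<bar>inner (h - \<psi>0) (proj \<phi> m \<psi>0)\<bar> \<le> norm (h - \<psi>0) * norm (proj \<phi> m \<psi>0)"
    by (rule Cauchy_Schwarz_ineq2)
  also have "\<dots> \<le> \<zeta> * norm \<psi>0" by (intro mult_mono h norm_proj_le onb zeta_nonneg) simp
  finally have 3: "\<bar>inner (h - \<psi>0) (proj \<phi> m \<psi>0)\<bar> \<le> \<zeta> * norm \<psi>0" .
  have 4: "\<bar>inner \<psi>0 (\<psi>0 - proj \<phi> m \<psi>0)\<bar> \<le> norm \<psi>0 * norm (\<psi>0 - proj \<phi> m \<psi>0)"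
    by (rule Cauchy_Schwarz_ineq2)
  have "N * cov m ?P ?P = N * cov m (vec (proj \<phi> m ?g)) ?P + N * cov m (vec (proj \<phi> m h)) ?P"
    using arg_cong[OF split, of "\<lambda>v. N * cov m v ?P"] by (simp only: cov.add_left distrib_left)
  also have "N * cov m (vec (proj \<phi> m h)) ?P = inner h (proj \<phi> m \<psi>0) - cov m Xv ?P"
    by (simp only: cov_X_decomposition feature_cov_X)
  finally have "N * cov m ?P ?P - (norm \<psi>0)\<^sup>2 = N * cov m (vec (proj \<phi> m ?g)) ?P
      + inner (h - \<psi>0) (proj \<phi> m \<psi>0) - inner \<psi>0 (\<psi>0 - proj \<phi> m \<psi>0) - cov m Xv ?P"
    by (simp add: inner_diff_left inner_diff_right power2_norm_eq_inner)
  then show ?thesis using 1 2 3 4 by linarith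
qed

lemma residual_sd_le: "sqrt (cov m (vec g) (vec g)) \<le> sqrt (\<integral>f. (inner f g)\<^sup>2 \<partial>\<mu>)"
  using cov_le_prior[of m "vec g"] by (simp add: feature_cov_vec)

text \<open>Standard deviations are compared by
  \<open>\<bar>sqrt x - sqrt y\<bar> \<le> sqrt \<bar>x - y\<bar>\<close>, which involves no
  division by \<open>norm \<psi>0\<close> and so covers \<open>\<psi>0 = 0\<close>. Passing from the
  projection of \<open>\<psi>0\<close> to \<open>\<psi>0\<close> costs the posterior seminorm of the
  residual, bounded by its prior value.\<close>

lemma sd_estimate:
  assumes \<tau>: "sqrt N * sqrt (\<integral>f. (inner f (\<psi>0 - proj \<phi> m \<psi>0))\<^sup>2 \<partial>\<mu>) \<le> \<tau>"
    and d: "norm (\<psi>0 - proj \<phi> m \<psi>0) \<le> d"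
  shows "\<bar>sqrt (N * cov m (vec \<psi>0) (vec \<psi>0)) - norm \<psi>0\<bar> \<le> \<tau> + sqrt ((3 * \<zeta> + d) * norm \<psi>0)"
proof -
  let ?P = "vec (proj \<phi> m \<psi>0)" and ?R = "vec (\<psi>0 - proj \<phi> m \<psi>0)"
  have sN: "sqrt N \<ge> 0" using N by simp
  have R: "sqrt N * sqrt (cov m ?R ?R) \<le> \<tau>"
    using mult_left_mono[OF residual_sd_le sN] \<tau> order_trans by blast
  have "sqrt (cov m (vec \<psi>0) (vec \<psi>0)) \<le> sqrt (cov m ?P ?P) + sqrt (cov m ?R ?R)"
    using cov.seminorm_triangle[of m ?P ?R] by simp
  from mult_left_mono[OF this sN]
  have 1: "sqrt (N * cov m (vec \<psi>0) (vec \<psi>0)) \<le> sqrt (N * cov m ?P ?P) + \<tau>"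
    using R by (simp add: real_sqrt_mult distrib_left)
  have neg: "cov m (- ?R) (- ?R) = cov m ?R ?R"
    using cov.scale_left[of m "-1" ?R "- ?R"] cov.scale_right[of m ?R "-1" ?R] by simp
  have "sqrt (cov m ?P ?P) \<le> sqrt (cov m (vec \<psi>0) (vec \<psi>0)) + sqrt (cov m ?R ?R)"
    using cov.seminorm_triangle[of m "vec \<psi>0" "- ?R"] neg by simp
  from mult_left_mono[OF this sN]
  have 2: "sqrt (N * cov m ?P ?P) \<le> sqrt (N * cov m (vec \<psi>0) (vec \<psi>0)) + \<tau>"
    using R by (simp add: real_sqrt_mult distrib_left)
  have sqrt_diff: "\<bar>sqrt x - sqrt y\<bar> \<le> sqrt \<bar>x - y\<bar>" if "x \<ge> 0" "y \<ge> 0" for x y :: real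
  proof -
    have *: "sqrt x \<le> sqrt y + sqrt \<bar>x - y\<bar>" if "x \<ge> 0" "y \<ge> 0" for x y :: real
    proof -
      have "sqrt x \<le> sqrt (y + \<bar>x - y\<bar>)" by simp
      also have "\<dots> \<le> sqrt y + sqrt \<bar>x - y\<bar>" using that by (intro sqrt_add_le_add_sqrt) auto
      finally show ?thesis .
    qed
    show ?thesis using *[of x y] *[of y x] that by (simp add: abs_minus_commute abs_le_iff)
  qed
  have "\<bar>sqrt (N * cov m ?P ?P) - sqrt ((norm \<psi>0)\<^sup>2)\<bar> \<le> sqrt \<bar>N * cov m ?P ?P - (norm \<psi>0)\<^sup>2\<bar>"
    using N cov.nonneg[of m ?P] by (intro sqrt_diff) auto
  also have "\<dots> \<le> sqrt ((3 * \<zeta> + d) * norm \<psi>0)"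
  proof (rule real_sqrt_le_mono)
    have "norm \<psi>0 * norm (\<psi>0 - proj \<phi> m \<psi>0) \<le> norm \<psi>0 * d" using d by (intro mult_left_mono) auto
    then show "\<bar>N * cov m ?P ?P - (norm \<psi>0)\<^sup>2\<bar> \<le> (3 * \<zeta> + d) * norm \<psi>0"
      using variance_estimate[of m] by (simp add: algebra_simps)
  qed
  finally show ?thesis using 1 2 by simp
qed

text \<open>Without noise the posterior mean of the functional is
  \<open>N * cov m (vec \<psi>0) (vec (proj \<phi> m f0))\<close>, so the left side is its bias.
  \<open>F\<close> is the bilinear form measuring how far N times the covariance is from the
  identity on projected vectors; an RKHS element in either argument turns it into a single
  covariance with a representer. The residual of \<open>\<psi>0\<close> and the tail of
  \<open>f0\<close> give the other two terms.\<close>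

lemma bias_estimate:
  assumes \<tau>: "sqrt (\<integral>f. (inner f (\<psi>0 - proj \<phi> m \<psi>0))\<^sup>2 \<partial>\<mu>) \<le> \<tau>"
  shows "\<bar>N * cov m (vec \<psi>0) (vec (proj \<phi> m f0)) - inner \<psi>0 f0\<bar>
    \<le> sqrt N * \<tau> * norm f0 + 9 * e * \<zeta> + norm \<psi>0 * norm (f0 - proj \<phi> m f0)"
proof -
  define V where "V g = vec (proj \<phi> m g)" for g
  define F where "F g d = N * cov m (V g) (V d) - inner (proj \<phi> m g) d" for g d
  have sN: "sqrt N > 0" using N by simp
  have sN2: "N = sqrt N * sqrt N" using N by simp
  have V_le: "sqrt (cov m (V g) (V g)) \<le> s / sqrt N" if "norm g \<le> s" for g s
    using cov_vec_proj_le[of m g] divide_right_mono[OF that, of "sqrt N"] sN unfolding V_def by simp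
  let ?g = "\<psi>0 - h" and ?d = "f0 - u"
  have g: "norm ?g \<le> \<zeta>" and d: "norm ?d \<le> e" using h u by (simp_all add: norm_minus_commute)
  have V_add: "V (g + g') = V g + V g'" for g g' by (simp add: V_def proj_add)
  have F_add: "F (g + g') d = F g d + F g' d" "F g (d + d') = F g d + F g d'" for g g' d d'
    unfolding F_def V_add cov.add_left cov.add_right
    by (simp_all add: proj_add inner_add_left inner_add_right algebra_simps)
  have Fh: "F h b = - cov m Xv (V b)" for b
  proof -
    have "N * cov m (V h) (V b) = inner h (proj \<phi> m b) - cov m Xv (V b)"
      unfolding V_def by (simp only: cov_X_decomposition feature_cov_X)
    then show ?thesis by (simp add: F_def inner_proj_right)
  qed
  have Fu: "F b u = - cov m Uv (V b)" for b
  proof -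
    have "N * cov m (V b) (V u) = inner u (proj \<phi> m b) - cov m Uv (V b)"
      unfolding V_def cov.sym[of m "vec (proj \<phi> m b)"] by (simp only: cov_U_decomposition feature_cov_U)
    then show ?thesis by (simp add: F_def inner_commute)
  qed
  have 1: "\<bar>F ?g ?d\<bar> \<le> 2 * (e * \<zeta>)"
  proof -
    have "\<bar>cov m (V ?g) (V ?d)\<bar> \<le> (\<zeta> / sqrt N) * (e / sqrt N)"
      by (intro cov.abs_le' V_le g d)
    then have "\<bar>N * cov m (V ?g) (V ?d)\<bar> \<le> e * \<zeta>"
      using N by (simp add: abs_mult field_simps)
    moreover have "\<bar>inner (proj \<phi> m ?g) ?d\<bar> \<le> norm (proj \<phi> m ?g) * norm ?d" by (rule Cauchy_Schwarz_ineq2)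
    moreover have "norm (proj \<phi> m ?g) * norm ?d \<le> \<zeta> * e"
      using g d zeta_nonneg by (intro mult_mono) (auto intro: order_trans[OF norm_proj_le[OF onb]])
    ultimately show ?thesis unfolding F_def by (simp add: mult.commute)
  qed
  have 2: "\<bar>F h ?d\<bar> \<le> e * \<zeta>"
  proof -
    have "\<bar>cov m Xv (V ?d)\<bar> \<le> (sqrt N * \<zeta>) * (e / sqrt N)"
      by (intro cov.abs_le' V_le d cov_X_le)
    then show ?thesis using sN by (simp add: Fh mult.commute)
  qed
  have 3: "\<bar>F ?g u\<bar> \<le> 2 * (e * \<zeta>)"
  proof -
    have "\<bar>cov m Uv (V ?g)\<bar> \<le> (2 * sqrt N * e) * (\<zeta> / sqrt N)"
      by (intro cov.abs_le' V_le g cov_U_le)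
    then show ?thesis using sN by (simp add: Fu)
  qed
  \<comment> \<open>Both arguments are in the RKHS, so both decompositions apply:
    \<open>F h u\<close> is minus the covariance of \<open>Xv\<close> with \<open>V u\<close>, and N
    times that covariance is the prior minus the posterior covariance of \<open>Uv\<close> and
    \<open>Xv\<close>, each at most \<open>2 * N * e * \<zeta>\<close> in absolute value.\<close>
  have 4: "\<bar>F h u\<bar> \<le> 4 * (e * \<zeta>)"
  proof -
    have "N * cov m (V u) Xv = feature_cov \<mu> X U Uv Xv - cov m Uv Xv"
      unfolding V_def by (rule cov_U_decomposition)
    moreover have "\<bar>cov m Uv Xv\<bar> \<le> (2 * sqrt N * e) * (sqrt N * \<zeta>)"
      by (intro cov.abs_le' cov_X_le cov_U_le)
    \<comment> \<open>At \<open>m = 0\<close> the updated covariance is the prior one, so the same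
      two seminorm bounds apply.\<close>
    moreover have "\<bar>feature_cov \<mu> X U Uv Xv\<bar> \<le> (2 * sqrt N * e) * (sqrt N * \<zeta>)"
      using cov.abs_le'[of 0, OF cov_U_le cov_X_le] by simp
    moreover have "(2 * sqrt N * e) * (sqrt N * \<zeta>) = N * (2 * (e * \<zeta>))"
      by (subst (3) sN2) (simp add: mult_ac del: real_sqrt_mult_self)
    moreover have "N * (2 * (e * \<zeta>)) + N * (2 * (e * \<zeta>)) = N * (4 * (e * \<zeta>))" by simp
    ultimately have "\<bar>N * cov m (V u) Xv\<bar> \<le> N * (4 * (e * \<zeta>))" by linarith
    then have "\<bar>cov m (V u) Xv\<bar> \<le> 4 * (e * \<zeta>)" using N by (simp add: abs_mult)
    then show ?thesis by (simp add: Fh cov.sym[of m Xv])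
  qed
  have "F \<psi>0 f0 = F ?g ?d + F h ?d + F ?g u + F h u"
    using F_add(1)[of ?g h f0] F_add(2)[of ?g ?d u] F_add(2)[of h ?d u] by simp
  then have A: "\<bar>F \<psi>0 f0\<bar> \<le> 9 * e * \<zeta>" using 1 2 3 4 by simp
  let ?R = "vec (\<psi>0 - proj \<phi> m \<psi>0)"
  have "\<bar>cov m ?R (V f0)\<bar> \<le> \<tau> * (norm f0 / sqrt N)"
    using order_trans[OF residual_sd_le \<tau>] by (intro cov.abs_le' V_le) auto
  then have "N * \<bar>cov m ?R (V f0)\<bar> \<le> N * (\<tau> * (norm f0 / sqrt N))" using N by (intro mult_left_mono) auto
  also have "\<dots> = sqrt N * \<tau> * norm f0"
    using sN by (subst sN2) (simp add: mult_ac del: real_sqrt_mult_self)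
  finally have B: "\<bar>N * cov m ?R (V f0)\<bar> \<le> sqrt N * \<tau> * norm f0" using N by (simp add: abs_mult)
  have C: "\<bar>inner \<psi>0 (f0 - proj \<phi> m f0)\<bar> \<le> norm \<psi>0 * norm (f0 - proj \<phi> m f0)"
    by (rule Cauchy_Schwarz_ineq2)
  have "vec \<psi>0 = ?R + V \<psi>0" by (simp add: V_def)
  then have "N * cov m (vec \<psi>0) (V f0) = N * cov m ?R (V f0) + N * cov m (V \<psi>0) (V f0)"
    by (simp only: cov.add_left distrib_left)
  then have "N * cov m (vec \<psi>0) (V f0) - inner \<psi>0 f0
      = N * cov m ?R (V f0) + F \<psi>0 f0 - inner \<psi>0 (f0 - proj \<phi> m f0)"
    by (simp add: F_def inner_diff_right inner_proj_right)
  then show ?thesis using A B C unfolding V_def by linarith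
qed

lemma L2_set_cov_le: "L2_set (\<lambda>k. N * cov m v (vec (\<phi> k))) {..<m} \<le> sqrt (N * cov m v v)"
proof -
  have "N * (N * (\<Sum>k<m. (cov m v (vec (\<phi> k)))\<^sup>2)) \<le> N * cov m v v"
    using sum_cov_square_le[of m v] N by (intro mult_left_mono) auto
  then have "(\<Sum>k<m. (N * cov m v (vec (\<phi> k)))\<^sup>2) \<le> N * cov m v v"
    by (simp add: power_mult_distrib sum_distrib_left[symmetric] power2_eq_square[of N] mult.assoc)
  then show ?thesis unfolding L2_set_def by (rule real_sqrt_le_mono)
qed

text \<open>The summands are squares of the differences between the weights of the noise variables
  in the posterior mean and in the efficient centring. Minkowski over the four pieces: the residual
  of \<open>\<psi>0\<close> contributes \<open>\<tau>\<close>, while the remainder \<open>?g\<close>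
  in the covariance, the coefficients of \<open>?g\<close>, and the covariance with
  \<open>Xv\<close> contribute \<open>\<zeta>\<close> each.\<close>

lemma noise_estimate:
  assumes \<tau>: "sqrt N * sqrt (\<integral>f. (inner f (\<psi>0 - proj \<phi> m \<psi>0))\<^sup>2 \<partial>\<mu>) \<le> \<tau>"
  shows "(\<Sum>k<m. (N * cov m (vec \<psi>0) (vec (\<phi> k)) - inner \<psi>0 (\<phi> k))\<^sup>2) \<le> (3 * \<zeta> + \<tau>)\<^sup>2"
proof -
  let ?R = "vec (\<psi>0 - proj \<phi> m \<psi>0)" and ?g = "\<psi>0 - h"
  have sN: "sqrt N > 0" using N by simp
  have g: "norm ?g \<le> \<zeta>" using h by (simp add: norm_minus_commute)
  define A where "A k = N * cov m ?R (vec (\<phi> k))" for k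
  define B where "B k = N * cov m (vec (proj \<phi> m ?g)) (vec (\<phi> k))" for k
  define G where "G k = - inner ?g (\<phi> k)" for k
  define C where "C k = - cov m Xv (vec (\<phi> k))" for k
  have split: "N * cov m (vec \<psi>0) (vec (\<phi> k)) - inner \<psi>0 (\<phi> k) = A k + (B k + (G k + C k))" for k
  proof -
    have "vec \<psi>0 = ?R + (vec (proj \<phi> m ?g) + vec (proj \<phi> m h))" by (simp add: proj_diff)
    then have "N * cov m (vec \<psi>0) (vec (\<phi> k)) = A k + (B k + N * cov m (vec (proj \<phi> m h)) (vec (\<phi> k)))"
      by (simp only: cov.add_left distrib_left A_def B_def)
    also have "N * cov m (vec (proj \<phi> m h)) (vec (\<phi> k)) = inner h (\<phi> k) + C k"
      by (simp only: cov_X_decomposition feature_cov_X C_def)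
    finally show ?thesis by (simp add: G_def inner_diff_left)
  qed
  have A: "L2_set A {..<m} \<le> \<tau>"
  proof -
    have "L2_set A {..<m} \<le> sqrt (N * cov m ?R ?R)" unfolding A_def by (rule L2_set_cov_le)
    also have "\<dots> \<le> sqrt N * sqrt (\<integral>f. (inner f (\<psi>0 - proj \<phi> m \<psi>0))\<^sup>2 \<partial>\<mu>)"
      unfolding real_sqrt_mult using sN by (intro mult_left_mono residual_sd_le) auto
    finally show ?thesis using \<tau> by simp
  qed
  have B: "L2_set B {..<m} \<le> \<zeta>"
  proof -
    have "L2_set B {..<m} \<le> sqrt N * sqrt (cov m (vec (proj \<phi> m ?g)) (vec (proj \<phi> m ?g)))"
      unfolding B_def real_sqrt_mult[symmetric] by (rule L2_set_cov_le)
    also have "\<dots> \<le> sqrt N * (norm ?g / sqrt N)"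
      using sN by (intro mult_left_mono cov_vec_proj_le) auto
    also have "\<dots> \<le> \<zeta>" using sN g by simp
    finally show ?thesis .
  qed
  have G: "L2_set G {..<m} \<le> \<zeta>"
  proof -
    have "L2_set G {..<m} = norm (proj \<phi> m ?g)"
      unfolding L2_set_def G_def by (simp add: norm_proj_sq[OF onb, symmetric])
    then show ?thesis using norm_proj_le[OF onb, of m ?g] g by simp
  qed
  have C: "L2_set C {..<m} \<le> \<zeta>"
  proof -
    have "N * L2_set C {..<m} = L2_set (\<lambda>k. N * cov m Xv (vec (\<phi> k))) {..<m}"
      using N by (simp add: L2_set_right_distrib) (simp add: L2_set_def C_def power_mult_distrib)
    also have "\<dots> \<le> sqrt N * sqrt (cov m Xv Xv)"
      unfolding real_sqrt_mult[symmetric] by (rule L2_set_cov_le)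
    also have "\<dots> \<le> sqrt N * (sqrt N * \<zeta>)" using sN by (intro mult_left_mono cov_X_le) auto
    also have "\<dots> = N * \<zeta>" using N by (simp flip: mult.assoc)
    finally show ?thesis using N by simp
  qed
  have "L2_set (\<lambda>k. A k + (B k + (G k + C k))) {..<m} \<le> 3 * \<zeta> + \<tau>"
    using L2_set_triangle_ineq[of A "\<lambda>k. B k + (G k + C k)" "{..<m}"]
      L2_set_triangle_ineq[of B "\<lambda>k. G k + C k" "{..<m}"] L2_set_triangle_ineq[of G C "{..<m}"] A B G C
    by linarith
  then have "(L2_set (\<lambda>k. A k + (B k + (G k + C k))) {..<m})\<^sup>2 \<le> (3 * \<zeta> + \<tau>)\<^sup>2"
    by (intro power_mono) auto
  then show ?thesis unfolding split by (simp add: L2_set_def sum_nonneg)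
qed

end

section \<open>Weak convergence of the posterior\<close>

definition bounded_lipschitz :: "(real \<Rightarrow> real) \<Rightarrow> bool" where
  "bounded_lipschitz g \<longleftrightarrow> (\<forall>x. \<bar>g x\<bar> \<le> 1) \<and> (\<forall>x y. \<bar>g x - g y\<bar> \<le> \<bar>x - y\<bar>)"

lemma bounded_lipschitz_measurable:
  assumes "bounded_lipschitz g" shows "g \<in> borel_measurable borel"
proof (intro borel_measurable_continuous_onI, unfold continuous_on_iff, intro ballI allI impI)
  fix x d :: real assume "0 < d"
  then show "\<exists>b>0. \<forall>x'\<in>UNIV. dist x' x < b \<longrightarrow> dist (g x') (g x) < d"
    using assms by (intro exI[of _ d]) (auto simp: bounded_lipschitz_def dist_real_def intro: le_less_trans)
qed

text \<open>The supremum is taken in the reals, so nonemptiness and boundedness matter: the zero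
  function supplies the former and shows that \<open>d_BL\<close> is nonnegative, and
  \<open>B\<close> supplies the latter.\<close>

lemma abs_d_BL_le:
  assumes "\<And>g. bounded_lipschitz g \<Longrightarrow> \<bar>(\<integral>x. g x \<partial>P) - (\<integral>x. g x \<partial>Q)\<bar> \<le> B"
  shows "\<bar>d_BL P Q\<bar> \<le> B"
proof -
  let ?S = "{g :: real \<Rightarrow> real. (\<forall>x. \<bar>g x\<bar> \<le> 1) \<and> (\<forall>x y. \<bar>g x - g y\<bar> \<le> \<bar>x - y\<bar>)}"
  let ?f = "\<lambda>g. \<bar>(\<integral>x. g x \<partial>P) - (\<integral>x. g x \<partial>Q)\<bar>"
  have zero: "(\<lambda>x. 0) \<in> ?S" by simp
  have le: "?f g \<le> B" if "g \<in> ?S" for g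
    using assms that by (simp add: bounded_lipschitz_def)
  have "?S \<noteq> {}" using zero by (metis empty_iff)
  then have "d_BL P Q \<le> B" unfolding d_BL_def by (rule cSUP_least) (rule le)
  moreover have "?f (\<lambda>x. 0) \<le> d_BL P Q"
    unfolding d_BL_def using le by (intro cSUP_upper[OF zero] bdd_aboveI2[where M=B]) auto
  ultimately show ?thesis by simp
qed

text \<open>Both laws are affine images of one standard normal \<open>z\<close>; under this coupling
  the arguments of \<open>g\<close> differ by \<open>b + q * z\<close>. The coefficient of
  \<open>\<bar>q\<bar>\<close> is 1, because
  \<open>\<bar>z\<bar> \<le> 1 / 2 + z\<^sup>2 / 2\<close> has right-hand mean 1.\<close>

lemma normal_law_bounded_lipschitz:
  assumes g: "bounded_lipschitz g" and V: "0 \<le> V" and c: "0 \<le> c"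
  shows "\<bar>(\<integral>t. g (r * t - k) \<partial>normal_law p c) - (\<integral>t. g t \<partial>normal_law 0 V)\<bar>
    \<le> \<bar>r * p - k\<bar> + \<bar>r * sqrt c - sqrt V\<bar>"
proof -
  note [measurable] = bounded_lipschitz_measurable[OF g]
  interpret real_distribution std_normal_distribution by (rule real_dist_normal_dist)
  define b where "b = r * p - k"
  define q where "q = r * sqrt c - sqrt V"
  have int: "integrable std_normal_distribution (\<lambda>z. g (x + y * z))" for x y
    by (rule integrable_const_bound[where B=1]) (use g in \<open>auto simp: bounded_lipschitz_def\<close>)
  have sq: "integrable std_normal_distribution (\<lambda>z. z\<^sup>2)" "(\<integral>z. z\<^sup>2 \<partial>std_normal_distribution) = 1"
    using std_normal_distribution_even_moments[of 1] by simp_all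
  have "(\<integral>t. g (r * t - k) \<partial>normal_law p c) = (\<integral>z. g (b + (r * sqrt c) * z) \<partial>std_normal_distribution)"
    unfolding normal_law_eq_distr[OF c] by (simp add: integral_distr b_def algebra_simps)
  moreover have "(\<integral>t. g t \<partial>normal_law 0 V) = (\<integral>z. g (0 + sqrt V * z) \<partial>std_normal_distribution)"
    unfolding normal_law_eq_distr[OF V] by (simp add: integral_distr)
  ultimately have "\<bar>(\<integral>t. g (r * t - k) \<partial>normal_law p c) - (\<integral>t. g t \<partial>normal_law 0 V)\<bar>
      = \<bar>\<integral>z. g (b + (r * sqrt c) * z) - g (0 + sqrt V * z) \<partial>std_normal_distribution\<bar>"
    by (simp only: Bochner_Integration.integral_diff[OF int int])
  also have "\<dots> \<le> (\<integral>z. \<bar>g (b + (r * sqrt c) * z) - g (0 + sqrt V * z)\<bar> \<partial>std_normal_distribution)"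
    by (rule integral_abs_bound)
  also have "\<dots> \<le> (\<integral>z. \<bar>b\<bar> + \<bar>q\<bar> * (1 / 2 + z\<^sup>2 / 2) \<partial>std_normal_distribution)"
  proof (rule integral_mono)
    show "integrable std_normal_distribution (\<lambda>z. \<bar>g (b + (r * sqrt c) * z) - g (0 + sqrt V * z)\<bar>)"
      by (intro Bochner_Integration.integrable_abs Bochner_Integration.integrable_diff int)
    show "integrable std_normal_distribution (\<lambda>z. \<bar>b\<bar> + \<bar>q\<bar> * (1 / 2 + z\<^sup>2 / 2))"
      using sq(1) by simp
    fix z
    have "\<bar>g (b + (r * sqrt c) * z) - g (0 + sqrt V * z)\<bar> \<le> \<bar>(b + (r * sqrt c) * z) - (0 + sqrt V * z)\<bar>"
      using g by (simp only: bounded_lipschitz_def)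
    also have "\<dots> = \<bar>b + q * z\<bar>" by (simp add: q_def algebra_simps)
    also have "\<dots> \<le> \<bar>b\<bar> + \<bar>q\<bar> * \<bar>z\<bar>" using abs_triangle_ineq[of b "q * z"] by (simp add: abs_mult)
    also have "\<dots> \<le> \<bar>b\<bar> + \<bar>q\<bar> * (1 / 2 + z\<^sup>2 / 2)"
    proof -
      have "\<bar>z\<bar> \<le> 1 / 2 + z\<^sup>2 / 2"
        using zero_le_power2[of "\<bar>z\<bar> - 1"] by (simp add: power2_diff)
      then show ?thesis by (intro add_left_mono mult_left_mono) auto
    qed
    finally show "\<bar>g (b + (r * sqrt c) * z) - g (0 + sqrt V * z)\<bar> \<le> \<bar>b\<bar> + \<bar>q\<bar> * (1 / 2 + z\<^sup>2 / 2)" .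
  qed
  also have "\<dots> = \<bar>b\<bar> + \<bar>q\<bar>"
    using sq prob_space by simp
  finally show ?thesis by (simp add: b_def q_def)
qed

text \<open>The small-ball term is nonnegative, so the infimum of the squared norms is at most
  \<open>2 * N * e\<^sup>2\<close>. It need not be attained, hence the comparison with the strictly
  larger \<open>4 * N * e\<^sup>2\<close>.\<close>

lemma concentration_function_approximation:
  fixes \<mu> :: "'b::real_normed_vector measure"
  assumes "prob_space \<mu>" and N: "0 < N"
    and conc: "concentration_function \<mu> f0 e \<le> ereal (N * e\<^sup>2)"
  obtains u where "u \<in> rkhs \<mu>" "norm (u - f0) < e" "rkhs_norm \<mu> u \<le> 2 * sqrt N * e"
proof -
  interpret prob_space \<mu> by fact
  let ?S = "{h \<in> rkhs \<mu>. norm (h - f0) < e}"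
  define p where "p = measure \<mu> {w. norm w \<le> e}"
  have "0 \<le> - ln p" if "p \<noteq> 0"
  proof -
    have "0 < p" "p \<le> 1" using that by (simp_all add: p_def less_le)
    then show ?thesis by simp
  qed
  then have "0 \<le> (if p = 0 then \<infinity> else ereal (- ln p))" by simp
  then have "ereal (1 / 2) * (INF h\<in>?S. ereal ((rkhs_norm \<mu> h)\<^sup>2)) \<le> concentration_function \<mu> f0 e"
    unfolding concentration_function_def p_def[symmetric] Let_def by (rule add_increasing) simp
  also note conc
  finally have le: "ereal (1 / 2) * (INF h\<in>?S. ereal ((rkhs_norm \<mu> h)\<^sup>2)) \<le> ereal (N * e\<^sup>2)" .
  \<comment> \<open>Otherwise no element competes in the infimum, which would then be
    infinite.\<close>
  have e: "0 < e"
  proof (rule ccontr)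
    assume "\<not> 0 < e"
    then have "?S = {}" by (auto dest: le_less_trans[OF norm_ge_zero])
    then show False using le by (simp only: image_empty Inf_empty top_ereal_def) simp
  qed
  have "\<exists>u\<in>?S. (rkhs_norm \<mu> u)\<^sup>2 < 4 * N * e\<^sup>2"
  proof (rule ccontr)
    assume "\<not> ?thesis"
    then have "ereal (4 * N * e\<^sup>2) \<le> (INF h\<in>?S. ereal ((rkhs_norm \<mu> h)\<^sup>2))"
      by (intro INF_greatest) (auto simp: not_less)
    then have "ereal (1 / 2) * ereal (4 * N * e\<^sup>2) \<le> ereal (1 / 2) * (INF h\<in>?S. ereal ((rkhs_norm \<mu> h)\<^sup>2))"
      by (intro ereal_mult_left_mono) auto
    also note le
    finally have "2 * (N * e\<^sup>2) \<le> N * e\<^sup>2" by simp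
    moreover have "0 < N * e\<^sup>2" using N e by simp
    ultimately show False by simp
  qed
  then obtain u where u: "u \<in> rkhs \<mu>" "norm (u - f0) < e" "(rkhs_norm \<mu> u)\<^sup>2 < 4 * N * e\<^sup>2" by auto
  have "(rkhs_norm \<mu> u)\<^sup>2 \<le> (2 * sqrt N * e)\<^sup>2"
    using u(3) N by (simp add: power_mult_distrib)
  then have "rkhs_norm \<mu> u \<le> 2 * sqrt N * e"
    by (rule power2_le_imp_le) (use N e in simp)
  then show thesis using that u by blast
qed

context posterior_estimates
begin

text \<open>\<open>m\<close> does not occur in the conclusion: at fixed \<open>n\<close> it is
  chosen so that all truncation effects are below \<open>\<eta>\<close>. The
  \<open>6 * \<eta>\<close> collects 2 from the total variation error, 1 from the standard
  deviation, 2 from the bias and 1 from the tail of the centring series. The threshold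
  \<open>s\<close> for the remaining noise is kept separate, since Chebyshev puts
  \<open>s\<^sup>2\<close> in a denominator.\<close>

lemma posterior_close_to_normal:
  fixes n :: nat and a \<eta> s :: real
  assumes na: "0 < n" "0 < a" "a \<le> 1" and N_eq: "N = real n * a" and \<eta>: "0 < \<eta>" and s: "0 < s"
  shows "\<exists>G\<in>sets M. measure M (space M - G) \<le> 2 * \<eta> + (3 * \<zeta> + \<eta>)\<^sup>2 / s\<^sup>2 \<and>
    (\<forall>\<omega>\<in>G. evidence a n \<omega> < \<infinity> \<longrightarrow> (\<forall>g. bounded_lipschitz g \<longrightarrow>
      \<bar>(\<integral>f. g (sqrt N * inner \<psi>0 (f - f0) - sqrt a * (\<Sum>k. inner \<psi>0 (\<phi> k) * \<epsilon> k \<omega>)) \<partial>posterior a n \<omega>)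
        - (\<integral>t. g t \<partial>normal_law 0 ((norm \<psi>0)\<^sup>2))\<bar>
      \<le> 6 * \<eta> + s + 9 * (sqrt N * e * \<zeta>) + sqrt ((3 * \<zeta> + \<eta>) * norm \<psi>0)))"
proof -
  define W where "W \<omega> = (\<Sum>k. inner \<psi>0 (\<phi> k) * \<epsilon> k \<omega>)" for \<omega>
  have [measurable]: "W \<in> borel_measurable M" unfolding W_def[abs_def] by measurable
  define \<tau> where "\<tau> m = sqrt (\<integral>f. (inner f (\<psi>0 - proj \<phi> m \<psi>0))\<^sup>2 \<partial>\<mu>)" for m
  have \<tau>: "\<tau> \<longlonglongrightarrow> 0"
    using tendsto_real_sqrt[OF residual_variance_tendsto[of \<psi>0]] by (simp add: \<tau>_def[abs_def])
  have res: "(\<lambda>m. norm (g - proj \<phi> m g)) \<longlonglongrightarrow> 0" for g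
    using tendsto_norm[OF tendsto_diff[OF tendsto_const[of g] proj_tendsto[OF onb, of g]]] by simp
  have tail: "(\<lambda>m. noise.prob {\<omega>\<in>space M. \<eta> \<le> \<bar>W \<omega> - (\<Sum>k<m. inner \<psi>0 (\<phi> k) * \<epsilon> k \<omega>)\<bar>}) \<longlonglongrightarrow> 0"
  proof (rule noise.AE_tendsto_0_imp_prob[OF _ _ \<eta>])
    show "AE \<omega> in M. (\<lambda>m. W \<omega> - (\<Sum>k<m. inner \<psi>0 (\<phi> k) * \<epsilon> k \<omega>)) \<longlonglongrightarrow> 0"
      using noise.AE_summable_noise[OF basis_coefficients_summable[of \<psi>0]]
    proof eventually_elim
      case (elim \<omega>)
      from tendsto_diff[OF tendsto_const[of "W \<omega>"] summable_LIMSEQ[OF elim]]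
      show ?case by (simp add: W_def)
    qed
  qed measurable
  have small: "eventually (\<lambda>m. K * x m < \<eta>) sequentially" if "x \<longlonglongrightarrow> 0" for x :: "nat \<Rightarrow> real" and K
    using tendsto_mult_right_zero[OF that, of K] \<eta> by (intro order_tendstoD(2)) auto
  \<comment> \<open>The factors 1 give every conjunct the form \<open>K * x m < \<eta>\<close> of
    \<open>small\<close>.\<close>
  have "eventually (\<lambda>m. sqrt N * \<tau> m < \<eta> \<and> N * norm f0 * \<tau> m < \<eta> \<and>
      sqrt N * norm \<psi>0 * norm (f0 - proj \<phi> m f0) < \<eta> \<and> 1 * norm (\<psi>0 - proj \<phi> m \<psi>0) < \<eta> \<and>
      1 * noise.prob {\<omega>\<in>space M. \<eta> \<le> \<bar>W \<omega> - (\<Sum>k<m. inner \<psi>0 (\<phi> k) * \<epsilon> k \<omega>)\<bar>} < \<eta> \<and>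
      1 * noise.prob {\<omega>\<in>space M. ennreal \<eta> * evidence a n \<omega> \<le> truncation_error a n m \<omega>} < \<eta>) sequentially"
    by (intro eventually_conj small \<tau> res tail truncation_error_in_prob na \<eta>)
  then obtain m where m: "sqrt N * \<tau> m < \<eta>" "N * norm f0 * \<tau> m < \<eta>"
      "sqrt N * norm \<psi>0 * norm (f0 - proj \<phi> m f0) < \<eta>" "norm (\<psi>0 - proj \<phi> m \<psi>0) < \<eta>"
      "noise.prob {\<omega>\<in>space M. \<eta> \<le> \<bar>W \<omega> - (\<Sum>k<m. inner \<psi>0 (\<phi> k) * \<epsilon> k \<omega>)\<bar>} < \<eta>"
      "noise.prob {\<omega>\<in>space M. ennreal \<eta> * evidence a n \<omega> \<le> truncation_error a n m \<omega>} < \<eta>"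
    by (auto simp: eventually_sequentially)
  define d where "d k = N * cov m (vec \<psi>0) (vec (\<phi> k)) - inner \<psi>0 (\<phi> k)" for k
  define B1 where "B1 = {\<omega>\<in>space M. \<eta> \<le> \<bar>W \<omega> - (\<Sum>k<m. inner \<psi>0 (\<phi> k) * \<epsilon> k \<omega>)\<bar>}"
  define B2 where "B2 = {\<omega>\<in>space M. ennreal \<eta> * evidence a n \<omega> \<le> truncation_error a n m \<omega>}"
  define B3 where "B3 = {\<omega>\<in>space M. s \<le> \<bar>\<Sum>k<m. d k * \<epsilon> k \<omega>\<bar>}"
  have [measurable]: "B1 \<in> sets M" "B2 \<in> sets M" "B3 \<in> sets M"
    unfolding B1_def B2_def B3_def by measurable
  have sN: "sqrt N > 0" using N by simp
  have "noise.prob B3 \<le> (\<Sum>k<m. (d k)\<^sup>2) / s\<^sup>2" unfolding B3_def by (rule noise.noise_sum_deviation[OF s])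
  also have "\<dots> \<le> (3 * \<zeta> + \<eta>)\<^sup>2 / s\<^sup>2"
    unfolding d_def using m(1) by (intro divide_right_mono noise_estimate) (auto simp: \<tau>_def)
  finally have B3: "noise.prob B3 \<le> (3 * \<zeta> + \<eta>)\<^sup>2 / s\<^sup>2" .
  have "noise.prob (B1 \<union> B2 \<union> B3) \<le> noise.prob B1 + noise.prob B2 + noise.prob B3"
    using measure_Un_le[of "B1 \<union> B2" M B3] measure_Un_le[of B1 M B2] by simp
  then have bad: "noise.prob (B1 \<union> B2 \<union> B3) \<le> 2 * \<eta> + (3 * \<zeta> + \<eta>)\<^sup>2 / s\<^sup>2"
    using m(5,6) B3 unfolding B1_def[symmetric] B2_def[symmetric] by simp
  have close: "\<bar>(\<integral>f. g (sqrt N * inner \<psi>0 (f - f0) - sqrt a * W \<omega>) \<partial>posterior a n \<omega>)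
        - (\<integral>t. g t \<partial>normal_law 0 ((norm \<psi>0)\<^sup>2))\<bar>
      \<le> 6 * \<eta> + s + 9 * (sqrt N * e * \<zeta>) + sqrt ((3 * \<zeta> + \<eta>) * norm \<psi>0)"
    if \<omega>: "\<omega> \<in> space M" "\<omega> \<notin> B1" "\<omega> \<notin> B2" "\<omega> \<notin> B3" and fin: "evidence a n \<omega> < \<infinity>" and g: "bounded_lipschitz g" for \<omega> g
  proof -
    note [measurable] = bounded_lipschitz_measurable[OF g]
    \<comment> \<open>Scaled so that \<open>y k / N\<close> is the observed coordinate, as
      \<open>postmean\<close> expects.\<close>
    define y where "y k = N * white_noise_obs \<phi> f0 \<epsilon> n \<omega> k" for k
    define k0 where "k0 = sqrt N * inner \<psi>0 f0 + sqrt a * W \<omega>"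
    define p where "p = postmean N (feature_cov \<mu> X U) (\<lambda>k. vec (\<phi> k)) y m (vec \<psi>0)"
    define c where "c = cov m (vec \<psi>0) (vec \<psi>0)"
    have c0: "c \<ge> 0" by (simp add: c_def cov.nonneg)
    have wt: "truncated_likelihood a n m \<omega> = weight y m"
      by (rule ext) (simp add: truncated_likelihood_def weight_def feature_def y_def N_eq[symmetric])
    have arg: "sqrt N * inner \<psi>0 (f - f0) - sqrt a * W \<omega> = sqrt N * feature X U (vec \<psi>0) f - k0" for f
      by (simp add: feature_def k0_def inner_diff_right inner_commute[of f] algebra_simps)
    have "(\<integral>f. truncated_likelihood a n m \<omega> f * g (sqrt N * feature X U (vec \<psi>0) f - k0) \<partial>\<mu>)
        = (\<integral>f. truncated_likelihood a n m \<omega> f \<partial>\<mu>) * (\<integral>t. g (sqrt N * t - k0) \<partial>normal_law p c)"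
      unfolding wt p_def c_def by (rule weighted_normal) measurable
    then have ratio: "(\<integral>f. truncated_likelihood a n m \<omega> f * g (sqrt N * feature X U (vec \<psi>0) f - k0) \<partial>\<mu>)
        / (\<integral>f. truncated_likelihood a n m \<omega> f \<partial>\<mu>) = (\<integral>t. g (sqrt N * t - k0) \<partial>normal_law p c)"
      using integral_weight_pos[of y m] unfolding wt by simp
    have "\<bar>(\<integral>f. g (sqrt N * feature X U (vec \<psi>0) f - k0) \<partial>posterior a n \<omega>)
        - (\<integral>t. g (sqrt N * t - k0) \<partial>normal_law p c)\<bar> \<le> 2 * \<eta>"
      unfolding ratio[symmetric]
    proof (rule posterior_truncation[OF fin _ \<eta>])
      show "truncation_error a n m \<omega> < ennreal \<eta> * evidence a n \<omega>" using \<omega> by (auto simp: B2_def not_le)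
      show "integrable \<mu> (truncated_likelihood a n m \<omega>)" unfolding wt by (rule integrable_weight)
      show "0 < (\<integral>f. truncated_likelihood a n m \<omega> f \<partial>\<mu>)" unfolding wt by (rule integral_weight_pos)
    qed (use g in \<open>auto simp: bounded_lipschitz_def\<close>)
    moreover have "\<bar>(\<integral>t. g (sqrt N * t - k0) \<partial>normal_law p c) - (\<integral>t. g t \<partial>normal_law 0 ((norm \<psi>0)\<^sup>2))\<bar>
        \<le> \<bar>sqrt N * p - k0\<bar> + \<bar>sqrt N * sqrt c - sqrt ((norm \<psi>0)\<^sup>2)\<bar>"
      by (rule normal_law_bounded_lipschitz[OF g _ c0]) simp
    moreover have "\<bar>sqrt N * sqrt c - sqrt ((norm \<psi>0)\<^sup>2)\<bar> \<le> \<eta> + sqrt ((3 * \<zeta> + \<eta>) * norm \<psi>0)"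
      using sd_estimate[of m \<eta> \<eta>] m(1,4) by (simp add: \<tau>_def c_def real_sqrt_mult)
    moreover have "\<bar>sqrt N * p - k0\<bar> \<le> 3 * \<eta> + s + 9 * (sqrt N * e * \<zeta>)"
    proof -
      define b where "b = N * cov m (vec \<psi>0) (vec (proj \<phi> m f0)) - inner \<psi>0 f0"
      have "N * (\<Sum>k<m. inner f0 (\<phi> k) * cov m (vec \<psi>0) (vec (\<phi> k))) = N * cov m (vec \<psi>0) (vec (proj \<phi> m f0))"
        unfolding vec_proj cov.sum_right cov.scale_right ..
      then have p_eq: "p = b + inner \<psi>0 f0 + N / sqrt n * (\<Sum>k<m. \<epsilon> k \<omega> * cov m (vec \<psi>0) (vec (\<phi> k)))"
        by (simp add: p_def postmean_def y_def white_noise_obs_def b_def algebra_simps sum.distrib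
            sum_distrib_left)
      \<comment> \<open>The tempered posterior acts as if the noise variance were
        \<open>1 / N\<close>, while it is \<open>1 / n\<close>. The resulting factor
        \<open>sqrt a\<close> also multiplies \<open>W\<close> in the centring, so the leading noise
        terms cancel.\<close>
      have scale: "sqrt N * (N / sqrt n) = sqrt a * N"
        using na by (simp add: N_eq real_sqrt_mult)
      have noise_eq: "N * (\<Sum>k<m. \<epsilon> k \<omega> * cov m (vec \<psi>0) (vec (\<phi> k)))
          = (\<Sum>k<m. d k * \<epsilon> k \<omega>) + (\<Sum>k<m. inner \<psi>0 (\<phi> k) * \<epsilon> k \<omega>)"
        by (simp add: d_def sum_distrib_left sum.distrib[symmetric] algebra_simps)
      define Z where "Z = sqrt a * ((\<Sum>k<m. d k * \<epsilon> k \<omega>)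
          - (W \<omega> - (\<Sum>k<m. inner \<psi>0 (\<phi> k) * \<epsilon> k \<omega>)))"
      have "sqrt N * p = sqrt N * b + sqrt N * inner \<psi>0 f0
          + (sqrt N * (N / sqrt n)) * (\<Sum>k<m. \<epsilon> k \<omega> * cov m (vec \<psi>0) (vec (\<phi> k)))"
        unfolding p_eq by (simp only: distrib_left mult.assoc)
      also have "\<dots> = sqrt N * b + sqrt N * inner \<psi>0 f0
          + sqrt a * ((\<Sum>k<m. d k * \<epsilon> k \<omega>) + (\<Sum>k<m. inner \<psi>0 (\<phi> k) * \<epsilon> k \<omega>))"
        unfolding scale noise_eq[symmetric] by (simp only: mult.assoc)
      finally have eq: "sqrt N * p - k0 = sqrt N * b + Z"
        by (simp add: k0_def Z_def algebra_simps)
      have "\<bar>sqrt N * b\<bar> \<le> sqrt N * (sqrt N * \<tau> m * norm f0 + 9 * e * \<zeta> + norm \<psi>0 * norm (f0 - proj \<phi> m f0))"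
        unfolding b_def abs_mult using bias_estimate[of m "\<tau> m"] sN
        by (intro mult_mono) (auto simp: \<tau>_def)
      also have "\<dots> = N * norm f0 * \<tau> m + 9 * (sqrt N * e * \<zeta>) + sqrt N * norm \<psi>0 * norm (f0 - proj \<phi> m f0)"
      proof -
        have "q * (q * x * y + z + w) = q * q * y * x + q * z + q * w" for q x y z w :: real
          by (simp add: algebra_simps)
        then show ?thesis using N by (simp add: mult.assoc mult.left_commute[of 9])
      qed
      finally have 1: "\<bar>sqrt N * b\<bar> \<le> 2 * \<eta> + 9 * (sqrt N * e * \<zeta>)" using m(2,3) by linarith
      have 2: "\<bar>(\<Sum>k<m. d k * \<epsilon> k \<omega>) - (W \<omega> - (\<Sum>k<m. inner \<psi>0 (\<phi> k) * \<epsilon> k \<omega>))\<bar> \<le> s + \<eta>"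
        using \<omega> unfolding B1_def B3_def by (simp add: not_le)
      have "\<bar>Z\<bar> \<le> 1 * (s + \<eta>)"
        unfolding Z_def abs_mult using na 2 by (intro mult_mono) auto
      with abs_triangle_ineq[of "sqrt N * b" Z] 1
      have "\<bar>sqrt N * b + Z\<bar> \<le> (2 * \<eta> + 9 * (sqrt N * e * \<zeta>)) + (s + \<eta>)"
        by (simp only: mult_1_left)
      then show ?thesis unfolding eq by simp
    qed
    ultimately show ?thesis unfolding arg by linarith
  qed
  show ?thesis
  proof (rule bexI[of _ "space M - (B1 \<union> B2 \<union> B3)"], intro conjI ballI impI allI)
    have "space M - (space M - (B1 \<union> B2 \<union> B3)) = B1 \<union> B2 \<union> B3"
      by (auto simp: B1_def B2_def B3_def)
    then show "measure M (space M - (space M - (B1 \<union> B2 \<union> B3))) \<le> 2 * \<eta> + (3 * \<zeta> + \<eta>)\<^sup>2 / s\<^sup>2"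
      using bad by simp
  qed (use close in \<open>auto simp: W_def\<close>)
qed

end

section \<open>From the linear functional to the functional of the theorem\<close>

lemma rkhs_representer:
  assumes "sets \<mu> = sets borel" and "h \<in> rkhs \<mu>"
  obtains \<xi> where "\<xi> \<in> dual_closure \<mu>" "has_pettis_integral \<mu> (\<lambda>w. \<xi> w *\<^sub>R w) h"
    "rkhs_norm \<mu> h = sqrt (\<integral>w. (\<xi> w)\<^sup>2 \<partial>\<mu>)"
  using assms rkhs_norm_eq[OF assms(1)] by (auto simp: rkhs_def)

lemma o_P_1_bad_event:
  assumes "o_P_1 M X" "0 < d"
  obtains E where "\<And>n. E n \<in> sets M" "\<And>n \<omega>. \<omega> \<in> space M \<Longrightarrow> \<omega> \<notin> E n \<Longrightarrow> \<bar>X n \<omega>\<bar> \<le> ereal d"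
    "(\<lambda>n. measure M (E n)) \<longlonglongrightarrow> 0"
proof -
  obtain E where E: "\<forall>n. E n \<in> sets M \<and> {\<omega> \<in> space M. ereal d < \<bar>X n \<omega>\<bar>} \<subseteq> E n"
    "(\<lambda>n. measure M (E n)) \<longlonglongrightarrow> 0"
    using assms unfolding o_P_1_def by blast
  show thesis by (rule that[of E]) (use E not_less in blast)+
qed

theorem theorem2p9:
  fixes M :: "'w measure" and \<epsilon> :: "nat \<Rightarrow> 'w \<Rightarrow> real"
    and \<phi> :: "nat \<Rightarrow> L2" and f0 :: L2 and \<mu> :: "L2 measure"
    and \<alpha> :: "nat \<Rightarrow> real" and eps :: "nat \<Rightarrow> real"
    and \<psi> :: "L2 \<Rightarrow> real" and \<psi>0 :: L2 and r :: "L2 \<Rightarrow> L2 \<Rightarrow> real"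
    and A :: "nat \<Rightarrow> L2 set" and \<psi>s :: "nat \<Rightarrow> L2" and \<zeta> :: "nat \<Rightarrow> real"
    and Y :: "nat \<Rightarrow> 'w \<Rightarrow> nat \<Rightarrow> real" and post :: "nat \<Rightarrow> 'w \<Rightarrow> L2 measure"
    and \<psi>hat :: "nat \<Rightarrow> 'w \<Rightarrow> real"
  assumes "Y = white_noise_obs \<phi> f0 \<epsilon>"
    and "post = (\<lambda>n \<omega>. tempered_posterior \<mu> \<phi> (\<alpha> n) n (Y n \<omega>))"
    and "\<psi>hat = (\<lambda>n \<omega>. \<psi> f0 + 1 / sqrt (real n) * (\<Sum>k. inner \<psi>0 (\<phi> k) * \<epsilon> k \<omega>))"
    and "prob_space M"
    and "iid_std_normal M \<epsilon>"
    and "orthonormal_basis \<phi>"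
    and "\<forall>n\<ge>1. 0 < \<alpha> n \<and> \<alpha> n \<le> 1"
    and "filterlim (\<lambda>n. real n * \<alpha> n) at_top sequentially"
    and "mean_zero_gaussian \<mu>"
    and "eps \<longlonglongrightarrow> 0"
    and "\<forall>n\<ge>1. concentration_function \<mu> f0 (eps n) \<le> ereal (real n * \<alpha> n * (eps n)\<^sup>2)"
    and "\<psi> \<in> borel_measurable borel"
    and "\<forall>f. \<psi> f = \<psi> f0 + inner \<psi>0 (f - f0) + r f f0"
    and "\<forall>n\<ge>1. A n \<in> sets borel \<and> A n \<subseteq> {f. norm (f - f0) \<le> eps n}"
    and "o_P_1 M (\<lambda>n \<omega>. ereal (measure (post n \<omega>) (A n) - 1))"
    and "\<forall>t::real. o_P_1 M (\<lambda>n \<omega>. SUP f\<in>A n. ereal \<bar>t * sqrt (real n * \<alpha> n) * r f f0\<bar>)"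
    and "\<forall>n\<ge>1. \<psi>s n \<in> rkhs \<mu>"
    and "\<zeta> \<longlonglongrightarrow> 0"
    and "\<forall>n\<ge>1. norm (\<psi>s n - \<psi>0) \<le> \<zeta> n"
    and "\<forall>n\<ge>1. rkhs_norm \<mu> (\<psi>s n) \<le> sqrt (real n * \<alpha> n) * \<zeta> n"
    and "(\<lambda>n. sqrt (real n * \<alpha> n) * eps n * \<zeta> n) \<longlonglongrightarrow> 0"
  shows "weakly_in_prob M
           (\<lambda>n \<omega>. distr (post n \<omega>) borel (\<lambda>f. sqrt (real n * \<alpha> n) * (\<psi> f - \<psi>hat n \<omega>)))
           (normal_law 0 ((norm \<psi>0)\<^sup>2))"
proof -
  note Y = assms(1) and post = assms(2) and hat = assms(3) and alpha = assms(7)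
  interpret white_noise_model M \<epsilon> \<mu> \<phi> f0
    using assms(4,5,6,9)
    by (simp add: white_noise_model_def white_noise_model_axioms_def std_noise_def
        std_noise_axioms_def centred_gaussian_def)
  have post_eq: "post n \<omega> = posterior (\<alpha> n) n \<omega>" for n \<omega>
    by (simp add: post Y posterior_def)
  define N where "N n = real n * \<alpha> n" for n
  define \<eta> where "\<eta> n = 1 / real (Suc n)" for n
  have \<eta>: "\<eta> n > 0" for n by (simp add: \<eta>_def)
  have \<eta>_lim: "\<eta> \<longlonglongrightarrow> 0" unfolding \<eta>_def[abs_def] by (rule LIMSEQ_Suc[OF lim_1_over_n])
  define W where "W \<omega> = (\<Sum>k. inner \<psi>0 (\<phi> k) * \<epsilon> k \<omega>)" for \<omega>
  \<comment> \<open>For fixed \<open>s\<close> this tends to \<open>s\<close> as \<open>n\<close>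
    grows. A fixed \<open>s\<close> also lets the probability bound
    \<open>(3 * \<zeta> n + \<eta> n)\<^sup>2 / s\<^sup>2\<close> vanish.\<close>
  define R where "R s n = 6 * \<eta> n + s + 9 * (sqrt (N n) * eps n * \<zeta> n) + sqrt ((3 * \<zeta> n + \<eta> n) * norm \<psi>0)" for s n
  have close: "\<exists>G\<in>sets M. measure M (space M - G) \<le> 2 * \<eta> n + (3 * \<zeta> n + \<eta> n)\<^sup>2 / s\<^sup>2 \<and>
    (\<forall>\<omega>\<in>G. evidence (\<alpha> n) n \<omega> < \<infinity> \<longrightarrow> (\<forall>g. bounded_lipschitz g \<longrightarrow>
      \<bar>(\<integral>f. g (sqrt (N n) * inner \<psi>0 (f - f0) - sqrt (\<alpha> n) * W \<omega>) \<partial>posterior (\<alpha> n) n \<omega>)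
        - (\<integral>t. g t \<partial>normal_law 0 ((norm \<psi>0)\<^sup>2))\<bar> \<le> R s n))" if n: "1 \<le> n" and s: "0 < s" for n s
  proof -
    have Nn: "0 < N n" using n alpha by (simp add: N_def)
    have conc: "concentration_function \<mu> f0 (eps n) \<le> ereal (N n * (eps n)\<^sup>2)"
      using assms(11) n by (simp add: N_def)
    obtain u where u: "u \<in> rkhs \<mu>" "norm (u - f0) < eps n" "rkhs_norm \<mu> u \<le> 2 * sqrt (N n) * eps n"
      using concentration_function_approximation[OF prior.prob_space_axioms Nn conc] by blast
    obtain U where U: "U \<in> dual_closure \<mu>" "has_pettis_integral \<mu> (\<lambda>w. U w *\<^sub>R w) u"
      "rkhs_norm \<mu> u = sqrt (\<integral>w. (U w)\<^sup>2 \<partial>\<mu>)"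
      using rkhs_representer[OF prior.sets_\<mu> u(1)] by blast
    have "\<psi>s n \<in> rkhs \<mu>" using assms(17) n by blast
    then obtain X where X: "X \<in> dual_closure \<mu>" "has_pettis_integral \<mu> (\<lambda>w. X w *\<^sub>R w) (\<psi>s n)"
      "rkhs_norm \<mu> (\<psi>s n) = sqrt (\<integral>w. (X w)\<^sup>2 \<partial>\<mu>)"
      using rkhs_representer[OF prior.sets_\<mu>] by blast
    interpret posterior_estimates M \<epsilon> \<mu> \<phi> f0 "N n" \<psi>0 "\<psi>s n" u X U "\<zeta> n" "eps n"
    proof
      show "norm (\<psi>s n - \<psi>0) \<le> \<zeta> n" using assms(19) n by blast
      show "sqrt (\<integral>w. (X w)\<^sup>2 \<partial>\<mu>) \<le> sqrt (N n) * \<zeta> n" using assms(20) n unfolding X(3)[symmetric] N_def by blast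
      show "norm (u - f0) \<le> eps n" using u(2) by simp
      show "sqrt (\<integral>w. (U w)\<^sup>2 \<partial>\<mu>) \<le> 2 * sqrt (N n) * eps n" using u(3) U(3) by simp
    qed (use Nn X U in auto)
    show ?thesis
      unfolding W_def R_def
      using posterior_close_to_normal[of n "\<alpha> n" "\<eta> n" s] n alpha \<eta> s by (simp add: N_def)
  qed
  have r_eq: "r f f0 = \<psi> f - \<psi> f0 - inner \<psi>0 (f - f0)" for f
    using assms(13) by (metis add_diff_cancel_left' diff_add_eq_diff_diff_swap diff_diff_add)
  show ?thesis
    unfolding weakly_in_prob_def o_P_1_def
  proof (intro allI impI)
    fix \<delta> :: real assume \<delta>: "0 < \<delta>"
    \<comment> \<open>\<open>d < 1\<close> forces positive posterior mass on \<open>A n\<close>,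
      hence finite evidence. The remainder and the complement of \<open>A n\<close> will cost
      \<open>3 * d \<le> 3 * \<delta> / 8\<close>, leaving room for
      \<open>R s n < \<delta> / 2\<close>.\<close>
    define d where "d = min (\<delta> / 8) (1 / 2)"
    have d: "0 < d" "d \<le> \<delta> / 8" "d < 1" using \<delta> by (simp_all add: d_def)
    define s where "s = \<delta> / 8"
    have s: "0 < s" using \<delta> by (simp add: s_def)
    obtain E1 where E1: "\<And>n. E1 n \<in> sets M"
      "\<And>n \<omega>. \<omega> \<in> space M \<Longrightarrow> \<omega> \<notin> E1 n \<Longrightarrow> \<bar>ereal (measure (post n \<omega>) (A n) - 1)\<bar> \<le> ereal d"
      "(\<lambda>n. measure M (E1 n)) \<longlonglongrightarrow> 0"
      using o_P_1_bad_event[OF assms(15) d(1)] by blast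
    obtain E2 where E2: "\<And>n. E2 n \<in> sets M"
      "\<And>n \<omega>. \<omega> \<in> space M \<Longrightarrow> \<omega> \<notin> E2 n \<Longrightarrow>
        \<bar>SUP f\<in>A n. ereal \<bar>1 * sqrt (real n * \<alpha> n) * r f f0\<bar>\<bar> \<le> ereal d"
      "(\<lambda>n. measure M (E2 n)) \<longlonglongrightarrow> 0"
      using o_P_1_bad_event[OF assms(16)[rule_format, of 1] d(1)] by blast
    obtain G where G: "\<And>n. 1 \<le> n \<Longrightarrow> G n \<in> sets M"
      "\<And>n. 1 \<le> n \<Longrightarrow> measure M (space M - G n) \<le> 2 * \<eta> n + (3 * \<zeta> n + \<eta> n)\<^sup>2 / s\<^sup>2"
      "\<And>n \<omega> g. 1 \<le> n \<Longrightarrow> \<omega> \<in> G n \<Longrightarrow> evidence (\<alpha> n) n \<omega> < \<infinity> \<Longrightarrow> bounded_lipschitz g \<Longrightarrow>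
        \<bar>(\<integral>f. g (sqrt (N n) * inner \<psi>0 (f - f0) - sqrt (\<alpha> n) * W \<omega>) \<partial>posterior (\<alpha> n) n \<omega>)
          - (\<integral>t. g t \<partial>normal_law 0 ((norm \<psi>0)\<^sup>2))\<bar> \<le> R s n"
      using close[OF _ s] by metis
    have "R s \<longlonglongrightarrow> 6 * 0 + s + 9 * 0 + sqrt ((3 * 0 + 0) * norm \<psi>0)"
      unfolding R_def[abs_def] N_def by (intro tendsto_intros \<eta>_lim assms(18,21))
    then have "eventually (\<lambda>n. R s n < \<delta> / 2) sequentially"
      using \<delta> by (intro order_tendstoD(2)) (auto simp: s_def)
    then obtain n0 where n0: "\<And>n. n0 \<le> n \<Longrightarrow> R s n < \<delta> / 2" by (auto simp: eventually_sequentially)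
    define n1 where "n1 = max n0 1"
    \<comment> \<open>For the finitely many \<open>n\<close> below \<open>n1\<close> the whole space
      serves as bad event; only the limit of the probabilities matters.\<close>
    define E where "E n = (if n1 \<le> n then E1 n \<union> E2 n \<union> (space M - G n) else space M)" for n
    have E_sets: "E n \<in> sets M" for n
      using E1(1) E2(1) G(1)[of n] by (auto simp: E_def n1_def)
    have bound: "\<bar>d_BL (distr (post n \<omega>) borel (\<lambda>f. sqrt (real n * \<alpha> n) * (\<psi> f - \<psi>hat n \<omega>)))
        (normal_law 0 ((norm \<psi>0)\<^sup>2))\<bar> \<le> \<delta>" if \<omega>: "\<omega> \<in> space M" "\<omega> \<notin> E n" for n \<omega>
    proof (rule abs_d_BL_le)
      fix g assume g: "bounded_lipschitz g"
      note [measurable] = bounded_lipschitz_measurable[OF g]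
      have "n1 \<le> n" using \<omega> by (auto simp: E_def split: if_splits)
      then have n: "1 \<le> n" "n0 \<le> n" and nE: "\<omega> \<notin> E1 n" "\<omega> \<notin> E2 n" "\<omega> \<in> G n"
        using \<omega> by (auto simp: E_def n1_def)
      have mass: "\<bar>measure (post n \<omega>) (A n) - 1\<bar> \<le> d"
        using E1(2)[OF \<omega>(1) nE(1)] by simp
      \<comment> \<open>With infinite evidence the posterior would be the zero measure,
        contradicting a mass of at least \<open>1 - d\<close> on \<open>A n\<close>.\<close>
      have fin: "evidence (\<alpha> n) n \<omega> < \<infinity>"
        using mass d(3) posterior_null[of "\<alpha> n" n \<omega> "A n"]
        by (cases "evidence (\<alpha> n) n \<omega> = \<infinity>") (auto simp: post_eq less_top)
      interpret post: prob_space "post n \<omega>"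
        unfolding post_eq by (rule prob_space_posterior[OF fin])
      have sets_post [measurable_cong]: "sets (post n \<omega>) = sets borel"
        by (simp add: post_eq sets_posterior prior.sets_\<mu>)
      have A [measurable]: "A n \<in> sets (post n \<omega>)" using assms(14) n(1) sets_post by blast
      have \<psi>_meas [measurable]: "\<psi> \<in> borel_measurable (post n \<omega>)"
        using assms(12) measurable_cong_sets[OF sets_post refl] by blast
      have [measurable]: "(\<lambda>f. inner \<psi>0 (f - f0)) \<in> borel_measurable (post n \<omega>)"
      proof -
        have "(\<lambda>f. inner \<psi>0 (f - f0)) \<in> borel_measurable borel"
          by (intro borel_measurable_continuous_onI continuous_intros)
        then show ?thesis using measurable_cong_sets[OF sets_post refl] by blast
      qed
      define S where "S f = sqrt (N n) * inner \<psi>0 (f - f0) - sqrt (\<alpha> n) * W \<omega>" for f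
      define T where "T f = sqrt (N n) * (\<psi> f - \<psi>hat n \<omega>)" for f
      have [measurable]: "S \<in> borel_measurable (post n \<omega>)" "T \<in> borel_measurable (post n \<omega>)"
        unfolding S_def[abs_def] T_def[abs_def] by measurable
      have "sqrt (N n) * (1 / sqrt (real n)) = sqrt (\<alpha> n)"
        using n by (simp add: N_def real_sqrt_mult)
      then have "sqrt (N n) * (1 / sqrt (real n) * W \<omega>) = sqrt (\<alpha> n) * W \<omega>"
        by (simp only: mult.assoc[symmetric])
      then have TS: "T f = S f + sqrt (N n) * r f f0" for f
        unfolding T_def S_def r_eq hat W_def[symmetric] by (simp add: algebra_simps)
      have rem: "\<bar>sqrt (N n) * r f f0\<bar> \<le> d" if "f \<in> A n" for f
      proof -
        have "ereal \<bar>1 * sqrt (real n * \<alpha> n) * r f f0\<bar> \<le> (SUP f\<in>A n. ereal \<bar>1 * sqrt (real n * \<alpha> n) * r f f0\<bar>)"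
          using that by (rule SUP_upper)
        also have "\<dots> \<le> \<bar>SUP f\<in>A n. ereal \<bar>1 * sqrt (real n * \<alpha> n) * r f f0\<bar>\<bar>"
        proof -
          have "x \<le> \<bar>x\<bar>" for x :: ereal by (cases x) auto
          then show ?thesis .
        qed
        also note E2(2)[OF \<omega>(1) nE(2)]
        finally show ?thesis by (simp add: N_def)
      qed
      have g_int: "integrable (post n \<omega>) (\<lambda>f. g (F f))" if [measurable]: "F \<in> borel_measurable (post n \<omega>)" for F
        by (rule post.integrable_const_bound[where B=1]) (use g in \<open>auto simp: bounded_lipschitz_def\<close>)
      have ind_int: "integrable (post n \<omega>) (indicator (space (post n \<omega>) - A n) :: L2 \<Rightarrow> real)"
        by (rule integrable_real_indicator) (auto simp: less_top[symmetric])
      have "\<bar>(\<integral>f. g (T f) \<partial>post n \<omega>) - (\<integral>f. g (S f) \<partial>post n \<omega>)\<bar> = \<bar>\<integral>f. g (T f) - g (S f) \<partial>post n \<omega>\<bar>"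
        by (simp add: g_int)
      also have "\<dots> \<le> (\<integral>f. \<bar>g (T f) - g (S f)\<bar> \<partial>post n \<omega>)" by (rule integral_abs_bound)
      also have "\<dots> \<le> (\<integral>f. d + 2 * indicator (space (post n \<omega>) - A n) f \<partial>post n \<omega>)"
      proof (rule integral_mono)
        show "integrable (post n \<omega>) (\<lambda>f. \<bar>g (T f) - g (S f)\<bar>)"
          by (intro Bochner_Integration.integrable_abs Bochner_Integration.integrable_diff g_int) measurable
        show "integrable (post n \<omega>) (\<lambda>f. d + 2 * indicator (space (post n \<omega>) - A n) f)"
          using ind_int by simp
        fix f assume f: "f \<in> space (post n \<omega>)"
        show "\<bar>g (T f) - g (S f)\<bar> \<le> d + 2 * indicator (space (post n \<omega>) - A n) f"
        proof (cases "f \<in> A n")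
          case True
          have "\<bar>g (T f) - g (S f)\<bar> \<le> \<bar>T f - S f\<bar>" using g by (simp add: bounded_lipschitz_def)
          also have "\<dots> \<le> d" using rem[OF True] by (simp add: TS)
          finally show ?thesis using True by simp
        next
          case False
          have "\<bar>g (T f)\<bar> \<le> 1" "\<bar>g (S f)\<bar> \<le> 1" using g by (simp_all add: bounded_lipschitz_def)
          then have "\<bar>g (T f) - g (S f)\<bar> \<le> 2" by linarith
          then show ?thesis using False f d(1) by simp
        qed
      qed
      also have "\<dots> = d + 2 * (1 - measure (post n \<omega>) (A n))"
        using ind_int by (simp add: post.prob_space post.prob_compl)
      also have "\<dots> \<le> 3 * d" using mass by (simp add: abs_le_iff)
      finally have 1: "\<bar>(\<integral>f. g (T f) \<partial>post n \<omega>) - (\<integral>f. g (S f) \<partial>post n \<omega>)\<bar> \<le> 3 * d" .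
      have 2: "\<bar>(\<integral>f. g (S f) \<partial>post n \<omega>) - (\<integral>t. g t \<partial>normal_law 0 ((norm \<psi>0)\<^sup>2))\<bar> \<le> R s n"
        unfolding S_def post_eq by (rule G(3)[OF n(1) nE(3) fin g])
      have "(\<integral>x. g x \<partial>distr (post n \<omega>) borel T) = (\<integral>f. g (T f) \<partial>post n \<omega>)"
        by (rule integral_distr) measurable
      then show "\<bar>(\<integral>x. g x \<partial>distr (post n \<omega>) borel (\<lambda>f. sqrt (real n * \<alpha> n) * (\<psi> f - \<psi>hat n \<omega>)))
          - (\<integral>x. g x \<partial>normal_law 0 ((norm \<psi>0)\<^sup>2))\<bar> \<le> \<delta>"
        using 1 2 n0[OF n(2)] d(2) \<delta> unfolding T_def[abs_def] N_def by linarith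
    qed
    have "(\<lambda>n. measure M (E n)) \<longlonglongrightarrow> 0"
    proof (rule Lim_null_comparison)
      show "(\<lambda>n. measure M (E1 n) + measure M (E2 n) + (2 * \<eta> n + (3 * \<zeta> n + \<eta> n)\<^sup>2 / s\<^sup>2)) \<longlonglongrightarrow> 0"
      proof -
        have "(\<lambda>n. measure M (E1 n) + measure M (E2 n) + (2 * \<eta> n + (3 * \<zeta> n + \<eta> n)\<^sup>2 / s\<^sup>2))
            \<longlonglongrightarrow> 0 + 0 + (2 * 0 + (3 * 0 + 0)\<^sup>2 / s\<^sup>2)"
          by (intro tendsto_intros E1(3) E2(3) \<eta>_lim assms(18)) (use s in simp)
        then show ?thesis by simp
      qed
      show "eventually (\<lambda>n. norm (measure M (E n)) \<le>
          measure M (E1 n) + measure M (E2 n) + (2 * \<eta> n + (3 * \<zeta> n + \<eta> n)\<^sup>2 / s\<^sup>2)) sequentially"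
        using eventually_ge_at_top[of n1]
      proof eventually_elim
        case (elim n)
        then have n: "1 \<le> n" by (simp add: n1_def)
        have "measure M (E n) = measure M (E1 n \<union> E2 n \<union> (space M - G n))" using elim by (simp add: E_def)
        also have "\<dots> \<le> measure M (E1 n \<union> E2 n) + measure M (space M - G n)"
          using E1(1) E2(1) G(1)[OF n] by (intro measure_Un_le) auto
        also have "\<dots> \<le> measure M (E1 n) + measure M (E2 n) + measure M (space M - G n)"
          using E1(1) E2(1) by (intro add_right_mono measure_Un_le) auto
        finally show ?case using G(2)[OF n] by simp
      qed
    qed
    moreover have "{\<omega> \<in> space M. ereal \<delta> < \<bar>ereal (d_BL (distr (post n \<omega>) borel
        (\<lambda>f. sqrt (real n * \<alpha> n) * (\<psi> f - \<psi>hat n \<omega>))) (normal_law 0 ((norm \<psi>0)\<^sup>2)))\<bar>} \<subseteq> E n" for n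
      using bound[of _ n] by (force simp: not_less)
    ultimately show "\<exists>E. (\<forall>n. E n \<in> sets M \<and> {\<omega> \<in> space M. ereal \<delta> < \<bar>ereal (d_BL (distr (post n \<omega>) borel
        (\<lambda>f. sqrt (real n * \<alpha> n) * (\<psi> f - \<psi>hat n \<omega>))) (normal_law 0 ((norm \<psi>0)\<^sup>2)))\<bar>} \<subseteq> E n) \<and>
        (\<lambda>n. measure M (E n)) \<longlonglongrightarrow> 0"
      using E_sets by blast
  qed
qed

end
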